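(* Let $K$ be a compact Hausdorff space and $T:K\to K$ a homeomorphism. Let $\alpha_T$ be the $^*$-automorphism of $C(K)$ given by $\alpha_T(f)=f\circ T$ for all $f\in C(K)$. Then $\mathrm{ht}(\alpha_T)=\mathrm{hc}(\alpha_T)=\mathrm{h}_{\mathrm{top}}(T)$, where $\mathrm{ht}$ is Voiculescu–Brown entropy, $\mathrm{hc}$ is CA entropy and $\mathrm{h}_{\mathrm{top}}$ is topological entropy.
   Context: $C(K)$ denotes complex-valued continuous functions. $\mathrm{h}_{\mathrm{top}}(T)$ is the usual topological entropy: the supremum over finite open covers $\mathcal{W}$ of $K$ of $\lim_n\frac1n\log N(\mathcal{W}\vee T^{-1}\mathcal{W}\vee\cdots\vee T^{-(n-1)}\mathcal{W})$, where $N(\cdot)$ is the smallest cardinality of a subcover. CA entropy: For a bounded linear map $\gamma:X\to Y$ of (complex) Banach spaces, a finite set $\Omega\subseteq X$ and $\delta>0$, let $\mathrm{CA}(\gamma,\Omega,\delta)$ be the collection of triples $(\phi,\psi,d)$ where $d$ is a positive integer and $\phi:X\to\ell_\infty^d$, $\psi:\ell_\infty^d\to Y$ are contractive (norm $\le1$) linear maps with $\|\psi\circ\phi(x)-\gamma(x)\|<\delta$ for all $x\in\Omega$. A CA embedding of $X$ is an isometric linear map $\iota$ from $X$ into a Banach space $Y$ such that $\mathrm{CA}(\iota,\Omega,\delta)\neq\emptyset$ for all finite $\Omega\subseteq X$ and $\delta>0$; every Banach space has one (e.g. the evaluation map $X\to C(B_1(X^* ))$, where $B_1(X^* )$ is the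 weak$^*$ compact unit ball of the dual). Set $\mathrm{rc}(\Omega,\delta)=\inf\{d:(\phi,\psi,d)\in\mathrm{CA}(\iota,\Omega,\delta)\}$, which does not depend on the CA embedding $\iota$. For an isometric (surjective linear) automorphism $\alpha$ of $X$ put $\mathrm{hc}(\alpha,\Omega,\delta)=\limsup_{n\to\infty}\frac1n\log\mathrm{rc}(\Omega\cup\alpha\Omega\cup\cdots\cup\alpha^{n-1}\Omega,\delta)$, $\mathrm{hc}(\alpha,\Omega)=\sup_{\delta>0}\mathrm{hc}(\alpha,\Omega,\delta)$, and $\mathrm{hc}(\alpha)=\sup_\Omega\mathrm{hc}(\alpha,\Omega)$ over finite $\Omega\subseteq X$. Voiculescu–Brown entropy of a $^*$-automorphism $\alpha$ of an exact $C^*$-algebra $A$: let $\pi:A\to\mathcal{B}(\mathcal{H})$ be a faithful representation; for finite $\Omega\subseteq A$ and $\delta>0$ let $\mathrm{rcp}(\Omega,\delta)$ be the infimum of $\mathrm{rank}\,B$ over triples $(\phi,\psi,B)$ with $B$ a finite-dimensional $C^*$-algebra and $\phi:A\to B$, $\psi:B\to\mathcal{B}(\mathcal{H})$ contractive completely positive maps with $\|\psi\circ\phi(x)-\pi(x)\|<\delta$ for all $x\in\Omega$ (the rank of $B$ is the dimension of a maximal abelian $^*$-subalgebra; the infimum is independent of $\pi$). Then $\mathrm{ht}(\alpha)=\sup_\Omega\sup_{\delta>0}\limsup_{n\to\infty}\frac1n\log\mathrm{rcp}(\Omega\cup\alpha\Omega\cup\cdots\cup\alpha^{n-1}\Omega,\delta)$.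 *)

theory Defs
  imports "HOL-Analysis.Analysis" "HOL-Library.Function_Algebras"
begin

section \<open>Complex vector spaces and Hilbert spaces\<close>

class complex_vector = ab_group_add +
  fixes scaleC :: "complex \<Rightarrow> 'a \<Rightarrow> 'a" (infixr "*\<^sub>C" 75)
  assumes scaleC_add_right: "c *\<^sub>C (x + y) = c *\<^sub>C x + c *\<^sub>C y"
    and scaleC_add_left: "(c + d) *\<^sub>C x = c *\<^sub>C x + d *\<^sub>C x"
    and scaleC_scaleC: "c *\<^sub>C (d *\<^sub>C x) = (c * d) *\<^sub>C x"
    and scaleC_one: "1 *\<^sub>C x = x"

interpretation complex_vector:
  vector_space "scaleC :: complex \<Rightarrow> 'a \<Rightarrow> 'a :: complex_vector"
  by unfold_locales (rule scaleC_add_right scaleC_add_left scaleC_scaleC scaleC_one)+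

instantiation complex :: complex_vector
begin
definition scaleC_complex :: "complex \<Rightarrow> complex \<Rightarrow> complex" where
  "scaleC_complex c z = c * z"
instance
  by standard (simp_all add: scaleC_complex_def algebra_simps)
end

instantiation "fun" :: (type, complex_vector) complex_vector
begin
definition scaleC_fun :: "complex \<Rightarrow> ('a \<Rightarrow> 'b) \<Rightarrow> 'a \<Rightarrow> 'b" where
  "scaleC_fun c f = (\<lambda>x. c *\<^sub>C f x)"
instance
  by standard (simp_all add: scaleC_fun_def fun_eq_iff scaleC_add_right scaleC_add_left
      scaleC_scaleC scaleC_one)
end

text \<open>The inner product is linear in the first argument.  The last axiom contains positive
  definiteness, since \<^term>\<open>norm\<close> is a norm.\<close>

class chilbert_space = complex_vector + banach +
  fixes cinner :: "'a \<Rightarrow> 'a \<Rightarrow> complex"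
  assumes scaleR_eq_scaleC: "scaleR r x = complex_of_real r *\<^sub>C x"
    and cinner_commute: "cinner x y = cnj (cinner y x)"
    and cinner_add_left: "cinner (x + y) z = cinner x z + cinner y z"
    and cinner_scaleC_left: "cinner (c *\<^sub>C x) y = c * cinner x y"
    and cinner_self: "cinner x x = complex_of_real ((norm x)\<^sup>2)"

instantiation complex :: chilbert_space
begin
definition cinner_complex :: "complex \<Rightarrow> complex \<Rightarrow> complex" where
  "cinner_complex z w = z * cnj w"
instance
  by standard (simp_all add: cinner_complex_def scaleC_complex_def scaleR_conv_of_real
      algebra_simps flip: complex_norm_square)
end

section \<open>Banach spaces and C*-algebras\<close>

text \<open>Addition and scalar multiplication are those of the ambient type; the carrier and the
  norm (and product and adjoint) are data.  This allows quantification over spaces and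
  algebras, such as \<open>\<ell>\<^sub>\<infinity>\<^sup>d\<close> for varying \<open>d\<close>, within one type.\<close>

record 'a nspace =
  car :: "'a set"
  nrm :: "'a \<Rightarrow> real"

record 'a salgebra = "'a nspace" +
  mul :: "'a \<Rightarrow> 'a \<Rightarrow> 'a"
  adj :: "'a \<Rightarrow> 'a"

definition cbanach :: "('a::complex_vector, 'm) nspace_scheme \<Rightarrow> bool" where
  "cbanach X \<longleftrightarrow> complex_vector.subspace (car X)
    \<and> (\<forall>x\<in>car X. 0 \<le> nrm X x \<and> (nrm X x = 0 \<longleftrightarrow> x = 0))
    \<and> (\<forall>x\<in>car X. \<forall>y\<in>car X. nrm X (x + y) \<le> nrm X x + nrm X y)
    \<and> (\<forall>c. \<forall>x\<in>car X. nrm X (c *\<^sub>C x) = cmod c * nrm X x)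
    \<and> (\<forall>s::nat \<Rightarrow> 'a. range s \<subseteq> car X \<longrightarrow>
         (\<forall>e>0. \<exists>N. \<forall>m\<ge>N. \<forall>n\<ge>N. nrm X (s m - s n) < e) \<longrightarrow>
         (\<exists>x\<in>car X. (\<lambda>n. nrm X (s n - x)) \<longlonglongrightarrow> 0))"

definition cstar_algebra :: "('a::complex_vector, 'm) salgebra_scheme \<Rightarrow> bool" where
  "cstar_algebra A \<longleftrightarrow> cbanach A
    \<and> (\<forall>x\<in>car A. adj A x \<in> car A \<and> adj A (adj A x) = x)
    \<and> (\<forall>c. \<forall>x\<in>car A. adj A (c *\<^sub>C x) = cnj c *\<^sub>C adj A x)
    \<and> (\<forall>x\<in>car A. \<forall>y\<in>car A. adj A (x + y) = adj A x + adj A y)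
    \<and> (\<forall>x\<in>car A. \<forall>y\<in>car A. mul A x y \<in> car A)
    \<and> (\<forall>x\<in>car A. \<forall>y\<in>car A. adj A (mul A x y) = mul A (adj A y) (adj A x))
    \<and> (\<forall>c. \<forall>x\<in>car A. \<forall>y\<in>car A.
         mul A (c *\<^sub>C x) y = c *\<^sub>C mul A x y \<and> mul A x (c *\<^sub>C y) = c *\<^sub>C mul A x y)
    \<and> (\<forall>x\<in>car A. \<forall>y\<in>car A. \<forall>z\<in>car A.
         mul A (x + y) z = mul A x z + mul A y z
         \<and> mul A x (y + z) = mul A x y + mul A x z
         \<and> mul A (mul A x y) z = mul A x (mul A y z))
    \<and> (\<forall>x\<in>car A. \<forall>y\<in>car A. nrm A (mul A x y) \<le> nrm A x * nrm A y)
    \<and> (\<forall>x\<in>car A. nrm A (mul A (adj A x) x) = (nrm A x)\<^sup>2)"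

definition clinear_on ::
    "('a::complex_vector, 'm) nspace_scheme \<Rightarrow> ('b::complex_vector, 'n) nspace_scheme \<Rightarrow>
      ('a \<Rightarrow> 'b) \<Rightarrow> bool" where
  "clinear_on X Y f \<longleftrightarrow> f ` car X \<subseteq> car Y
    \<and> (\<forall>x\<in>car X. \<forall>y\<in>car X. f (x + y) = f x + f y)
    \<and> (\<forall>c. \<forall>x\<in>car X. f (c *\<^sub>C x) = c *\<^sub>C f x)"

definition contractive where
  "contractive X Y f \<longleftrightarrow> clinear_on X Y f \<and> (\<forall>x\<in>car X. nrm Y (f x) \<le> nrm X x)"

definition isometric where
  "isometric X Y f \<longleftrightarrow> clinear_on X Y f \<and> (\<forall>x\<in>car X. nrm Y (f x) = nrm X x)"

definition star_hom where
  "star_hom A B f \<longleftrightarrow> clinear_on A B f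
    \<and> (\<forall>x\<in>car A. \<forall>y\<in>car A. f (mul A x y) = mul B (f x) (f y))
    \<and> (\<forall>x\<in>car A. f (adj A x) = adj B (f x))"

definition cfun :: "('k::topological_space \<Rightarrow> complex) salgebra" where
  "cfun = \<lparr>car = {f. continuous_on UNIV f}, nrm = (\<lambda>f. SUP x. cmod (f x)),
     mul = (\<lambda>f g x. f x * g x), adj = (\<lambda>f x. cnj (f x))\<rparr>"

definition linf :: "nat \<Rightarrow> (nat \<Rightarrow> complex) nspace" where
  "linf d = \<lparr>car = {v. \<forall>i\<ge>d. v i = 0}, nrm = (\<lambda>v. MAX i\<in>{..<d}. cmod (v i))\<rparr>"

definition hilbert_adjoint :: "('h::chilbert_space \<Rightarrow> 'h) \<Rightarrow> 'h \<Rightarrow> 'h" where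
  "hilbert_adjoint S = (THE R. \<forall>x y. cinner (S x) y = cinner x (R y))"

definition bounded_ops :: "('h::chilbert_space \<Rightarrow> 'h) salgebra" where
  "bounded_ops = \<lparr>car = {S. bounded_linear S \<and> (\<forall>c x. S (c *\<^sub>C x) = c *\<^sub>C S x)}, nrm = onorm,
     mul = (\<circ>), adj = hilbert_adjoint\<rparr>"

definition faithful_rep ::
    "('a::complex_vector) salgebra \<Rightarrow> ('a \<Rightarrow> 'h::chilbert_space \<Rightarrow> 'h) \<Rightarrow> bool" where
  "faithful_rep A \<pi> \<longleftrightarrow> star_hom A bounded_ops \<pi> \<and> inj_on \<pi> (car A)"

section \<open>Approximation entropies\<close>

definition elog :: "enat \<Rightarrow> ereal" where
  "elog m = (case m of enat k \<Rightarrow> if k = 0 then -\<infinity> else ereal (ln (real k)) | \<infinity> \<Rightarrow> \<infinity>)"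

text \<open>The passage common to CA entropy and Voiculescu--Brown entropy from a rank function
  \<open>r \<Omega> \<delta>\<close> to the entropy of a map \<open>\<alpha>\<close> of the carrier \<open>C\<close>.\<close>

definition entropy_at ::
    "('a set \<Rightarrow> real \<Rightarrow> enat) \<Rightarrow> ('a \<Rightarrow> 'a) \<Rightarrow> 'a set \<Rightarrow> real \<Rightarrow> ereal" where
  "entropy_at r \<alpha> \<Omega> \<delta> =
    limsup (\<lambda>n. elog (r (\<Union>i<n. (\<alpha> ^^ i) ` \<Omega>) \<delta>) / ereal (real n))"

definition entropy_of ::
    "'a set \<Rightarrow> ('a set \<Rightarrow> real \<Rightarrow> enat) \<Rightarrow> ('a \<Rightarrow> 'a) \<Rightarrow> ereal" where
  "entropy_of C r \<alpha> =
    (SUP \<Omega>\<in>{\<Omega>. finite \<Omega> \<and> \<Omega> \<subseteq> C}. SUP \<delta>\<in>{0<..}. entropy_at r \<alpha> \<Omega> \<delta>)"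

subsection \<open>CA entropy\<close>

definition CA where
  "CA X Y \<gamma> \<Omega> \<delta> = {(\<phi>, \<psi>, d). 0 < d \<and> contractive X (linf d) \<phi> \<and> contractive (linf d) Y \<psi>
     \<and> (\<forall>x\<in>\<Omega>. nrm Y (\<psi> (\<phi> x) - \<gamma> x) < \<delta>)}"

definition CA_embedding where
  "CA_embedding X Y \<iota> \<longleftrightarrow> cbanach Y \<and> isometric X Y \<iota>
    \<and> (\<forall>\<Omega> \<delta>. finite \<Omega> \<longrightarrow> \<Omega> \<subseteq> car X \<longrightarrow> 0 < \<delta> \<longrightarrow> CA X Y \<iota> \<Omega> \<delta> \<noteq> {})"

definition rc where
  "rc X Y \<iota> \<Omega> \<delta> = (INF (\<phi>, \<psi>, d) \<in> CA X Y \<iota> \<Omega> \<delta>. enat d)"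

text \<open>As a function of \<open>\<alpha>\<close>, this does not depend on the choice of the CA embedding
  \<open>\<iota>\<close> of \<open>X\<close> into \<open>Y\<close>.\<close>

definition hc where
  "hc X Y \<iota> \<alpha> = entropy_of (car X) (rc X Y \<iota>) \<alpha>"

subsection \<open>Voiculescu--Brown entropy\<close>

text \<open>The positive elements of the matrix algebra \<open>M\<^sub>k(A)\<close> are the products \<open>c\<^sup>* c\<close>.\<close>

definition matrix_pos ::
    "('a::complex_vector) salgebra \<Rightarrow> nat \<Rightarrow> (nat \<Rightarrow> nat \<Rightarrow> 'a) \<Rightarrow> bool" where
  "matrix_pos A k a \<longleftrightarrow> (\<exists>c. (\<forall>i<k. \<forall>j<k. c i j \<in> car A)
    \<and> (\<forall>i<k. \<forall>j<k. a i j = (\<Sum>l<k. mul A (adj A (c l i)) (c l j))))"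

definition completely_positive where
  "completely_positive A B \<phi> \<longleftrightarrow> clinear_on A B \<phi>
    \<and> (\<forall>k a. matrix_pos A k a \<longrightarrow> matrix_pos B k (\<lambda>i j. \<phi> (a i j)))"

definition fd_cstar_algebra :: "('a::complex_vector) salgebra \<Rightarrow> bool" where
  "fd_cstar_algebra B \<longleftrightarrow> cstar_algebra B
    \<and> (\<exists>S. finite S \<and> car B \<subseteq> complex_vector.span S)"

definition abelian_star_subalgebra ::
    "('a::complex_vector) salgebra \<Rightarrow> 'a set \<Rightarrow> bool" where
  "abelian_star_subalgebra B M \<longleftrightarrow> M \<subseteq> car B \<and> complex_vector.subspace M
    \<and> (\<forall>x\<in>M. adj B x \<in> M)
    \<and> (\<forall>x\<in>M. \<forall>y\<in>M. mul B x y \<in> M \<and> mul B x y = mul B y x)"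

definition masa :: "('a::complex_vector) salgebra \<Rightarrow> 'a set \<Rightarrow> bool" where
  "masa B M \<longleftrightarrow> abelian_star_subalgebra B M
    \<and> (\<forall>N. abelian_star_subalgebra B N \<longrightarrow> M \<subseteq> N \<longrightarrow> N = M)"

text \<open>In a finite-dimensional C*-algebra all maximal abelian *-subalgebras have the same
  dimension.\<close>

definition rank_alg :: "('a::complex_vector) salgebra \<Rightarrow> nat" where
  "rank_alg B = complex_vector.dim (SOME M. masa B M)"

text \<open>Every finite-dimensional complex vector space is isomorphic to a subspace of
  \<^typ>\<open>nat \<Rightarrow> complex\<close>.  As product, adjoint and norm of the algebra \<open>B\<close> are arbitrary
  functions, \<open>B\<close> thus ranges over all finite-dimensional C*-algebras up to isomorphism.\<close>

definition CPA ::
    "('a::complex_vector) salgebra \<Rightarrow> ('a \<Rightarrow> 'h::chilbert_space \<Rightarrow> 'h) \<Rightarrow> 'a set \<Rightarrow> real \<Rightarrow>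
      (('a \<Rightarrow> nat \<Rightarrow> complex) \<times> ((nat \<Rightarrow> complex) \<Rightarrow> 'h \<Rightarrow> 'h) \<times> (nat \<Rightarrow> complex) salgebra) set"
  where
  "CPA A \<pi> \<Omega> \<delta> = {(\<phi>, \<psi>, B). fd_cstar_algebra B
     \<and> contractive A B \<phi> \<and> completely_positive A B \<phi>
     \<and> contractive B bounded_ops \<psi> \<and> completely_positive B bounded_ops \<psi>
     \<and> (\<forall>x\<in>\<Omega>. nrm bounded_ops (\<psi> (\<phi> x) - \<pi> x) < \<delta>)}"

definition rcp where
  "rcp A \<pi> \<Omega> \<delta> = (INF (\<phi>, \<psi>, B) \<in> CPA A \<pi> \<Omega> \<delta>. enat (rank_alg B))"

text \<open>As a function of \<open>\<alpha>\<close>, this does not depend on the choice of the faithful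
  representation \<open>\<pi>\<close> of \<open>A\<close>.\<close>

definition ht where
  "ht A \<pi> \<alpha> = entropy_of (car A) (rcp A \<pi>) \<alpha>"

section \<open>Topological entropy\<close>

definition finite_open_cover :: "'k::topological_space set set \<Rightarrow> bool" where
  "finite_open_cover W \<longleftrightarrow> finite W \<and> (\<forall>U\<in>W. open U) \<and> \<Union>W = UNIV"

definition min_subcover :: "'k set set \<Rightarrow> nat" where
  "min_subcover W = (INF V\<in>{V. finite V \<and> V \<subseteq> W \<and> \<Union>V = UNIV}. card V)"

definition cover_join :: "'k set set \<Rightarrow> 'k set set \<Rightarrow> 'k set set" where
  "cover_join V W = {U \<inter> U' |U U'. U \<in> V \<and> U' \<in> W}"

primrec iterated_join :: "('k \<Rightarrow> 'k) \<Rightarrow> 'k set set \<Rightarrow> nat \<Rightarrow> 'k set set" where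
  "iterated_join T W 0 = {UNIV}"
| "iterated_join T W (Suc n) = cover_join (iterated_join T W n) ((-`) (T ^^ n) ` W)"

definition htop :: "('k::topological_space \<Rightarrow> 'k) \<Rightarrow> ereal" where
  "htop T = (SUP W\<in>{W. finite_open_cover W}.
     ereal (lim (\<lambda>n. ln (real (min_subcover (iterated_join T W n))) / real n)))"

section \<open>The automorphism induced by a homeomorphism\<close>

definition koopman :: "('k \<Rightarrow> 'k) \<Rightarrow> ('k \<Rightarrow> complex) \<Rightarrow> 'k \<Rightarrow> complex" where
  "koopman T f = f \<circ> T"

lemma bdd_above_cfun:
  fixes f :: "'k::topological_space \<Rightarrow> complex"
  assumes "compact (UNIV :: 'k set)" "continuous_on UNIV f"
  shows "bdd_above (range (\<lambda>x. cmod (f x)))"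
  by (intro compact_imp_bounded[THEN bounded_imp_bdd_above] compact_continuous_image
      continuous_on_norm assms)

lemma nrm_cfun_upper:
  fixes f :: "'k::topological_space \<Rightarrow> complex"
  assumes "compact (UNIV :: 'k set)" "continuous_on UNIV f"
  shows "cmod (f x) \<le> nrm cfun f"
  unfolding cfun_def using cSUP_upper[OF UNIV_I bdd_above_cfun[OF assms], of x] by simp

lemma nrm_cfun_least:
  assumes "\<And>x. cmod (f x) \<le> B"
  shows "nrm cfun f \<le> B"
  unfolding cfun_def using assms by (simp add: cSUP_least)

lemma cbanach_cfun:
  assumes K: "compact (UNIV :: 'k::topological_space set)"
  shows "cbanach (cfun :: ('k \<Rightarrow> complex) salgebra)"
proof -
  let ?C = "cfun :: ('k \<Rightarrow> complex) salgebra"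
  note [simp] = scaleC_fun_def scaleC_complex_def
  have car: "car ?C = {f. continuous_on UNIV f}"
    by (simp add: cfun_def)
  note up = nrm_cfun_upper[OF K]
  have sub: "complex_vector.subspace (car ?C)"
    unfolding car complex_vector.subspace_def
    by (auto simp: plus_fun_def zero_fun_def intro!: continuous_intros)
  have pos: "0 \<le> nrm ?C f" if "f \<in> car ?C" for f
    using that order_trans[OF norm_ge_zero up[of f undefined]] by (simp add: car)
  have zero: "nrm ?C f = 0 \<longleftrightarrow> f = 0" if "f \<in> car ?C" for f
  proof
    assume "nrm ?C f = 0"
    then have "cmod (f x) \<le> 0" for x
      using that up[of f x] by (simp add: car)
    then show "f = 0"
      by (simp add: fun_eq_iff)
  qed (simp add: cfun_def)
  have tri: "nrm ?C (f + g) \<le> nrm ?C f + nrm ?C g" if "f \<in> car ?C" "g \<in> car ?C" for f g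
    using that by (intro nrm_cfun_least)
      (auto simp: car intro!: order_trans[OF norm_triangle_ineq] add_mono up)
  have scale_le: "nrm ?C (c *\<^sub>C f) \<le> cmod c * nrm ?C f" if "f \<in> car ?C" for c f
    using that by (intro nrm_cfun_least) (auto simp: car norm_mult intro!: mult_left_mono up)
  have scale: "nrm ?C (c *\<^sub>C f) = cmod c * nrm ?C f" if f: "f \<in> car ?C" for c f
  proof (cases "c = 0")
    case True
    have "c *\<^sub>C f = 0"
      using True by (simp add: fun_eq_iff)
    then show ?thesis
      using True by (simp add: cfun_def)
  next
    case False
    have "c *\<^sub>C f \<in> car ?C"
      using sub f by (simp add: complex_vector.subspace_scale del: scaleC_fun_def)
    from scale_le[OF this, of "inverse c"] False
    have "nrm ?C f \<le> nrm ?C (c *\<^sub>C f) / cmod c"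
      by (simp add: norm_divide inverse_eq_divide field_simps)
    then show ?thesis
      using False scale_le[OF f, of c] by (simp add: field_simps)
  qed
  have complete: "\<exists>f\<in>car ?C. (\<lambda>n. nrm ?C (s n - f)) \<longlonglongrightarrow> 0"
    if s: "range s \<subseteq> car ?C"
      and cau: "\<forall>e>0. \<exists>N. \<forall>m\<ge>N. \<forall>n\<ge>N. nrm ?C (s m - s n) < e" for s :: "nat \<Rightarrow> 'k \<Rightarrow> complex"
  proof -
    have cont: "continuous_on UNIV (s n)" for n
      using s by (auto simp: car)
    have diff: "continuous_on UNIV (s m - s n)" for m n
      using cont by (auto simp: fun_diff_def intro!: continuous_intros)
    have "uniformly_Cauchy_on UNIV s"
      unfolding uniformly_Cauchy_on_def
    proof (intro allI impI)
      fix e :: real assume "0 < e"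
      with cau obtain N where N: "\<forall>m\<ge>N. \<forall>n\<ge>N. nrm ?C (s m - s n) < e"
        by blast
      show "\<exists>M. \<forall>x\<in>UNIV. \<forall>m\<ge>M. \<forall>n\<ge>M. dist (s m x) (s n x) < e"
        using N le_less_trans[OF up[OF diff, simplified]]
          by (auto simp: dist_norm intro!: exI[of _ N])
    qed
    then obtain f where f: "uniform_limit UNIV s f sequentially"
      using Cauchy_uniformly_convergent uniformly_convergent_on_def by blast
    have "continuous_on UNIV f"
      using uniform_limit_theorem[OF _ f] cont by simp
    moreover have "(\<lambda>n. nrm ?C (s n - f)) \<longlonglongrightarrow> 0"
    proof (rule tendstoI)
      fix e :: real assume e: "0 < e"
      have dc: "continuous_on UNIV (s n - f)" for n
        using cont \<open>continuous_on UNIV f\<close> by (auto simp: fun_diff_def intro!: continuous_intros)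
      have "\<forall>\<^sub>F n in sequentially. \<forall>x. dist (s n x) (f x) < e / 2"
        using uniform_limitD[OF f, of "e/2"] e by simp
      then show "\<forall>\<^sub>F n in sequentially. dist (nrm ?C (s n - f)) 0 < e"
      proof eventually_elim
        case (elim n)
        then have "nrm ?C (s n - f) \<le> e / 2"
          by (intro nrm_cfun_least) (auto simp: dist_norm less_imp_le)
        then show ?case
          using e pos[of "s n - f"] dc by (simp add: car)
      qed
    qed
    ultimately show ?thesis
      by (auto simp: car)
  qed
  show ?thesis
    unfolding cbanach_def using sub pos zero tri scale complete by simp
qed

lemma cstar_algebra_cfun:
  assumes K: "compact (UNIV :: 'k::topological_space set)"
  shows "cstar_algebra (cfun :: ('k \<Rightarrow> complex) salgebra)"
proof -
  let ?C = "cfun :: ('k \<Rightarrow> complex) salgebra"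
  have car: "car ?C = {f. continuous_on UNIV f}"
    and mul: "mul ?C = (\<lambda>f g x. f x * g x)" and adj: "adj ?C = (\<lambda>f x. cnj (f x))"
    by (simp_all add: cfun_def)
  note up = nrm_cfun_upper[OF K]
  have pos: "0 \<le> nrm ?C f" if "f \<in> car ?C" for f
    using cbanach_cfun[OF K] that by (simp add: cbanach_def)
  have sub: "nrm ?C (mul ?C f g) \<le> nrm ?C f * nrm ?C g" if "f \<in> car ?C" "g \<in> car ?C" for f g
    using that pos[of f] by (intro nrm_cfun_least)
      (auto simp: car mul norm_mult intro!: mult_mono up)
  have star: "nrm ?C (mul ?C (adj ?C f) f) = (nrm ?C f)\<^sup>2" if f: "f \<in> car ?C" for f
  proof (rule antisym)
    show "nrm ?C (mul ?C (adj ?C f) f) \<le> (nrm ?C f)\<^sup>2"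
      using f pos[OF f] by (intro nrm_cfun_least)
        (auto simp: car mul adj norm_mult power2_eq_square intro!: mult_mono up)
    have c: "continuous_on UNIV (mul ?C (adj ?C f) f)"
      using f by (auto simp: car mul adj intro!: continuous_intros)
    have "(cmod (f x))\<^sup>2 \<le> nrm ?C (mul ?C (adj ?C f) f)" for x
      using up[OF c, of x] by (simp add: mul adj norm_mult power2_eq_square)
    then have "nrm ?C f \<le> sqrt (nrm ?C (mul ?C (adj ?C f) f))"
      by (intro nrm_cfun_least real_le_rsqrt)
    then have "(nrm ?C f)\<^sup>2 \<le> (sqrt (nrm ?C (mul ?C (adj ?C f) f)))\<^sup>2"
      using pos[OF f] by (intro power_mono) auto
    also have "\<dots> = nrm ?C (mul ?C (adj ?C f) f)"
      using pos[of "mul ?C (adj ?C f) f"] c by (simp add: car)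
    finally show "(nrm ?C f)\<^sup>2 \<le> nrm ?C (mul ?C (adj ?C f) f)" .
  qed
  show ?thesis
    unfolding cstar_algebra_def
    using cbanach_cfun[OF K] sub star
    by (simp add: car mul adj fun_eq_iff scaleC_fun_def scaleC_complex_def algebra_simps)
      (auto intro!: continuous_intros)
qed

lemma CA_embedding_cfun:
  assumes K: "compact (UNIV :: 'k::topological_space set)"
  shows "CA_embedding (cfun :: ('k \<Rightarrow> complex) salgebra) cfun (\<lambda>f. f)"
proof -
  let ?C = "cfun :: ('k \<Rightarrow> complex) salgebra"
  note up = nrm_cfun_upper[OF K]
  have car: "car ?C = {f. continuous_on UNIV f}"
    by (simp add: cfun_def)
  have "CA ?C ?C (\<lambda>f. f) \<Omega> \<delta> \<noteq> {}" if fin: "finite \<Omega>" and \<Omega>: "\<Omega> \<subseteq> car ?C" and \<delta>: "0 < \<delta>" for \<Omega> \<delta>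
  proof -
    have cont: "continuous_on UNIV f" if "f \<in> \<Omega>" for f
      using \<Omega> that by (auto simp: car)
    define e where "e = \<delta> / 2"
    have e: "0 < e" "e < \<delta>"
      using \<delta> by (auto simp: e_def)
    define g where "g a x = (\<Prod>f\<in>\<Omega>. max 0 (e - cmod (f x - f a)))" for a x :: 'k
    have g_cont: "continuous_on UNIV (g a)" for a
      unfolding g_def using cont by (intro continuous_intros) auto
    have g_nonneg: "0 \<le> g a x" for a x
      unfolding g_def by (intro prod_nonneg) auto
    have g_self: "0 < g a a" for a
      unfolding g_def using e by (intro prod_pos) auto
    have g_close: "cmod (f x - f a) \<le> e" if "f \<in> \<Omega>" "g a x \<noteq> 0" for f a x
      using that fin by (fastforce simp: g_def prod_zero_iff max_def split: if_splits)
    have "open {x. 0 < g a x}" for a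
      using g_cont[of a] by (intro open_Collect_less) auto
    moreover have "UNIV \<subseteq> (\<Union>a\<in>UNIV. {x. 0 < g a x})"
      using g_self by auto
    ultimately obtain A where A: "finite A" "UNIV \<subseteq> (\<Union>a\<in>A. {x. 0 < g a x})"
      using compactE_image[OF K, of UNIV "\<lambda>a. {x. 0 < g a x}"] by (metis (no_types, lifting))
    define d where "d = card A"
    obtain b where b: "bij_betw b {..<d} A"
      using ex_bij_betw_nat_finite[OF A(1)] by (auto simp: d_def lessThan_atLeast0)
    have "A \<noteq> {}"
      using A(2) by auto
    then have d: "0 < d"
      using A(1) by (simp add: d_def card_gt_0_iff)
    define s where "s x = (\<Sum>i<d. g (b i) x)" for x
    have s_pos: "0 < s x" for x
    proof -
      obtain a where "a \<in> A" "0 < g a x"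
        using A(2) by auto
      then obtain i where "i < d" "0 < g (b i) x"
        using b by (auto simp: bij_betw_def)
      then show ?thesis
        unfolding s_def using g_nonneg by (intro sum_pos2[of _ i]) auto
    qed
    define p where "p i x = g (b i) x / s x" for i x
    have p_nonneg: "0 \<le> p i x" for i x
      using s_pos[of x] g_nonneg by (simp add: p_def)
    have p_sum: "(\<Sum>i<d. p i x) = 1" for x
      using s_pos[of x] by (simp add: p_def s_def sum_divide_distrib[symmetric])
    have p_cont: "continuous_on UNIV (p i)" for i
      unfolding p_def s_def using g_cont s_pos[unfolded s_def]
      by (intro continuous_intros) (auto simp: less_imp_neq[symmetric])
    define \<phi> :: "('k \<Rightarrow> complex) \<Rightarrow> nat \<Rightarrow> complex"
      where "\<phi> f i = (if i < d then f (b i) else 0)" for f i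
    define \<psi> :: "(nat \<Rightarrow> complex) \<Rightarrow> 'k \<Rightarrow> complex"
      where "\<psi> v x = (\<Sum>i<d. complex_of_real (p i x) * v i)" for v x
    have avg: "cmod (\<Sum>i<d. complex_of_real (p i x) * v i) \<le> M"
      if "\<And>i. i < d \<Longrightarrow> p i x \<noteq> 0 \<Longrightarrow> cmod (v i) \<le> M" for x v M
    proof -
      have "cmod (\<Sum>i<d. complex_of_real (p i x) * v i) \<le> (\<Sum>i<d. p i x * M)"
      proof (rule sum_norm_le)
        fix i assume "i \<in> {..<d}"
        then show "cmod (complex_of_real (p i x) * v i) \<le> p i x * M"
          using that[of i] p_nonneg[of i x]
          by (cases "p i x = 0") (auto simp: norm_mult intro!: mult_left_mono)
      qed
      then show ?thesis
        by (simp add: sum_distrib_right[symmetric] p_sum)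
    qed
    have "contractive ?C (linf d) \<phi>"
      unfolding contractive_def clinear_on_def using d
      by (auto simp: \<phi>_def linf_def fun_eq_iff scaleC_fun_def scaleC_complex_def car
          intro!: Max.boundedI up)
    moreover have "contractive (linf d) ?C \<psi>"
      unfolding contractive_def clinear_on_def
    proof (intro conjI ballI allI)
      show "\<psi> ` car (linf d) \<subseteq> car ?C"
        unfolding car \<psi>_def using p_cont by (auto intro!: continuous_intros)
      show "\<psi> (v + w) = \<psi> v + \<psi> w" for v w
        by (simp add: \<psi>_def fun_eq_iff algebra_simps sum.distrib)
      show "\<psi> (c *\<^sub>C v) = c *\<^sub>C \<psi> v" for c v
        by (simp add: \<psi>_def fun_eq_iff scaleC_fun_def scaleC_complex_def sum_distrib_left
            mult.left_commute)
      show "nrm ?C (\<psi> v) \<le> nrm (linf d) v" for v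
        unfolding \<psi>_def by (intro nrm_cfun_least avg) (auto simp: linf_def)
    qed
    moreover have "nrm ?C (\<psi> (\<phi> f) - f) < \<delta>" if f: "f \<in> \<Omega>" for f
    proof -
      have "nrm ?C (\<psi> (\<phi> f) - f) \<le> e"
      proof (rule nrm_cfun_least)
        fix x
        have "(\<psi> (\<phi> f) - f) x =
            (\<Sum>i<d. complex_of_real (p i x) * \<phi> f i) - complex_of_real (\<Sum>i<d. p i x) * f x"
          by (simp only: p_sum) (simp add: \<psi>_def)
        also have "\<dots> = (\<Sum>i<d. complex_of_real (p i x) * (f (b i) - f x))"
          by (simp add: \<phi>_def sum_distrib_left sum_subtractf algebra_simps)
        also have "cmod \<dots> \<le> e"
        proof (rule avg)
          fix i assume "i < d" "p i x \<noteq> 0"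
          then have "g (b i) x \<noteq> 0"
            by (auto simp: p_def)
          then show "cmod (f (b i) - f x) \<le> e"
            using g_close[OF f, of "b i" x] by (metis norm_minus_commute)
        qed
        finally show "cmod ((\<psi> (\<phi> f) - f) x) \<le> e" .
      qed
      with e show ?thesis
        by simp
    qed
    ultimately have "(\<phi>, \<psi>, d) \<in> CA ?C ?C (\<lambda>f. f) \<Omega> \<delta>"
      using d by (simp add: CA_def)
    then show ?thesis
      by blast
  qed
  then show ?thesis
    unfolding CA_embedding_def isometric_def clinear_on_def using cbanach_cfun[OF K] by simp
qed

lemma koopman_automorphism:
  fixes T :: "'k::topological_space \<Rightarrow> 'k"
  assumes T: "homeomorphism UNIV UNIV T T'"
  shows "star_hom cfun cfun (koopman T)" "bij_betw (koopman T) (car cfun) (car cfun)"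
    "isometric cfun cfun (koopman T)"
proof -
  have c: "continuous_on UNIV T" "continuous_on UNIV T'"
    and inv: "T (T' y) = y" "T' (T x) = x" for x y
    using T by (auto simp: homeomorphism_def)
  have "continuous_on UNIV (f \<circ> T)" "continuous_on UNIV (f \<circ> T')"
    if "continuous_on UNIV f" for f :: "'k \<Rightarrow> complex"
    using that c continuous_on_compose2[of UNIV f UNIV] by (auto simp: comp_def)
  note comp = this
  show hom: "star_hom cfun cfun (koopman T)"
    unfolding star_hom_def clinear_on_def using comp
    by (auto simp: cfun_def koopman_def fun_eq_iff scaleC_fun_def)
  show "bij_betw (koopman T) (car cfun) (car cfun)"
    using comp by (intro bij_betw_byWitness[where f' = "koopman T'"])
      (auto simp: cfun_def koopman_def fun_eq_iff inv)
  have "range T = UNIV"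
    using T by (simp add: homeomorphism_def)
  then have "nrm cfun (koopman T f) = nrm cfun f" for f
    by (simp add: cfun_def koopman_def image_image[of "\<lambda>x. cmod (f x)" T, symmetric])
  then show "isometric cfun cfun (koopman T)"
    using hom by (simp add: isometric_def star_hom_def)
qed

end

theory Submission
  imports Defs "HOL-Computational_Algebra.Fundamental_Theorem_Algebra"
begin

text \<open>
  Both approximation entropies are compared with the topological entropy by the same pair of
  arguments; only the notion of rank changes.

  Upper bound.  Cover \<open>K\<close> by finitely many cozero sets on which the functions of \<open>\<Omega>\<close> oscillate
  little.  A minimal subcover of the \<open>n\<close>-th join, with \<open>N\<close> members, carries a partition of unity,
  and evaluating at one point of each member and averaging against the partition reproduces all
  \<open>f \<circ> T\<^sup>i\<close> with \<open>f \<in> \<Omega>\<close> and \<open>i < n\<close> up to the oscillation (\<open>iterated_approximable\<close>).  Both maps are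
  contractive, so the CA rank is at most \<open>N\<close>.  Through the commutative algebra \<open>\<complex>\<^sup>N\<close> and followed by
  the representation, they are completely positive contractions: this rests on continuous square roots of positive matrix functions
  (\<open>gram_reduction\<close>) and on the fact that representations of \<open>C(K)\<close> are contractive
  (\<open>representation_contractive\<close>).  Hence the completely positive rank is at most \<open>N\<close> as well.

  Lower bound.  For a cover \<open>W\<close> choose finitely many bump functions \<open>g\<^sub>a\<close>, each supported well inside
  a member of \<open>W\<close>, such that at every point some \<open>g\<^sub>a\<close> equals \<open>1\<close>.  An orbit segment of length
  \<open>n\<close> gets as name a word \<open>w\<close> with \<open>g\<^bsub>w i\<^esub> (T\<^sup>i x) = 1\<close>.  The average \<open>f\<^sub>w\<close> of the
  functions \<open>g\<^bsub>w i\<^esub> \<circ> T\<^sup>i\<close> has norm \<open>1\<close>, and cutting it off at height \<open>1 - 2\<theta>\<close> gives a function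
  \<open>0 \<le> F\<^sub>w \<le> 1\<close> with \<open>\<parallel>f\<^sub>w - \<theta> F\<^sub>w\<parallel> \<le> 1 - \<theta>\<close> which is nonzero only where fewer than \<open>2\<theta>n\<close> of the
  \<open>n\<close> bumps vanish.  If a pair of contractions \<open>\<phi>, \<psi>\<close> moves the functions
  \<open>g\<^sub>a \<circ> T\<^sup>i\<close> by less than \<open>\<theta>/2\<close>, then \<open>\<parallel>\<phi>(f\<^sub>w)\<parallel> > 1 - \<theta>/2\<close>, and the triangle inequality forces
  \<open>\<parallel>\<phi>(F\<^sub>w)\<parallel> > 1/2\<close> (\<open>peaked_image_norm\<close>).  Functions \<open>F\<^sub>w\<close> with disjoint supports have
  \<open>\<parallel>\<Sum> a\<^sub>w F\<^sub>w\<parallel> \<le> 1\<close> for all \<open>\<bar>a\<^sub>w\<bar> \<le> 1\<close>, and an algebra or space of rank \<open>d\<close> has room for at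
  most \<open>2d\<close> such images (\<open>linf_packing\<close>, \<open>rank_packing\<close>).  A maximal disjoint family thus has at most
  \<open>2d\<close> members, while by maximality every orbit segment follows one of its words in all but
  \<open>4\<theta>n\<close> places.  So \<open>2d\<close> times the number of such deviations bounds the minimal size of a subcover
  (\<open>min_subcover_le_packing\<close>), and the exponential growth rate of the number of deviations tends
  to \<open>0\<close> with \<open>\<theta>\<close>.

  The packing bound in \<open>\<ell>\<^sub>\<infinity>\<^sup>d\<close> counts coordinates.  In a finite-dimensional C*-algebra it uses the
  trace \<open>b \<mapsto> \<Sum>\<^sub>p \<lambda>\<^sub>p(b)\<close>, where \<open>p\<close> runs over the minimal projections of a maximal abelian
  *-subalgebra and \<open>p b p = \<lambda>\<^sub>p(b) p\<close>: it dominates the norm of positive elements because the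
  associated Hilbert--Schmidt norm is submultiplicative (\<open>N_sq_le_hs\<close>).
\<close>

section \<open>Joins of covers and the existence of the limit\<close>

text \<open>
  Fekete's subadditivity argument, with the limit being the infimum: if \<open>a m / m\<close> is nearly minimal,
  division with remainder by \<open>m\<close> gives \<open>a n \<le> n (a m / m) + O(1)\<close>.
\<close>

lemma fekete:
  fixes a :: "nat \<Rightarrow> real"
  assumes nonneg: "\<And>n. 0 \<le> a n" and sub: "\<And>m n. a (m + n) \<le> a m + a n"
  shows "convergent (\<lambda>n. a n / real n)"
proof -
  define L where "L = (INF n\<in>{1..}. a n / real n)"
  have bdd: "bdd_below ((\<lambda>n. a n / real n) ` {1..})"
    using nonneg by (intro bdd_belowI2[where m=0]) auto
  have mult: "a (q * m) \<le> real q * a m" if "q \<ge> 1" for q m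
    using that
  proof (induction q rule: dec_induct)
    case (step q)
    then show ?case
      using sub[of m "q * m"] by (simp add: algebra_simps)
  qed simp
  have "(\<lambda>n. a n / real n) \<longlonglongrightarrow> L"
  proof (rule LIMSEQ_I)
    fix e :: real assume e: "0 < e"
    have "\<exists>m\<in>{1..}. a m / real m < L + e / 2"
    proof (rule ccontr)
      assume "\<not> ?thesis"
      then have "L + e / 2 \<le> L"
        unfolding L_def by (intro cINF_greatest) (auto simp: not_less L_def)
      with e show False by simp
    qed
    then obtain m where m: "m \<ge> 1" "a m / real m < L + e / 2"
      by auto
    define B where "B = (\<Sum>r<m. a r)"
    have B: "a r \<le> B" if "r < m" for r
      unfolding B_def using that nonneg by (intro member_le_sum) auto
    obtain N :: nat where N: "B / (e / 2) < real N"
      using reals_Archimedean2 by blast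
    have "norm (a n / real n - L) < e" if n: "n \<ge> max N (max 1 m)" for n
    proof -
      have n1: "n \<ge> 1" "n \<ge> m" "n \<ge> N" using n by auto
      have q: "n div m \<ge> 1" using n1 m by (simp add: div_greater_zero_iff Suc_leI)
      have "a n = a ((n div m) * m + n mod m)" by simp
      also have "\<dots> \<le> a ((n div m) * m) + a (n mod m)" by (rule sub)
      also have "\<dots> \<le> real (n div m) * a m + B"
        using mult[OF q, of m] B[of "n mod m"] m by simp
      also have "real (n div m) * a m \<le> (real n / real m) * a m"
        by (intro mult_right_mono nonneg of_nat_div_le_of_nat)
      finally have "a n \<le> real n * (a m / real m) + B" by simp
      then have "a n / real n \<le> a m / real m + B / real n"
        using n1 by (simp add: field_simps)
      also have "B / real n < e / 2"
      proof -
        have "B / (e / 2) < real n" using N n1 by linarith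
        then show ?thesis using e n1 by (simp add: field_simps)
      qed
      finally have "a n / real n < L + e" using m(2) by linarith
      moreover have "L \<le> a n / real n"
        unfolding L_def using n1 by (intro cINF_lower bdd) auto
      ultimately show ?thesis using e by (simp add: abs_less_iff)
    qed
    then show "\<exists>no. \<forall>n\<ge>no. norm (a n / real n - L) < e" by blast
  qed
  then show ?thesis by (auto simp: convergent_def)
qed

lemma funpow_continuous:
  fixes T :: "'k::topological_space \<Rightarrow> 'k"
  assumes "continuous_on UNIV T"
  shows "continuous_on UNIV (T ^^ n)"
proof (induction n)
  case (Suc n)
  then have "continuous_on UNIV (T \<circ> (T ^^ n))"
    by (intro continuous_on_compose) (auto intro: continuous_on_subset[OF assms])
  then show ?case by (simp add: comp_def)
qed (simp add: id_def)

lemma continuous_on_funpow: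
  fixes T :: "'k::topological_space \<Rightarrow> 'k" and g :: "'k \<Rightarrow> 'b::topological_space"
  assumes "continuous_on UNIV T" "continuous_on UNIV g"
  shows "continuous_on UNIV (\<lambda>x. g ((T ^^ n) x))"
  using continuous_on_compose2[OF assms(2) funpow_continuous[OF assms(1)]] by simp

lemma finite_iterated_join:
  assumes "finite W" shows "finite (iterated_join T W n)"
proof (induction n)
  case (Suc n)
  have "cover_join V V' = (\<lambda>(U, U'). U \<inter> U') ` (V \<times> V')" for V V' :: "'a set set"
    by (auto simp: cover_join_def)
  then show ?case using Suc assms by simp
qed simp

lemma cover_memE:
  assumes "\<Union>V = UNIV"
  obtains U where "U \<in> V" "x \<in> U"
  using assms by (metis UNIV_I UnionE)

lemma iterated_join_covers:
  assumes "\<Union>W = UNIV" shows "\<Union>(iterated_join T W n) = UNIV"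
proof (induction n)
  case (Suc n)
  have "x \<in> \<Union>(iterated_join T W (Suc n))" for x
  proof -
    obtain U where "U \<in> iterated_join T W n" "x \<in> U"
      using cover_memE[OF Suc] .
    moreover obtain U' where "U' \<in> W" "(T ^^ n) x \<in> U'"
      using cover_memE[OF assms] .
    ultimately have "U \<inter> (T ^^ n) -` U' \<in> iterated_join T W (Suc n)"
      "x \<in> U \<inter> (T ^^ n) -` U'"
      by (auto simp: cover_join_def)
    then show ?thesis by blast
  qed
  then show ?case by blast
qed simp

text \<open>
  Subadditivity of the cover entropy comes from splitting an orbit segment of length \<open>m + n\<close>
  after \<open>m\<close> steps.
\<close>

lemma iterated_join_concat:
  assumes "U \<in> iterated_join T W m" "U' \<in> iterated_join T W n"
  shows "U \<inter> (T ^^ m) -` U' \<in> iterated_join T W (m + n)"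
  using assms(2)
proof (induction n arbitrary: U')
  case 0
  then show ?case using assms(1) by simp
next
  case (Suc n)
  then obtain V w where V: "V \<in> iterated_join T W n" "w \<in> W" "U' = V \<inter> (T ^^ n) -` w"
    by (auto simp: cover_join_def)
  have "U \<inter> (T ^^ m) -` U' = (U \<inter> (T ^^ m) -` V) \<inter> (T ^^ (m + n)) -` w"
    unfolding V(3) by (auto simp: funpow_add add.commute[of m])
  moreover have "U \<inter> (T ^^ m) -` V \<in> iterated_join T W (m + n)"
    using Suc.IH[OF V(1)] .
  ultimately show ?case using V(2) by (auto simp: cover_join_def)
qed

lemma min_subcover_le:
  assumes "finite V" "V \<subseteq> W" "\<Union>V = UNIV"
  shows "min_subcover W \<le> card V"
  unfolding min_subcover_def using assms by (intro cINF_lower) auto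

lemma min_subcover_attained:
  assumes "finite W" "\<Union>W = UNIV"
  obtains V where "finite V" "V \<subseteq> W" "\<Union>V = UNIV" "card V = min_subcover W"
proof -
  have "min_subcover W \<in> card ` {V. finite V \<and> V \<subseteq> W \<and> \<Union>V = UNIV}"
    unfolding min_subcover_def using assms by (intro Inf_nat_def1) auto
  then obtain V where "V \<in> {V. finite V \<and> V \<subseteq> W \<and> \<Union>V = UNIV}" "min_subcover W = card V"
    by (rule imageE) simp
  then show ?thesis by (intro that[of V]) simp_all
qed

lemma min_subcover_pos:
  assumes "finite W" "\<Union>W = UNIV"
  shows "1 \<le> min_subcover W"
proof -
  obtain V where V: "finite V" "V \<subseteq> W" "\<Union>V = UNIV" "card V = min_subcover W"
    using min_subcover_attained[OF assms] .
  then have "V \<noteq> {}" by auto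
  then show ?thesis using V(1,4) by (metis Suc_leI One_nat_def card_gt_0_iff)
qed

lemma min_subcover_submultiplicative:
  assumes "finite W" "\<Union>W = UNIV"
  shows "min_subcover (iterated_join T W (m + n))
    \<le> min_subcover (iterated_join T W m) * min_subcover (iterated_join T W n)"
proof -
  note fin = finite_iterated_join[OF assms(1)] and cov = iterated_join_covers[OF assms(2)]
  obtain V where V: "finite V" "V \<subseteq> iterated_join T W m" "\<Union>V = UNIV"
    "card V = min_subcover (iterated_join T W m)"
    using min_subcover_attained[OF fin cov] .
  obtain V' where V': "finite V'" "V' \<subseteq> iterated_join T W n" "\<Union>V' = UNIV"
    "card V' = min_subcover (iterated_join T W n)"
    using min_subcover_attained[OF fin cov] .
  let ?J = "(\<lambda>(U, U'). U \<inter> (T ^^ m) -` U') ` (V \<times> V')"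
  have "x \<in> \<Union>?J" for x
  proof -
    obtain U where "U \<in> V" "x \<in> U"
      using cover_memE[OF V(3)] .
    moreover obtain U' where "U' \<in> V'" "(T ^^ m) x \<in> U'"
      using cover_memE[OF V'(3)] .
    ultimately show ?thesis by auto
  qed
  then have "\<Union>?J = UNIV" by auto
  moreover have "?J \<subseteq> iterated_join T W (m + n)"
    using V(2) V'(2) iterated_join_concat by fast
  ultimately have "min_subcover (iterated_join T W (m + n)) \<le> card ?J"
    using V(1) V'(1) by (intro min_subcover_le) blast+
  also have "\<dots> \<le> card (V \<times> V')" using V(1) V'(1) by (intro card_image_le) simp
  finally show ?thesis using V(4) V'(4) by (simp add: card_cartesian_product)
qed

lemma cover_entropy_convergent:
  assumes "finite W" "\<Union>W = UNIV"
  shows "(\<lambda>n. ln (real (min_subcover (iterated_join T W n))) / real n)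
    \<longlonglongrightarrow> lim (\<lambda>n. ln (real (min_subcover (iterated_join T W n))) / real n)"
proof -
  let ?N = "\<lambda>n. min_subcover (iterated_join T W n)"
  have pos: "1 \<le> ?N n" for n
    using min_subcover_pos finite_iterated_join[OF assms(1)] iterated_join_covers[OF assms(2)] .
  have "convergent (\<lambda>n. ln (real (?N n)) / real n)"
  proof (rule fekete)
    show "0 \<le> ln (real (?N n))" for n using pos[of n] by simp
    show "ln (real (?N (m + n))) \<le> ln (real (?N m)) + ln (real (?N n))" for m n
    proof -
      have "real (?N (m + n)) \<le> real (?N m) * real (?N n)"
        using min_subcover_submultiplicative[OF assms, of T m n] 
        by (simp flip: of_nat_mult)
      moreover have "0 < ?N (m+n)" "0 < ?N m" "0 < ?N n"
        using pos[of "m + n"] pos[of m] pos[of n] by linarith+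
      ultimately show ?thesis
        by (subst ln_mult_pos[symmetric]) simp_all
    qed
  qed
  then show ?thesis by (simp add: convergent_LIMSEQ_iff)
qed

section \<open>Continuous square roots of positive matrix functions\<close>

text \<open>
  The coefficients of the binomial series of \<open>sqrt (1 - t)\<close>.
\<close>

definition sqrt_coeff :: "nat \<Rightarrow> real" where
  "sqrt_coeff n = pochhammer (- 1/2) n / fact n"

lemma sqrt_coeff_convolution:
  "(\<Sum>m\<le>n. sqrt_coeff m * sqrt_coeff (n - m)) = (if n = 0 then 1 else if n = 1 then -1 else 0)"
proof -
  have "(\<Sum>m\<le>n. sqrt_coeff m * sqrt_coeff (n - m)) = pochhammer (- 1) n / fact n"
    using pochhammer_binomial_sum[of "- 1/2 :: real" "- 1/2" n]
    by (simp add: sqrt_coeff_def binomial_fact sum_divide_distrib field_simps)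
  moreover have "pochhammer (- 1 :: real) n = 0" if "n \<ge> 2"
    using that by (auto simp: pochhammer_eq_0_iff intro!: exI[of _ 1])
  ultimately show ?thesis
    by (cases n) (auto simp: pochhammer_Suc)
qed

text \<open>
  The partial sums at \<open>t = 1\<close> are nonnegative.  As all coefficients but the first are
  nonpositive, this makes the series converge absolutely on the closed unit disc, so that it may be
  applied to matrices of operator norm \<open>1\<close>.
\<close>

lemma sqrt_coeff_partial_sum: "(\<Sum>m\<le>n. sqrt_coeff m) = pochhammer (1/2) n / fact n"
proof (induction n)
  case (Suc n)
  have "pochhammer (- 1/2 :: real) (Suc n) = (- 1/2) * pochhammer (1/2) n"
    by (simp add: pochhammer_rec)
  then have "sqrt_coeff (Suc n) = - (pochhammer (1/2) n) / (2 * fact (Suc n))"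
    unfolding sqrt_coeff_def by simp
  then have "(\<Sum>m\<le>Suc n. sqrt_coeff m)
      = pochhammer (1/2) n / fact n - pochhammer (1/2) n / (2 * fact (Suc n))"
    using Suc by simp
  also have "\<dots> = pochhammer (1/2) n * (1/2 + real n) / fact (Suc n)"
  proof -
    have "x / f - x / (2 * ((1 + m) * f)) = x * (1/2 + m) / ((1 + m) * f)"
      if "f > 0" "m \<ge> 0" for x f m :: real
      using that by (simp add: divide_simps) (simp add: algebra_simps)
    from this[of "fact n" "real n"] show ?thesis by simp
  qed
  finally show ?case by (simp add: pochhammer_Suc)
qed (simp add: sqrt_coeff_def)

lemma summable_sqrt_coeff: "summable (\<lambda>n. \<bar>sqrt_coeff n\<bar>)"
proof (rule summableI_nonneg_bounded)
  have neg: "sqrt_coeff (Suc n) \<le> 0" for n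
  proof -
    have "sqrt_coeff (Suc n) = - (1/2 * pochhammer (1/2) n / fact (Suc n))"
      by (simp add: sqrt_coeff_def pochhammer_rec)
    also have "\<dots> \<le> 0" by (simp add: pochhammer_nonneg)
    finally show ?thesis .
  qed
  have eq: "(\<Sum>m\<le>n. \<bar>sqrt_coeff m\<bar>) = 2 - (\<Sum>m\<le>n. sqrt_coeff m)" for n
  proof (induction n)
    case (Suc n)
    then show ?case using neg[of n] by simp
  qed (simp add: sqrt_coeff_def)
  have "(\<Sum>m\<le>n. \<bar>sqrt_coeff m\<bar>) \<le> 2" for n
    unfolding eq sqrt_coeff_partial_sum by (simp add: pochhammer_nonneg)
  then show "(\<Sum>m<n. \<bar>sqrt_coeff m\<bar>) \<le> 2" for n
    by (cases n) (simp_all flip: lessThan_Suc_atMost)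
qed simp

text \<open>
  Matrices are functions of two indices, of which the values below \<open>k\<close> count.
\<close>

primrec mat_power :: "nat \<Rightarrow> (nat \<Rightarrow> nat \<Rightarrow> complex) \<Rightarrow> nat \<Rightarrow> nat \<Rightarrow> nat \<Rightarrow> complex" where
  "mat_power k b 0 i j = (if i = j then 1 else 0)"
| "mat_power k b (Suc n) i j = (\<Sum>l<k. mat_power k b n i l * b l j)"

lemma mat_power_add:
  assumes "j < k"
  shows "(\<Sum>l<k. mat_power k b m i l * mat_power k b n l j) = mat_power k b (m + n) i j"
  using assms
proof (induction n arbitrary: j)
  case 0
  have "(\<Sum>l<k. mat_power k b m i l * mat_power k b 0 l j)
      = (\<Sum>l<k. if l = j then mat_power k b m i j else 0)"
    by (intro sum.cong) auto
  then show ?case using 0 by simp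
next
  case (Suc n)
  have "(\<Sum>l<k. mat_power k b m i l * mat_power k b (Suc n) l j)
      = (\<Sum>l<k. \<Sum>p<k. mat_power k b m i l * mat_power k b n l p * b p j)"
    by (simp add: sum_distrib_left mult.assoc)
  also have "\<dots> = (\<Sum>p<k. \<Sum>l<k. mat_power k b m i l * mat_power k b n l p * b p j)"
    by (rule sum.swap)
  also have "\<dots> = (\<Sum>p<k. mat_power k b (m + n) i p * b p j)"
    by (intro sum.cong refl) (simp add: Suc.IH flip: sum_distrib_right)
  finally show ?case by simp
qed

lemma mat_power_hermitian:
  assumes herm: "\<And>i j. i < k \<Longrightarrow> j < k \<Longrightarrow> cnj (b i j) = b j i" and "i < k" "j < k"
  shows "cnj (mat_power k b n i j) = mat_power k b n j i"
  using assms(2,3)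
proof (induction n arbitrary: i j)
  case (Suc n)
  have one: "mat_power k b 1 p q = b p q" if "p < k" for p q
  proof -
    have "mat_power k b 1 p q = (\<Sum>l<k. if l = p then b p q else 0)"
      unfolding One_nat_def mat_power.simps by (intro sum.cong) auto
    then show ?thesis using that by simp
  qed
  have "cnj (mat_power k b (Suc n) i j) = (\<Sum>l<k. mat_power k b 1 j l * mat_power k b n l i)"
    unfolding mat_power.simps cnj_sum
    by (intro sum.cong refl) (use Suc herm one in \<open>simp add: mult.commute\<close>)
  also have "\<dots> = mat_power k b (Suc n) j i"
    using mat_power_add[of i k b 1 j n] Suc.prems by simp
  finally show ?case .
qed simp

lemma cauchy_schwarz_complex_sum:
  fixes u v :: "'a \<Rightarrow> complex"
  shows "(cmod (\<Sum>i\<in>I. u i * v i))\<^sup>2 \<le> (\<Sum>i\<in>I. (cmod (u i))\<^sup>2) * (\<Sum>i\<in>I. (cmod (v i))\<^sup>2)"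
proof -
  have "cmod (\<Sum>i\<in>I. u i * v i) \<le> (\<Sum>i\<in>I. cmod (u i) * cmod (v i))"
    by (intro order_trans[OF norm_sum]) (simp add: norm_mult)
  then have "(cmod (\<Sum>i\<in>I. u i * v i))\<^sup>2 \<le> (\<Sum>i\<in>I. cmod (u i) * cmod (v i))\<^sup>2"
    by (intro power_mono) auto
  also have "\<dots> \<le> (\<Sum>i\<in>I. (cmod (u i))\<^sup>2) * (\<Sum>i\<in>I. (cmod (v i))\<^sup>2)"
    by (rule Cauchy_Schwarz_ineq_sum)
  finally show ?thesis .
qed

text \<open>
  With \<open>u = v c\<^sup>*\<close> the left side is \<open>\<parallel>v\<parallel>\<^sup>2 - 2 \<parallel>u\<parallel>\<^sup>2 + \<parallel>u c\<parallel>\<^sup>2\<close>, and \<open>\<parallel>u c\<parallel> \<le> \<parallel>u\<parallel>\<close> because the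
  operator norm of \<open>c\<close> is at most its Hilbert--Schmidt norm.
\<close>

lemma one_minus_gram_contracts:
  fixes c :: "'i \<Rightarrow> nat \<Rightarrow> complex" and v :: "nat \<Rightarrow> complex"
  assumes c: "(\<Sum>l\<in>L. \<Sum>i<k. (cmod (c l i))\<^sup>2) \<le> 1"
    and b: "\<And>i j. b i j = (if i = j then 1 else 0) - (\<Sum>l\<in>L. cnj (c l i) * c l j)"
  shows "(\<Sum>j<k. (cmod (\<Sum>i<k. v i * b i j))\<^sup>2) \<le> (\<Sum>j<k. (cmod (v j))\<^sup>2)"
proof -
  define u where "u l = (\<Sum>i<k. v i * cnj (c l i))" for l
  define w where "w j = (\<Sum>l\<in>L. u l * c l j)" for j
  have vb: "(\<Sum>i<k. v i * b i j) = v j - w j" if "j < k" for j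
  proof -
    have "(\<Sum>i<k. v i * (if i = j then 1 else 0)) = (\<Sum>i<k. if i = j then v j else 0)"
      by (intro sum.cong) auto
    then have "(\<Sum>i<k. v i * b i j)
        = (\<Sum>i<k. if i = j then v j else 0) - (\<Sum>i<k. \<Sum>l\<in>L. v i * cnj (c l i) * c l j)"
      unfolding b right_diff_distrib sum_subtractf sum_distrib_left by (simp only: mult.assoc)
    also have "(\<Sum>i<k. \<Sum>l\<in>L. v i * cnj (c l i) * c l j) = w j"
      unfolding w_def u_def sum_distrib_right by (rule sum.swap)
    finally show ?thesis using that by simp
  qed
  have inner: "(\<Sum>j<k. cnj (v j) * w j) = of_real (\<Sum>l\<in>L. (cmod (u l))\<^sup>2)"
  proof -
    have "(\<Sum>j<k. cnj (v j) * w j) = (\<Sum>l\<in>L. \<Sum>j<k. u l * cnj (v j * cnj (c l j)))"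
      unfolding w_def sum_distrib_left by (subst sum.swap) (simp add: ac_simps)
    also have "\<dots> = (\<Sum>l\<in>L. u l * cnj (u l))"
      by (simp add: u_def sum_distrib_left)
    finally show ?thesis by (simp only: of_real_sum complex_norm_square)
  qed
  have w_bound: "(\<Sum>j<k. (cmod (w j))\<^sup>2) \<le> (\<Sum>l\<in>L. (cmod (u l))\<^sup>2)"
  proof -
    have "(\<Sum>j<k. (cmod (w j))\<^sup>2)
        \<le> (\<Sum>j<k. (\<Sum>l\<in>L. (cmod (u l))\<^sup>2) * (\<Sum>l\<in>L. (cmod (c l j))\<^sup>2))"
      unfolding w_def by (intro sum_mono cauchy_schwarz_complex_sum)
    also have "\<dots> = (\<Sum>l\<in>L. (cmod (u l))\<^sup>2) * (\<Sum>l\<in>L. \<Sum>j<k. (cmod (c l j))\<^sup>2)"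
      using sum.swap[of "\<lambda>j l. (cmod (c l j))\<^sup>2" "L" "{..<k}"]
      by (simp flip: sum_distrib_left)
    also have "\<dots> \<le> (\<Sum>l\<in>L. (cmod (u l))\<^sup>2)"
      using c by (intro mult_left_le) (auto intro: sum_nonneg)
    finally show ?thesis .
  qed
  have sq: "(cmod (x - y))\<^sup>2 = (cmod x)\<^sup>2 - 2 * Re (cnj x * y) + (cmod y)\<^sup>2" for x y
    unfolding cmod_power2 by (simp add: power2_eq_square algebra_simps)
  have "(\<Sum>j<k. (cmod (\<Sum>i<k. v i * b i j))\<^sup>2) = (\<Sum>j<k. (cmod (v j - w j))\<^sup>2)"
    by (simp add: vb)
  also have "\<dots> = (\<Sum>j<k. (cmod (v j))\<^sup>2) - 2 * Re (\<Sum>j<k. cnj (v j) * w j) + (\<Sum>j<k. (cmod (w j))\<^sup>2)"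
    unfolding sq by (simp add: sum.distrib sum_subtractf Re_sum flip: sum_distrib_left)
  also have "\<dots> \<le> (\<Sum>j<k. (cmod (v j))\<^sup>2)"
    using w_bound sum_nonneg[of "L" "\<lambda>l. (cmod (u l))\<^sup>2"] unfolding inner by simp
  finally show ?thesis .
qed

text \<open>
  Row \<open>i\<close> of the \<open>n\<close>-th power arises from a unit vector by \<open>n\<close> applications of the contraction.
\<close>

lemma mat_power_entry_bound:
  assumes contr: "\<And>v. (\<Sum>j<k. (cmod (\<Sum>i<k. v i * b i j))\<^sup>2) \<le> (\<Sum>j<k. (cmod (v j))\<^sup>2)"
    and ij: "i < k" "j < k"
  shows "cmod (mat_power k b n i j) \<le> 1"
proof -
  have "(\<Sum>j<k. (cmod (mat_power k b n i j))\<^sup>2) \<le> 1"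
  proof (induction n)
    case 0
    have "(\<Sum>j<k. (cmod (mat_power k b 0 i j))\<^sup>2) = (\<Sum>j<k. if j = i then 1 else 0)"
      by (intro sum.cong) auto
    then show ?case using ij by simp
  next
    case (Suc n)
    have "(\<Sum>j<k. (cmod (mat_power k b (Suc n) i j))\<^sup>2) \<le> (\<Sum>j<k. (cmod (mat_power k b n i j))\<^sup>2)"
      using contr[of "mat_power k b n i"] by simp
    then show ?case using Suc by linarith
  qed
  moreover have "(cmod (mat_power k b n i j))\<^sup>2 \<le> (\<Sum>j<k. (cmod (mat_power k b n i j))\<^sup>2)"
    using ij by (intro member_le_sum) auto
  ultimately have "(cmod (mat_power k b n i j))\<^sup>2 \<le> 1"
    by linarith
  then show ?thesis
    unfolding abs_square_le_1 by simp
qed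

lemma continuous_mat_power:
  assumes "\<And>i j. continuous_on S (\<lambda>x. b x i j)"
  shows "continuous_on S (\<lambda>x. mat_power k (b x) n i j)"
proof (induction n arbitrary: i j)
  case (Suc n)
  show ?case unfolding mat_power.simps by (intro continuous_intros Suc assms)
qed simp

text \<open>
  The \<open>k \<times> k\<close> Gram matrix of a tall matrix \<open>c\<close> is positive, so it equals \<open>d\<^sup>* d\<close> for its square
  root \<open>d\<close>.  After scaling \<open>c\<close> to Hilbert--Schmidt norm at most \<open>1\<close>, the root is the binomial series
  in \<open>b = 1 - c\<^sup>* c\<close>; it converges uniformly on \<open>K\<close>, which gives continuity.
\<close>

lemma gram_reduction:
  fixes c :: "'i \<Rightarrow> nat \<Rightarrow> 'k::topological_space \<Rightarrow> complex"
  assumes K: "compact (UNIV :: 'k set)"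
    and cont: "\<And>l i. continuous_on UNIV (c l i)"
  shows "\<exists>d. (\<forall>l i. continuous_on UNIV (d l i)) \<and>
    (\<forall>i<k. \<forall>j<k. \<forall>x. (\<Sum>l\<in>L. cnj (c l i x) * c l j x) = (\<Sum>l<k. cnj (d l i x) * d l j x))"
proof -
  define F where "F x = (\<Sum>l\<in>L. \<Sum>i<k. (cmod (c l i x))\<^sup>2)" for x
  have "continuous_on UNIV F"
    unfolding F_def using cont by (intro continuous_intros)
  then have "bounded (range F)"
    using K by (intro compact_imp_bounded compact_continuous_image)
  then obtain R where R: "0 < R" "\<forall>y\<in>range F. norm y \<le> R"
    unfolding bounded_pos by blast
  have F_le: "F x \<le> R" for x
    using R(2) by (auto dest: abs_le_D1)
  define c' where "c' x l i = c l i x / of_real (sqrt R)" for x l i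
  have c': "(\<Sum>l\<in>L. \<Sum>i<k. (cmod (c' x l i))\<^sup>2) \<le> 1" for x
  proof -
    have "(\<Sum>l\<in>L. \<Sum>i<k. (cmod (c' x l i))\<^sup>2) = F x / R"
      unfolding F_def c'_def using R(1)
      by (simp add: norm_divide power_divide sum_divide_distrib)
    then show ?thesis using R(1) F_le by simp
  qed
  define b where "b x i j = (if i = j then 1 else 0) - (\<Sum>l\<in>L. cnj (c' x l i) * c' x l j)" for x i j
  have b_cont: "continuous_on UNIV (\<lambda>x. b x i j)" for i j
    unfolding b_def c'_def using R(1) by (intro continuous_intros cont) auto
  have b_herm: "cnj (b x i j) = b x j i" for x i j
    unfolding b_def by (simp add: mult.commute)
  have contr: "(\<Sum>j<k. (cmod (\<Sum>i<k. v i * b x i j))\<^sup>2) \<le> (\<Sum>j<k. (cmod (v j))\<^sup>2)" for v x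
    by (rule one_minus_gram_contracts[OF c' b_def])
  note P_bound = mat_power_entry_bound[OF contr]
  define t where "t x i j n = of_real (sqrt_coeff n) * mat_power k (b x) n i j" for x i j n
  have t_bound: "cmod (t x i j n) \<le> \<bar>sqrt_coeff n\<bar>" if "i < k" "j < k" for x i j n
    unfolding t_def norm_mult using P_bound[OF that, of x n] by (simp add: mult_left_le)
  have t_summable: "summable (\<lambda>n. cmod (t x i j n))" if "i < k" "j < k" for x i j
    by (rule summable_comparison_test'[OF summable_sqrt_coeff, of 0]) (simp add: t_bound that)
  define S where "S x i j = (\<Sum>n. t x i j n)" for x i j
  have S_cont: "continuous_on UNIV (\<lambda>x. S x i j)" if ij: "i < k" "j < k" for i j
  proof (rule uniform_limit_theorem)
    show "uniform_limit UNIV (\<lambda>n x. \<Sum>m<n. t x i j m) (\<lambda>x. S x i j) sequentially"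
      unfolding S_def by (rule Weierstrass_m_test[OF _ summable_sqrt_coeff]) (rule t_bound[OF ij])
    show "\<forall>\<^sub>F n in sequentially. continuous_on UNIV (\<lambda>x. \<Sum>m<n. t x i j m)"
      unfolding t_def by (intro always_eventually allI continuous_intros continuous_mat_power b_cont)
  qed simp
  have S_herm: "cnj (S x i j) = S x j i" if ij: "i < k" "j < k" for x i j
  proof -
    have "(\<lambda>n. t x i j n) sums S x i j"
      unfolding S_def by (rule summable_sums[OF summable_norm_cancel[OF t_summable[OF ij]]])
    then have "(\<lambda>n. cnj (t x i j n)) sums cnj (S x i j)"
      by (simp only: sums_cnj)
    moreover have "cnj (t x i j n) = t x j i n" for n
      unfolding t_def using mat_power_hermitian[of k "b x" i j n] b_herm ij by simp
    ultimately show ?thesis unfolding S_def by (simp add: sums_unique)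
  qed
  have S_square: "(\<Sum>l<k. S x i l * S x l j) = (\<Sum>l\<in>L. cnj (c' x l i) * c' x l j)"
    if ij: "i < k" "j < k" for x i j
  proof -
    have "(\<lambda>n. \<Sum>m\<le>n. t x i l m * t x l j (n - m)) sums (S x i l * S x l j)" if "l < k" for l
      unfolding S_def using that ij by (intro Cauchy_product_sums t_summable)
    then have "(\<lambda>n. \<Sum>l<k. \<Sum>m\<le>n. t x i l m * t x l j (n - m)) sums (\<Sum>l<k. S x i l * S x l j)"
      by (intro sums_sum) simp
    moreover have "(\<Sum>l<k. \<Sum>m\<le>n. t x i l m * t x l j (n - m))
        = of_real (if n = 0 then 1 else if n = 1 then -1 else 0) * mat_power k (b x) n i j" for n
    proof -
      have "(\<Sum>l<k. \<Sum>m\<le>n. t x i l m * t x l j (n - m))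
          = (\<Sum>m\<le>n. \<Sum>l<k. of_real (sqrt_coeff m * sqrt_coeff (n - m)) *
              (mat_power k (b x) m i l * mat_power k (b x) (n - m) l j))"
        by (subst sum.swap) (simp add: t_def ac_simps)
      also have "\<dots> = (\<Sum>m\<le>n. of_real (sqrt_coeff m * sqrt_coeff (n - m)) * mat_power k (b x) n i j)"
        unfolding sum_distrib_left[symmetric] by (intro sum.cong refl) (simp add: mat_power_add ij)
      also have "\<dots> = of_real (\<Sum>m\<le>n. sqrt_coeff m * sqrt_coeff (n - m)) * mat_power k (b x) n i j"
        by (simp add: sum_distrib_right)
      finally show ?thesis unfolding sqrt_coeff_convolution .
    qed
    moreover have "(\<lambda>n. of_real (if n = 0 then 1 else if n = 1 then -1 else 0) * mat_power k (b x) n i j)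
        sums (\<Sum>n\<in>{0,1}. of_real (if n = 0 then 1 else if n = 1 then -1 else 0) * mat_power k (b x) n i j)"
      by (rule sums_finite) auto
    ultimately have "(\<Sum>l<k. S x i l * S x l j) =
       (\<Sum>n\<in>{0,1}. of_real (if n = 0 then 1 else if n = 1 then -1 else 0) * mat_power k (b x) n i j)"
      by (simp only: sums_unique2)
    also have "\<dots> = (if i = j then 1 else 0) - (\<Sum>l<k. (if i = l then 1 else 0) * b x l j)"
      by simp
    also have "(\<Sum>l<k. (if i = l then 1 else 0) * b x l j) = (\<Sum>l<k. if l = i then b x i j else 0)"
      by (intro sum.cong) auto
    finally show ?thesis using ij by (simp add: b_def)
  qed
  define d where "d l i x = (if l < k \<and> i < k then of_real (sqrt R) * S x l i else 0)" for l i x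
  have "continuous_on UNIV (d l i)" for l i
    unfolding d_def using S_cont by (cases "l < k \<and> i < k") (auto intro!: continuous_intros)
  moreover have "(\<Sum>l\<in>L. cnj (c l i x) * c l j x) = (\<Sum>l<k. cnj (d l i x) * d l j x)"
    if ij: "i < k" "j < k" for i j x
  proof -
    have R2: "of_real (sqrt R) * of_real (sqrt R) = (of_real R :: complex)"
      using R(1) by (simp flip: of_real_mult)
    have "(\<Sum>l<k. cnj (d l i x) * d l j x) = of_real R * (\<Sum>l<k. S x i l * S x l j)"
      unfolding sum_distrib_left
      by (intro sum.cong refl) (use ij in \<open>simp add: d_def S_herm algebra_simps flip: R2\<close>)
    also have "\<dots> = (\<Sum>l\<in>L. of_real R * (cnj (c' x l i) * c' x l j))"
      by (simp add: S_square ij sum_distrib_left)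
    also have "\<dots> = (\<Sum>l\<in>L. cnj (c l i x) * c l j x)"
      by (intro sum.cong refl) (use R(1) in \<open>simp add: c'_def field_simps flip: R2\<close>)
    finally show ?thesis by simp
  qed
  ultimately show ?thesis by blast
qed

section \<open>Representations of C(K) on Hilbert spaces\<close>

text \<open>
  The common properties of Banach spaces and of the bounded operators that the norm estimates
  below use.
\<close>

definition seminormed :: "('a::complex_vector, 'm) nspace_scheme \<Rightarrow> bool" where
  "seminormed X \<longleftrightarrow> complex_vector.subspace (car X)
    \<and> (\<forall>x\<in>car X. \<forall>y\<in>car X. nrm X (x + y) \<le> nrm X x + nrm X y)
    \<and> (\<forall>c. \<forall>x\<in>car X. nrm X (c *\<^sub>C x) = cmod c * nrm X x)"

lemma seminormed_cbanach: "cbanach X \<Longrightarrow> seminormed X"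
  by (simp add: cbanach_def seminormed_def)

lemma cinner_add_right: "cinner x (y + z) = cinner x y + cinner (x::'h::chilbert_space) z"
  using cinner_commute[of x "y + z"] cinner_commute[of x y] cinner_commute[of x z]
  by (simp add: cinner_add_left)

lemma cinner_scaleC_right: "cinner x (c *\<^sub>C y) = cnj c * cinner (x::'h::chilbert_space) y"
  using cinner_commute[of x "c *\<^sub>C y"] cinner_commute[of x y]
  by (simp add: cinner_scaleC_left)

lemma Re_cinner_commute: "Re (cinner x y) = Re (cinner (y::'h::chilbert_space) x)"
  using cinner_commute[of x y] by simp

lemma norm_sq_eq_cinner: "(norm (x::'h::chilbert_space))\<^sup>2 = Re (cinner x x)"
  by (simp add: cinner_self)

lemma norm_add_sq:
  "(norm (x + y))\<^sup>2 = (norm x)\<^sup>2 + 2 * Re (cinner x y) + (norm (y::'h::chilbert_space))\<^sup>2"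
  unfolding norm_sq_eq_cinner
  by (simp add: cinner_add_left cinner_add_right Re_cinner_commute[of y x])

lemma cinner_scaleR_left: "cinner (r *\<^sub>R x) y = of_real r * cinner (x::'h::chilbert_space) y"
  by (simp add: scaleR_eq_scaleC cinner_scaleC_left)

lemma cinner_minus_right: "cinner x (- y) = - cinner (x::'h::chilbert_space) y"
  using cinner_scaleC_right[of x "-1" y] by simp

lemma norm_scaleC: "norm (c *\<^sub>C x) = cmod c * norm (x::'h::chilbert_space)"
proof -
  have "complex_of_real ((norm (c *\<^sub>C x))\<^sup>2) = c * cnj c * cinner x x"
    by (simp only: cinner_self[symmetric] cinner_scaleC_left cinner_scaleC_right) (simp only: ac_simps)
  also have "\<dots> = of_real ((cmod c * norm x)\<^sup>2)"
    by (simp only: complex_norm_square[symmetric] cinner_self power_mult_distrib of_real_mult)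
  finally have "(norm (c *\<^sub>C x))\<^sup>2 = (cmod c * norm x)\<^sup>2"
    by (simp only: of_real_eq_iff)
  then show ?thesis by simp
qed

text \<open>
  Cauchy--Schwarz for the real part, from \<open>\<parallel>\<parallel>y\<parallel> x - \<parallel>x\<parallel> y\<parallel>\<^sup>2 \<ge> 0\<close>.
\<close>

lemma abs_Re_cinner_le:
  fixes x y :: "'h::chilbert_space"
  shows "\<bar>Re (cinner x y)\<bar> \<le> norm x * norm y"
proof -
  have *: "Re (cinner x y) \<le> norm x * norm y" for x y :: 'h
  proof (cases "x = 0 \<or> y = 0")
    case True
    have "cinner 0 y = 0" for y :: 'h using cinner_scaleC_left[of 0 0 y] by simp
    moreover have "cinner x 0 = 0" for x :: 'h using cinner_scaleC_right[of x 0 0] by simp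
    ultimately show ?thesis using True by auto
  next
    case False
    have "0 \<le> (norm ((norm y) *\<^sub>R x + - ((norm x) *\<^sub>R y)))\<^sup>2" by simp
    also have "\<dots> = 2 * (norm x * norm y) * (norm x * norm y) - 2 * (norm x * norm y) * Re (cinner x y)"
      unfolding norm_add_sq
      by (simp add: cinner_minus_right cinner_scaleR_left scaleR_eq_scaleC[of _ y]
          cinner_scaleC_right power_mult_distrib norm_scaleC)
        (simp add: power2_eq_square algebra_simps)
    finally have "(norm x * norm y) * Re (cinner x y) \<le> (norm x * norm y) * (norm x * norm y)"
      by linarith
    then show ?thesis using False by simp
  qed
  show ?thesis using *[of x y] *[of x "- y"] by (simp add: cinner_minus_right abs_le_iff)
qed

text \<open>
  The representing vector minimises \<open>J x = \<parallel>x\<parallel>\<^sup>2 - 2 Re (f x)\<close>.  By the parallelogram law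
  minimising sequences are Cauchy, and the vanishing first variation of \<open>J\<close> is the claim.
\<close>

lemma riesz_representation:
  fixes f :: "'h::chilbert_space \<Rightarrow> complex"
  assumes bl: "bounded_linear f" and cl: "\<And>c x. f (c *\<^sub>C x) = c * f x"
  shows "\<exists>z. \<forall>x. f x = cinner x z"
proof -
  interpret f: bounded_linear f by (rule bl)
  define J where "J x = (norm x)\<^sup>2 - 2 * Re (f x)" for x
  obtain C where C: "\<And>x. cmod (f x) \<le> norm x * C" using f.bounded by blast
  have J_below: "- C\<^sup>2 \<le> J x" for x
  proof -
    have "Re (f x) \<le> norm x * C" using C[of x] complex_Re_le_cmod[of "f x"] by linarith
    moreover have "0 \<le> (norm x - C)\<^sup>2" by simp
    ultimately show ?thesis by (simp add: J_def power2_eq_square algebra_simps)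
  qed
  define m where "m = (INF x. J x)"
  have m_le: "m \<le> J x" for x
    unfolding m_def by (intro cINF_lower bdd_belowI2[of _ "- C\<^sup>2"] J_below) simp
  have "\<exists>x. J x < m + 1 / real (Suc n)" for n
  proof (rule ccontr)
    assume "\<not> ?thesis"
    then have "m + 1 / real (Suc n) \<le> (INF x. J x)"
      by (intro cINF_greatest) (auto simp: not_less)
    then show False unfolding m_def by (simp add: field_simps)
  qed
  then obtain s where s: "\<And>n. J (s n) < m + 1 / real (Suc n)" by metis
  have mid: "(norm (x - y))\<^sup>2 = 2 * J x + 2 * J y - 4 * J ((1/2) *\<^sub>R (x + y))" for x y
  proof -
    have "(norm ((1/2) *\<^sub>R (x + y)))\<^sup>2 = (norm (x + y))\<^sup>2 / 4"
      by (simp add: power_divide)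
    then show ?thesis
      using norm_add_sq[of x y] norm_add_sq[of x "- y"]
      by (simp add: J_def f.scaleR f.add cinner_minus_right algebra_simps)
  qed
  have "Cauchy s"
    unfolding Cauchy_def dist_norm
  proof (intro allI impI)
    fix e :: real assume e: "0 < e"
    obtain N where N: "4 / e\<^sup>2 < real N" using reals_Archimedean2 by blast
    have "norm (s i - s j) < e" if "i \<ge> N" "j \<ge> N" for i j
    proof -
      have bd: "1 / real (Suc i) < e\<^sup>2 / 4" if "i \<ge> N" for i
      proof -
        have "4 / e\<^sup>2 < real (Suc i)" using N that by linarith
        then show ?thesis using e by (simp add: field_simps)
      qed
      have "(norm (s i - s j))\<^sup>2 \<le> 2 * (1 / real (Suc i)) + 2 * (1 / real (Suc j))"
        unfolding mid using s[of i] s[of j] m_le[of "(1/2) *\<^sub>R (s i + s j)"] by linarith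
      also have "\<dots> < e\<^sup>2" using bd[OF that(1)] bd[OF that(2)] by linarith
      finally show ?thesis using e by (rule_tac power_less_imp_less_base) auto
    qed
    then show "\<exists>M. \<forall>i\<ge>M. \<forall>j\<ge>M. norm (s i - s j) < e" by blast
  qed
  then obtain z where z: "s \<longlonglongrightarrow> z"
    using Cauchy_convergent convergent_def by blast
  have "(\<lambda>n. J (s n)) \<longlonglongrightarrow> J z"
    unfolding J_def by (intro tendsto_intros z f.tendsto)
  moreover have "(\<lambda>n. m + 1 / real (Suc n)) \<longlonglongrightarrow> m + 0"
    by (intro tendsto_intros LIMSEQ_Suc[OF lim_1_over_n])
  ultimately have "J z \<le> m"
    using s by (intro LIMSEQ_le[of "\<lambda>n. J (s n)" _ "\<lambda>n. m + 1 / real (Suc n)"])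
      (auto intro: less_imp_le)
  then have min: "J z \<le> J x" for x using m_le[of x] by linarith
  have re: "Re (cinner h z) = Re (f h)" for h
  proof -
    define a where "a = (norm h)\<^sup>2"
    define b where "b = Re (cinner h z) - Re (f h)"
    have a: "0 \<le> a" by (simp add: a_def)
    have quad: "0 \<le> t\<^sup>2 * a + 2 * t * b" for t
      using min[of "t *\<^sub>R h + z"] unfolding J_def norm_add_sq
      by (simp add: f.add f.scaleR cinner_scaleR_left a_def b_def power_mult_distrib
          algebra_simps)
    \<comment> \<open>This choice of \<open>t\<close> makes the quadratic form negative unless \<open>b = 0\<close>, for \<open>a = 0\<close> as well.\<close>
    have "0 \<le> (- b / (a + 1))\<^sup>2 * a + 2 * (- b / (a + 1)) * b" by (rule quad)
    also have "\<dots> = - (b\<^sup>2 * (a + 2)) / (a + 1)\<^sup>2"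
      using a by (simp add: divide_simps) (simp add: power2_eq_square algebra_simps)
    finally have "b\<^sup>2 * (a + 2) \<le> 0"
      using a by (simp add: divide_le_0_iff zero_le_divide_iff)
    then have "b = 0"
      using a by (auto simp: mult_le_0_iff)
    then show ?thesis by (simp add: b_def)
  qed
  have "f h = cinner h z" for h
    using re[of h] re[of "\<i> *\<^sub>C h"] by (simp add: complex_eq_iff cl cinner_scaleC_left)
  then show ?thesis by blast
qed

lemma car_bounded_ops:
  "S \<in> car bounded_ops \<longleftrightarrow> bounded_linear S \<and> (\<forall>c x. S (c *\<^sub>C x) = c *\<^sub>C S x)"
  by (simp add: bounded_ops_def)

lemma mul_bounded_ops: "mul bounded_ops S R = S \<circ> R"
  and adj_bounded_ops: "adj bounded_ops S = hilbert_adjoint S"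
  and nrm_bounded_ops: "nrm bounded_ops = onorm"
  by (simp_all add: bounded_ops_def)

text \<open>
  \<^const>\<open>hilbert_adjoint\<close> is a definite description; the Riesz theorem shows that the adjoint
  exists.
\<close>

lemma hilbert_adjoint:
  fixes S :: "'h::chilbert_space \<Rightarrow> 'h"
  assumes S: "S \<in> car bounded_ops"
  shows "cinner (S x) y = cinner x (hilbert_adjoint S y)"
proof -
  have "\<exists>z. \<forall>x. cinner (S x) y = cinner x z" for y
  proof (rule riesz_representation)
    have bl: "bounded_linear S" and cl: "\<And>c x. S (c *\<^sub>C x) = c *\<^sub>C S x"
      using S by (auto simp: car_bounded_ops)
    interpret S: bounded_linear S by (rule bl)
    show "cinner (S (c *\<^sub>C x)) y = c * cinner (S x) y" for c x
      by (simp add: cl cinner_scaleC_left)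
    have "norm (cinner (S x) y) \<le> norm x * (onorm S * 2 * norm y)" for x
    proof -
      have "cmod (cinner (S x) y) \<le> \<bar>Re (cinner (S x) y)\<bar> + \<bar>Im (cinner (S x) y)\<bar>"
        by (rule cmod_le)
      also have "Im (cinner (S x) y) = Re (cinner (S x) (\<i> *\<^sub>C y))"
        by (simp add: cinner_scaleC_right)
      also have "\<bar>Re (cinner (S x) y)\<bar> + \<bar>Re (cinner (S x) (\<i> *\<^sub>C y))\<bar> \<le> 2 * (norm (S x) * norm y)"
        using abs_Re_cinner_le[of "S x" y] abs_Re_cinner_le[of "S x" "\<i> *\<^sub>C y"] by (simp add: norm_scaleC)
      also have "\<dots> \<le> 2 * ((onorm S * norm x) * norm y)"
        by (intro mult_left_mono mult_right_mono onorm bl) auto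
      finally show ?thesis by (simp add: ac_simps)
    qed
    then show "bounded_linear (\<lambda>x. cinner (S x) y)"
      by (intro bounded_linear_intro)
        (auto simp: S.add S.scaleR cinner_add_left cinner_scaleR_left scaleR_conv_of_real)
  qed
  then obtain R where R: "\<And>x y. cinner (S x) y = cinner x (R y)" by metis
  have "hilbert_adjoint S = R"
    unfolding hilbert_adjoint_def
  proof (rule the_equality)
    fix R' assume R': "\<forall>x y. cinner (S x) y = cinner x (R' y)"
    have "cinner x (R' y + - R y) = 0" for x y
      unfolding cinner_add_right cinner_minus_right
      using R'[rule_format, of x y] R[of x y] by simp
    then have "(norm (R' y + - R y))\<^sup>2 = 0" for y
      unfolding norm_sq_eq_cinner by simp
    then show "R' = R" by (simp add: fun_eq_iff)
  qed (use R in simp)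
  then show ?thesis using R by simp
qed

lemma onorm_scaleC:
  fixes S :: "'h::chilbert_space \<Rightarrow> 'h"
  assumes "bounded_linear S"
  shows "onorm (c *\<^sub>C S) = cmod c * onorm S"
proof -
  have "onorm (c *\<^sub>C S) = onorm (\<lambda>x. cmod c *\<^sub>R S x)"
    unfolding onorm_def by (simp add: scaleC_fun_def norm_scaleC)
  also have "\<dots> = cmod c * onorm S"
    using onorm_scaleR[OF assms, of "cmod c"] by simp
  finally show ?thesis .
qed

lemma subspace_bounded_ops:
  "complex_vector.subspace (car (bounded_ops :: ('h::chilbert_space \<Rightarrow> 'h) salgebra))"
  unfolding complex_vector.subspace_def
proof (intro conjI ballI allI)
  show "0 \<in> car (bounded_ops :: ('h \<Rightarrow> 'h) salgebra)"
    by (simp add: car_bounded_ops zero_fun_def bounded_linear_zero)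
  fix S R :: "'h \<Rightarrow> 'h" and c
  assume S: "S \<in> car bounded_ops"
  show "c *\<^sub>C S \<in> car bounded_ops"
    unfolding car_bounded_ops
  proof (intro conjI allI)
    have bl: "bounded_linear S" and cl: "\<And>c x. S (c *\<^sub>C x) = c *\<^sub>C S x"
      using S by (auto simp: car_bounded_ops)
    interpret S: bounded_linear S by (rule bl)
    show "bounded_linear (c *\<^sub>C S)"
    proof (rule bounded_linear_intro[where K = "cmod c * onorm S"])
      show "(c *\<^sub>C S) (x + y) = (c *\<^sub>C S) x + (c *\<^sub>C S) y" for x y
        by (simp add: scaleC_fun_def S.add scaleC_add_right)
      show "(c *\<^sub>C S) (r *\<^sub>R x) = r *\<^sub>R (c *\<^sub>C S) x" for r x
        by (simp add: scaleC_fun_def S.scaleR) (simp add: scaleR_eq_scaleC scaleC_scaleC mult.commute)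
      show "norm ((c *\<^sub>C S) x) \<le> norm x * (cmod c * onorm S)" for x
        using mult_left_mono[OF onorm[OF bl, of x], of "cmod c"]
        by (simp add: scaleC_fun_def norm_scaleC ac_simps)
    qed
    show "(c *\<^sub>C S) (a *\<^sub>C x) = a *\<^sub>C (c *\<^sub>C S) x" for a x
      by (simp add: scaleC_fun_def cl scaleC_scaleC mult.commute)
  qed
  assume R: "R \<in> car bounded_ops"
  show "S + R \<in> car bounded_ops"
    using S R by (simp add: car_bounded_ops plus_fun_def bounded_linear_add scaleC_add_right)
qed

lemma seminormed_bounded_ops:
  "seminormed (bounded_ops :: ('h::chilbert_space \<Rightarrow> 'h) salgebra)"
  unfolding seminormed_def nrm_bounded_ops
  using subspace_bounded_ops onorm_triangle onorm_scaleC
  by (auto simp: car_bounded_ops plus_fun_def)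

lemma car_cfun: "f \<in> car cfun \<longleftrightarrow> continuous_on UNIV f"
  by (simp add: cfun_def)

lemma mul_cfun: "mul cfun f g = (\<lambda>x. f x * g x)"
  by (simp add: cfun_def)

lemma adj_cfun: "adj cfun f = (\<lambda>x. cnj (f x))"
  by (simp add: cfun_def)

text \<open>
  For \<open>N = \<parallel>f\<parallel>\<close> the function \<open>g = sqrt (N\<^sup>2 - \<bar>f\<bar>\<^sup>2)\<close> satisfies \<open>f\<^sup>* f + g\<^sup>* g = N\<^sup>2\<close>, whence
  \<open>\<parallel>\<pi>(f) x\<parallel>\<^sup>2 \<le> N\<^sup>2 \<parallel>\<pi>(1) x\<parallel>\<^sup>2\<close>.  The projection \<open>\<pi>(1)\<close> may differ from the identity.
\<close>

lemma representation_contractive: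
  fixes \<pi> :: "('k::topological_space \<Rightarrow> complex) \<Rightarrow> 'h::chilbert_space \<Rightarrow> 'h"
  assumes K: "compact (UNIV :: 'k set)" and hom: "star_hom cfun bounded_ops \<pi>"
  shows "contractive cfun bounded_ops \<pi>"
  unfolding contractive_def
proof (intro conjI ballI)
  show lin: "clinear_on cfun bounded_ops \<pi>" using hom by (simp add: star_hom_def)
  have ops: "\<pi> f \<in> car bounded_ops" if "continuous_on UNIV f" for f
    using lin that by (auto simp: clinear_on_def car_cfun)
  have sq: "complex_of_real ((norm (\<pi> f x))\<^sup>2) = cinner x (\<pi> (\<lambda>y. cnj (f y) * f y) x)"
    if f: "continuous_on UNIV f" for f x
  proof -
    have f': "continuous_on UNIV (\<lambda>y. cnj (f y))" using f by (intro continuous_intros)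
    have "\<pi> (\<lambda>y. cnj (f y)) = hilbert_adjoint (\<pi> f)"
      using hom f by (simp add: star_hom_def car_cfun adj_cfun adj_bounded_ops)
    moreover have "\<pi> (\<lambda>y. cnj (f y) * f y) = \<pi> (\<lambda>y. cnj (f y)) \<circ> \<pi> f"
      using hom f f' by (simp add: star_hom_def car_cfun mul_cfun mul_bounded_ops)
    ultimately show ?thesis
      by (simp add: hilbert_adjoint[OF ops[OF f], symmetric] cinner_self)
  qed
  fix f :: "'k \<Rightarrow> complex" assume "f \<in> car cfun"
  then have f: "continuous_on UNIV f" by (simp add: car_cfun)
  define N where "N = nrm cfun f"
  have fN: "cmod (f y) \<le> N" for y unfolding N_def by (rule nrm_cfun_upper[OF K f])
  have N: "0 \<le> N" using fN[of undefined] by (meson norm_ge_zero order_trans)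
  define g where "g y = complex_of_real (sqrt (N\<^sup>2 - (cmod (f y))\<^sup>2))" for y
  have g: "continuous_on UNIV g"
    unfolding g_def by (intro continuous_intros f)
  have one: "continuous_on UNIV (\<lambda>_::'k. 1::complex)" by simp
  have sum: "(\<lambda>y. cnj (f y) * f y) + (\<lambda>y. cnj (g y) * g y) = of_real (N\<^sup>2) *\<^sub>C (\<lambda>_. cnj 1 * 1)"
  proof
    fix y
    have "(cmod (f y))\<^sup>2 \<le> N\<^sup>2" using fN by (intro power_mono) auto
    then have "(sqrt (N\<^sup>2 - (cmod (f y))\<^sup>2))\<^sup>2 = N\<^sup>2 - (cmod (f y))\<^sup>2" by simp
    moreover have "cnj (g y) * g y = of_real ((sqrt (N\<^sup>2 - (cmod (f y))\<^sup>2))\<^sup>2)"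
      unfolding g_def power2_eq_square[of "sqrt _"] of_real_mult by simp
    ultimately have "cnj (g y) * g y = of_real (N\<^sup>2 - (cmod (f y))\<^sup>2)"
      by (simp only:)
    moreover have "cnj (f y) * f y = of_real ((cmod (f y))\<^sup>2)"
      by (simp only: complex_norm_square mult.commute)
    ultimately show "((\<lambda>y. cnj (f y) * f y) + (\<lambda>y. cnj (g y) * g y)) y = (of_real (N\<^sup>2) *\<^sub>C (\<lambda>_. cnj 1 * 1)) y"
      by (simp add: scaleC_fun_def scaleC_complex_def)
  qed
  have "norm (\<pi> f x) \<le> N * norm x" for x
  proof -
    have cf: "continuous_on UNIV (\<lambda>y. cnj (f y) * f y)" "continuous_on UNIV (\<lambda>y. cnj (g y) * g y)"
      by (intro continuous_intros f g)+
    have "complex_of_real ((norm (\<pi> f x))\<^sup>2) + complex_of_real ((norm (\<pi> g x))\<^sup>2)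
      = cinner x (\<pi> ((\<lambda>y. cnj (f y) * f y) + (\<lambda>y. cnj (g y) * g y)) x)"
      using lin cf by (simp only: sq f g clinear_on_def car_cfun) (simp add: cinner_add_right)
    also have "\<dots> = of_real (N\<^sup>2) * cinner x (\<pi> (\<lambda>_. cnj 1 * 1) x)"
      using lin by (simp add: sum clinear_on_def car_cfun scaleC_fun_def[of _ "\<pi> _"] cinner_scaleC_right)
    also have "\<dots> = of_real (N\<^sup>2 * (norm (\<pi> (\<lambda>_. 1) x))\<^sup>2)"
      using sq[OF one, of x] by simp
    finally have fg: "(norm (\<pi> f x))\<^sup>2 + (norm (\<pi> g x))\<^sup>2 = N\<^sup>2 * (norm (\<pi> (\<lambda>_. 1) x))\<^sup>2"
      by (simp flip: of_real_add of_real_mult del: of_real_power)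
    have "(norm (\<pi> (\<lambda>_. 1) x))\<^sup>2 = Re (cinner x (\<pi> (\<lambda>_. 1) x))"
      using sq[OF one, of x] by (simp add: complex_eq_iff)
    then have "(norm (\<pi> (\<lambda>_. 1) x))\<^sup>2 \<le> (norm x)\<^sup>2"
      using norm_add_sq[of x "- \<pi> (\<lambda>_. 1) x"] zero_le_power2[of "norm (x + - \<pi> (\<lambda>_. 1) x)"]
      by (simp add: cinner_minus_right)
    then have "N\<^sup>2 * (norm (\<pi> (\<lambda>_. 1) x))\<^sup>2 \<le> N\<^sup>2 * (norm x)\<^sup>2"
      by (intro mult_left_mono) auto
    with fg have "(norm (\<pi> f x))\<^sup>2 \<le> (N * norm x)\<^sup>2"
      using zero_le_power2[of "norm (\<pi> g x)"] unfolding power_mult_distrib by linarith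
    then show ?thesis
      by (rule power2_le_imp_le) (use N in simp)
  qed
  then show "nrm bounded_ops (\<pi> f) \<le> nrm cfun f"
    unfolding nrm_bounded_ops N_def[symmetric] by (rule onorm_bound[OF N])
qed

text \<open>
  If \<open>\<rho> = \<parallel>\<pi>(f)\<parallel> < s < 1\<close>, then \<open>h = max 0 (f - s)\<close> factors as \<open>f\<^sup>m g\<^sub>m\<close> with
  \<open>\<parallel>g\<^sub>m\<parallel> \<le> s\<^sup>-\<^sup>m\<close>, so \<open>\<parallel>\<pi>(h)\<parallel> \<le> (\<rho>/s)\<^sup>m\<close> for all \<open>m\<close>.  Thus \<open>\<pi>(h) = 0\<close> although \<open>h \<noteq> 0\<close>.
\<close>

lemma faithful_rep_norming:
  fixes \<pi> :: "('k::topological_space \<Rightarrow> complex) \<Rightarrow> 'h::chilbert_space \<Rightarrow> 'h" and f :: "'k \<Rightarrow> real"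
  assumes K: "compact (UNIV :: 'k set)" and rep: "faithful_rep cfun \<pi>"
    and f: "continuous_on UNIV f" "\<And>y. 0 \<le> f y" "\<And>y. f y \<le> 1" and fx: "f x = 1"
  shows "1 \<le> nrm bounded_ops (\<pi> (\<lambda>y. complex_of_real (f y)))"
proof (rule ccontr)
  assume contr: "\<not> ?thesis"
  have hom: "star_hom cfun bounded_ops \<pi>" and inj: "inj_on \<pi> (car cfun)"
    using rep by (auto simp: faithful_rep_def)
  have lin: "clinear_on cfun bounded_ops \<pi>" using hom by (simp add: star_hom_def)
  have ops: "bounded_linear (\<pi> g)" if "continuous_on UNIV g" for g
    using lin that by (auto simp: clinear_on_def car_cfun image_subset_iff car_bounded_ops)
  define F where "F = (\<lambda>y. complex_of_real (f y))"
  have F: "continuous_on UNIV F" unfolding F_def by (intro continuous_intros f)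
  define \<rho> where "\<rho> = onorm (\<pi> F)"
  have \<rho>: "0 \<le> \<rho>" "\<rho> < 1"
    using contr onorm_pos_le[OF ops[OF F]] by (auto simp: \<rho>_def F_def nrm_bounded_ops)
  define s where "s = (1 + \<rho>) / 2"
  have s: "0 < s" "\<rho> < s" "s < 1" using \<rho> by (auto simp: s_def)
  define h where "h y = complex_of_real (max 0 (f y - s))" for y
  have h: "continuous_on UNIV h" unfolding h_def by (intro continuous_intros f)
  define g where "g m y = h y / complex_of_real (max (f y) s) ^ m" for m y
  have g: "continuous_on UNIV (g m)" for m
    unfolding g_def using s by (intro continuous_intros f h) (auto simp: max_def)
  have hg: "h = (\<lambda>y. F y ^ m * g m y)" for m
  proof
    fix y
    show "h y = F y ^ m * g m y"
    proof (cases "f y \<le> s")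
      case False
      then show ?thesis using s by (simp add: g_def F_def max_def)
    qed (simp add: h_def g_def)
  qed
  have g_norm: "nrm cfun (g m) \<le> (1 / s) ^ m" for m
  proof (rule nrm_cfun_least)
    fix y
    have "s ^ m \<le> (max (f y) s) ^ m" using s by (intro power_mono) auto
    moreover have "cmod (h y) \<le> 1" using f(3)[of y] s by (simp add: h_def)
    ultimately have "cmod (h y) / (max (f y) s) ^ m \<le> 1 / s ^ m"
      using s by (intro frac_le) auto
    moreover have "cmod (g m y) = cmod (h y) / (max (f y) s) ^ m"
      using s by (simp add: g_def norm_divide norm_power)
    ultimately show "cmod (g m y) \<le> (1 / s) ^ m" by (simp add: power_divide)
  qed
  have pow: "onorm (\<pi> (\<lambda>y. F y ^ m * u y)) \<le> \<rho> ^ m * onorm (\<pi> u)"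
    if u: "continuous_on UNIV u" for u m
  proof (induction m)
    case (Suc m)
    have c: "continuous_on UNIV (\<lambda>y. F y ^ m * u y)" by (intro continuous_intros F u)
    have "\<pi> (\<lambda>y. F y ^ Suc m * u y) = \<pi> F \<circ> \<pi> (\<lambda>y. F y ^ m * u y)"
      using hom F c by (simp add: star_hom_def car_cfun mul_cfun mul_bounded_ops mult.assoc)
    then have "onorm (\<pi> (\<lambda>y. F y ^ Suc m * u y)) \<le> \<rho> * onorm (\<pi> (\<lambda>y. F y ^ m * u y))"
      unfolding \<rho>_def using onorm_compose[OF ops[OF F] ops[OF c]] by simp
    also have "\<dots> \<le> \<rho> * (\<rho> ^ m * onorm (\<pi> u))" by (intro mult_left_mono Suc \<rho>)
    finally show ?case by (simp add: mult.assoc)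
  qed simp
  have bound: "onorm (\<pi> h) \<le> (\<rho> / s) ^ m" for m
  proof -
    have "onorm (\<pi> h) \<le> \<rho> ^ m * onorm (\<pi> (g m))"
      using pow[OF g, of m m] hg[of m] by simp
    also have "\<dots> \<le> \<rho> ^ m * (1 / s) ^ m"
      using representation_contractive[OF K hom] g_norm[of m] g[of m] \<rho>
      by (intro mult_left_mono) (auto simp: contractive_def nrm_bounded_ops car_cfun intro: order_trans)
    finally show ?thesis by (simp add: power_divide)
  qed
  have "(\<lambda>m. (\<rho> / s) ^ m) \<longlonglongrightarrow> 0"
    using \<rho> s by (intro LIMSEQ_realpow_zero) auto
  then have "onorm (\<pi> h) \<le> 0"
    using bound by (intro LIMSEQ_le_const) auto
  then have "onorm (\<pi> h) = 0"
    using onorm_pos_le[OF ops[OF h]] by linarith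
  then have "\<pi> h = 0"
    using onorm_eq_0[OF ops[OF h]] by (simp add: fun_eq_iff)
  moreover have "\<pi> 0 = 0"
  proof -
    have "(0::'k \<Rightarrow> complex) \<in> car cfun" by (simp add: car_cfun zero_fun_def)
    then have "\<pi> (0 *\<^sub>C 0) = 0 *\<^sub>C \<pi> 0" using lin unfolding clinear_on_def by blast
    then show ?thesis by simp
  qed
  ultimately have "h = 0"
    using inj h by (auto simp: inj_on_def car_cfun zero_fun_def)
  then have "h x = 0" by simp
  then show False using fx s by (simp add: h_def)
qed

section \<open>The trace of a finite-dimensional C*-algebra\<close>

text \<open>
  The iterates of \<open>u\<close> are linearly dependent, so \<open>p(L) u = 0\<close> for some polynomial \<open>p \<noteq> 0\<close>.
  Splitting off linear factors of \<open>p\<close> one at a time leads to an eigenvector.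
\<close>

lemma eigenvector_exists:
  fixes L :: "'a::complex_vector \<Rightarrow> 'a"
  assumes sub: "complex_vector.subspace I" and fin: "finite S" "I \<subseteq> complex_vector.span S"
    and add: "\<And>x y. x \<in> I \<Longrightarrow> y \<in> I \<Longrightarrow> L (x + y) = L x + L y"
    and scale: "\<And>c x. x \<in> I \<Longrightarrow> L (c *\<^sub>C x) = c *\<^sub>C L x"
    and inv: "\<And>x. x \<in> I \<Longrightarrow> L x \<in> I"
    and u: "u \<in> I" "u \<noteq> 0"
  shows "\<exists>v\<in>I. v \<noteq> 0 \<and> (\<exists>c. L v = c *\<^sub>C v)"
proof -
  define pa where "pa p = (\<Sum>i\<le>degree p. coeff p i *\<^sub>C (L ^^ i) u)" for p :: "complex poly"
  have Lu: "(L ^^ i) u \<in> I" for i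
    by (induction i) (auto simp: u inv)
  have sumI: "(\<Sum>i\<in>F. f i *\<^sub>C (L ^^ i) u) \<in> I" for F :: "nat set" and f
    by (intro complex_vector.subspace_sum[OF sub] complex_vector.subspace_scale[OF sub] Lu)
  have L_sum: "L (\<Sum>i\<le>n. f i *\<^sub>C (L ^^ i) u) = (\<Sum>i\<le>n. f i *\<^sub>C (L ^^ Suc i) u)" for f and n :: nat
  proof (induction n)
    case (Suc n)
    have "f (Suc n) *\<^sub>C (L ^^ Suc n) u \<in> I"
      by (intro complex_vector.subspace_scale[OF sub] Lu)
    then show ?case using Suc sumI[of f "{..n}"] Lu[of "Suc n"] by (simp add: add scale)
  qed (use Lu[of 0] in \<open>simp add: scale\<close>)
  have pa_eq: "pa p = (\<Sum>i\<le>n. coeff p i *\<^sub>C (L ^^ i) u)" if "degree p \<le> n" for p n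
    unfolding pa_def using that
    by (intro sum.mono_neutral_left) (auto simp: coeff_eq_0)
  have factor: "pa ([:- c, 1:] * q) = L (pa q) - c *\<^sub>C pa q" for c q
  proof -
    have "degree ([:- c, 1:] * q) \<le> Suc (degree q)"
      using degree_mult_le[of "[:- c, 1:]" q] by simp
    then have "pa ([:- c, 1:] * q) = (\<Sum>i\<le>Suc (degree q). coeff ([:- c, 1:] * q) i *\<^sub>C (L ^^ i) u)"
      by (rule pa_eq)
    also have "\<dots> = (\<Sum>i\<le>Suc (degree q). coeff (pCons 0 q) i *\<^sub>C (L ^^ i) u)
        - (\<Sum>i\<le>Suc (degree q). c *\<^sub>C (coeff q i *\<^sub>C (L ^^ i) u))"
      by (simp add: complex_vector.scale_left_diff_distrib scaleC_scaleC sum_subtractf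
          del: sum.atMost_Suc)
    also have "(\<Sum>i\<le>Suc (degree q). c *\<^sub>C (coeff q i *\<^sub>C (L ^^ i) u)) = c *\<^sub>C pa q"
      unfolding pa_eq[of q "Suc (degree q)", OF le_SucI[OF order_refl]]
      by (rule complex_vector.scale_sum_right[symmetric])
    also have "(\<Sum>i\<le>Suc (degree q). coeff (pCons 0 q) i *\<^sub>C (L ^^ i) u) = L (pa q)"
      unfolding pa_def L_sum by (subst sum.atMost_Suc_shift) simp
    finally show ?thesis .
  qed
  have "\<exists>p. p \<noteq> 0 \<and> pa p = 0"
  proof (cases "inj_on (\<lambda>i. (L ^^ i) u) {..card S}")
    case False
    then obtain i j where ij: "i \<noteq> j" "(L ^^ i) u = (L ^^ j) u"
      by (auto simp: inj_on_def)
    let ?p = "monom 1 i - monom 1 j :: complex poly"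
    have "coeff ?p i = 1" using ij(1) by simp
    then have "?p \<noteq> 0" by (metis coeff_0 zero_neq_one)
    moreover have "degree ?p \<le> max i j"
      by (intro degree_diff_le) (auto simp: degree_monom_eq)
    then have "pa ?p = (\<Sum>k\<le>max i j. (if k = i then (L ^^ i) u else 0) - (if k = j then (L ^^ j) u else 0))"
      using ij(1) by (subst pa_eq) (auto intro!: sum.cong simp: complex_vector.scale_left_diff_distrib)
    then have "pa ?p = 0" using ij by (simp add: sum_subtractf)
    ultimately show ?thesis by blast
  next
    case True
    let ?V = "(\<lambda>i. (L ^^ i) u) ` {..card S}"
    have "card ?V = Suc (card S)" using card_image[OF True] by simp
    moreover have "?V \<subseteq> complex_vector.span S" using Lu fin by auto
    ultimately have "complex_vector.dependent ?V"
      using complex_vector.independent_span_bound[OF fin(1), of ?V] by auto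
    then obtain f v where f: "v \<in> ?V" "f v \<noteq> 0" "(\<Sum>v\<in>?V. f v *\<^sub>C v) = 0"
      using complex_vector.dependent_finite[of ?V] by auto
    then obtain k where k: "k \<le> card S" "f ((L ^^ k) u) \<noteq> 0" by auto
    define p where "p = (\<Sum>i\<le>card S. monom (f ((L ^^ i) u)) i)"
    have coeff: "coeff p i = (if i \<le> card S then f ((L ^^ i) u) else 0)" for i
      unfolding p_def coeff_sum by (simp add: sum.delta)
    have "p \<noteq> 0" using k coeff[of k] by auto
    moreover have "degree p \<le> card S"
      by (rule degree_le) (simp add: coeff)
    then have "pa p = (\<Sum>i\<le>card S. f ((L ^^ i) u) *\<^sub>C (L ^^ i) u)"
      by (simp add: pa_eq coeff)
    then have "pa p = 0"
      using f(3) by (simp add: sum.reindex[OF True])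
    ultimately show ?thesis by blast
  qed
  then obtain p where "p \<noteq> 0" "pa p = 0" by blast
  then show ?thesis
  proof (induction "degree p" arbitrary: p rule: less_induct)
    case less
    show ?case
    proof (cases "degree p = 0")
      case True
      then obtain c where "p = [:c:]" by (metis degree_eq_zeroE)
      with less u show ?thesis by (auto simp: pa_def)
    next
      case False
      then obtain c where "poly p c = 0"
        using fundamental_theorem_of_algebra[of p] by (auto simp: constant_degree)
      then obtain q where q: "p = [:- c, 1:] * q"
        by (auto simp: poly_eq_0_iff_dvd dvd_def)
      then have "q \<noteq> 0" using less.prems by auto
      have "degree q < degree p"
        unfolding q using \<open>q \<noteq> 0\<close> by (subst degree_mult_eq) auto
      have L: "L (pa q) = c *\<^sub>C pa q" using less.prems(2) factor[of c q] q by simp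
      have "pa q \<in> I" unfolding pa_def by (rule sumI)
      then show ?thesis
        using L less.hyps[OF \<open>degree q < degree p\<close> \<open>q \<noteq> 0\<close>] by (cases "pa q = 0") auto
    qed
  qed
qed

text \<open>
  The tensor power trick along powers of two: a constant factor is invisible after taking
  \<open>2\<^sup>n\<close>-th roots.
\<close>

lemma le_of_power_le_const_mult:
  fixes a b C :: real
  assumes "0 \<le> a" "0 \<le> b" and pow: "\<And>n. a ^ (2 ^ n) \<le> C * b ^ (2 ^ n)"
  shows "a \<le> b"
proof (rule ccontr)
  assume "\<not> a \<le> b"
  then have ab: "b < a" by simp
  show False
  proof (cases "b = 0")
    case True
    then have "a \<le> 0" using pow[of 0] by simp
    then show False using ab True by simp
  next
    case False
    then have b: "0 < b" using assms by simp
    then obtain N where N: "C < (a / b) ^ N"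
      using real_arch_pow[of "a / b" C] ab by auto
    have "(a / b) ^ N \<le> (a / b) ^ (2 ^ N)"
      using ab b by (intro power_increasing) (auto simp: less_imp_le)
    also have "\<dots> \<le> C" using pow[of N] b by (simp add: power_divide divide_le_eq)
    finally show False using N by simp
  qed
qed

locale cstar =
  fixes B :: "'a::complex_vector salgebra"
  assumes cstar: "cstar_algebra B"
begin

abbreviation A where "A \<equiv> car B"
abbreviation times_B (infixl "\<odot>" 70) where "x \<odot> y \<equiv> mul B x y"
abbreviation st where "st \<equiv> adj B"
abbreviation N where "N \<equiv> nrm B"

lemma cbanach_B: "cbanach B" using cstar by (simp add: cstar_algebra_def)

lemma subspace_A: "complex_vector.subspace A"
  using cbanach_B by (simp add: cbanach_def)

lemma closed [simp]:
  "0 \<in> A"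
  "x \<in> A \<Longrightarrow> y \<in> A \<Longrightarrow> x + y \<in> A"
  "x \<in> A \<Longrightarrow> y \<in> A \<Longrightarrow> x - y \<in> A"
  "x \<in> A \<Longrightarrow> c *\<^sub>C x \<in> A"
  "x \<in> A \<Longrightarrow> y \<in> A \<Longrightarrow> x \<odot> y \<in> A"
  "x \<in> A \<Longrightarrow> st x \<in> A"
  using cstar subspace_A complex_vector.subspace_diff[OF subspace_A]
  by (simp_all add: cstar_algebra_def complex_vector.subspace_def)

lemma sum_closed [simp]: "(\<And>i. i \<in> F \<Longrightarrow> f i \<in> A) \<Longrightarrow> (\<Sum>i\<in>F. f i) \<in> A"
  by (rule complex_vector.subspace_sum[OF subspace_A])

lemma mult_assoc: "x \<in> A \<Longrightarrow> y \<in> A \<Longrightarrow> z \<in> A \<Longrightarrow> x \<odot> y \<odot> z = x \<odot> (y \<odot> z)"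
  and mult_add_left: "x \<in> A \<Longrightarrow> y \<in> A \<Longrightarrow> z \<in> A \<Longrightarrow> (x + y) \<odot> z = x \<odot> z + y \<odot> z"
  and mult_add_right: "x \<in> A \<Longrightarrow> y \<in> A \<Longrightarrow> z \<in> A \<Longrightarrow> x \<odot> (y + z) = x \<odot> y + x \<odot> z"
  and mult_scale_left: "x \<in> A \<Longrightarrow> y \<in> A \<Longrightarrow> (c *\<^sub>C x) \<odot> y = c *\<^sub>C (x \<odot> y)"
  and mult_scale_right: "x \<in> A \<Longrightarrow> y \<in> A \<Longrightarrow> x \<odot> (c *\<^sub>C y) = c *\<^sub>C (x \<odot> y)"
  and st_mult: "x \<in> A \<Longrightarrow> y \<in> A \<Longrightarrow> st (x \<odot> y) = st y \<odot> st x"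
  and st_add: "x \<in> A \<Longrightarrow> y \<in> A \<Longrightarrow> st (x + y) = st x + st y"
  and st_scale: "x \<in> A \<Longrightarrow> st (c *\<^sub>C x) = cnj c *\<^sub>C st x"
  and st_st: "x \<in> A \<Longrightarrow> st (st x) = x"
  using cstar by (simp_all add: cstar_algebra_def)

lemma mult_zero: "x \<in> A \<Longrightarrow> 0 \<odot> x = 0" "x \<in> A \<Longrightarrow> x \<odot> 0 = 0"
  using mult_scale_left[of 0 x 0] mult_scale_right[of x 0 0] by simp_all

lemma st_zero: "st 0 = 0"
  using st_scale[of 0 0] by simp

lemma mult_diff_left: "x \<in> A \<Longrightarrow> y \<in> A \<Longrightarrow> z \<in> A \<Longrightarrow> (x - y) \<odot> z = x \<odot> z - y \<odot> z"
  using mult_add_left[of "x - y" y z] by simp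

lemma mult_diff_right: "x \<in> A \<Longrightarrow> y \<in> A \<Longrightarrow> z \<in> A \<Longrightarrow> z \<odot> (x - y) = z \<odot> x - z \<odot> y"
  using mult_add_right[of z "x - y" y] by simp

lemma st_diff: "x \<in> A \<Longrightarrow> y \<in> A \<Longrightarrow> st (x - y) = st x - st y"
  using st_add[of "x - y" y] by simp

lemma mult_sum_left:
  "(\<And>i. i \<in> F \<Longrightarrow> f i \<in> A) \<Longrightarrow> x \<in> A \<Longrightarrow> (\<Sum>i\<in>F. f i) \<odot> x = (\<Sum>i\<in>F. f i \<odot> x)"
  by (induction F rule: infinite_finite_induct) (simp_all add: mult_zero mult_add_left)

lemma mult_sum_right:
  "(\<And>i. i \<in> F \<Longrightarrow> f i \<in> A) \<Longrightarrow> x \<in> A \<Longrightarrow> x \<odot> (\<Sum>i\<in>F. f i) = (\<Sum>i\<in>F. x \<odot> f i)"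
  by (induction F rule: infinite_finite_induct) (simp_all add: mult_zero mult_add_right)

lemma st_sum: "(\<And>i. i \<in> F \<Longrightarrow> f i \<in> A) \<Longrightarrow> st (\<Sum>i\<in>F. f i) = (\<Sum>i\<in>F. st (f i))"
  by (induction F rule: infinite_finite_induct) (simp_all add: st_zero st_add)

lemma N_nonneg: "x \<in> A \<Longrightarrow> 0 \<le> N x"
  and N_eq_0: "x \<in> A \<Longrightarrow> N x = 0 \<longleftrightarrow> x = 0"
  and N_add: "x \<in> A \<Longrightarrow> y \<in> A \<Longrightarrow> N (x + y) \<le> N x + N y"
  and N_scale: "x \<in> A \<Longrightarrow> N (c *\<^sub>C x) = cmod c * N x"
  using cbanach_B by (simp_all add: cbanach_def)

lemma N_mult: "x \<in> A \<Longrightarrow> y \<in> A \<Longrightarrow> N (x \<odot> y) \<le> N x * N y"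
  and N_st_mult: "x \<in> A \<Longrightarrow> N (st x \<odot> x) = (N x)\<^sup>2"
  using cstar by (simp_all add: cstar_algebra_def)

lemma N_zero: "N 0 = 0"
  using N_eq_0 by simp

lemma N_sum: "(\<And>i. i \<in> F \<Longrightarrow> f i \<in> A) \<Longrightarrow> N (\<Sum>i\<in>F. f i) \<le> (\<Sum>i\<in>F. N (f i))"
proof (induction F rule: infinite_finite_induct)
  case (insert i F)
  then show ?case using N_add[of "f i" "\<Sum>i\<in>F. f i"] by simp
qed (simp_all add: N_zero)

lemma st_mult_eq_0: "x \<in> A \<Longrightarrow> st x \<odot> x = 0 \<Longrightarrow> x = 0"
  using N_st_mult[of x] N_eq_0[of x] by (simp add: N_zero)

lemma N_st: "x \<in> A \<Longrightarrow> N (st x) = N x"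
proof -
  have le: "N y \<le> N (st y)" if y: "y \<in> A" for y
  proof (cases "y = 0")
    case False
    then have "0 < N y" using N_nonneg[OF y] N_eq_0[OF y] by simp
    moreover have "N y * N y \<le> N (st y) * N y"
      using N_st_mult[OF y] N_mult[of "st y" y] y by (simp add: power2_eq_square)
    ultimately show ?thesis by simp
  qed (simp add: N_zero st_zero)
  assume "x \<in> A"
  then show ?thesis using le[of x] le[of "st x"] by (simp add: st_st)
qed

text \<open>
  A self-adjoint square cannot be negative.  For \<open>a = sqrt t f + \<i> x\<close> one gets
  \<open>a\<^sup>* a = t f + x\<^sup>2 = 0\<close>, hence \<open>a = 0\<close>, and \<open>a - a\<^sup>* = 2 \<i> x\<close>.
\<close>

lemma neg_square_self_adjoint_zero:
  assumes x: "x \<in> A" "st x = x" and f: "f \<in> A" "f \<odot> f = f" "st f = f" "f \<odot> x = x" "x \<odot> f = x"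
    and eq: "x \<odot> x = - (complex_of_real t) *\<^sub>C f" and t: "0 < t"
  shows "x = 0"
proof -
  define c where "c = complex_of_real (sqrt t)"
  have c2: "c * c = of_real t" "cnj c = c"
    using t by (simp_all add: c_def flip: of_real_mult)
  define a where "a = c *\<^sub>C f + \<i> *\<^sub>C x"
  have a: "a \<in> A" using x f by (simp add: a_def)
  have sta: "st a = c *\<^sub>C f + (-\<i>) *\<^sub>C x"
    using x f by (simp add: a_def st_add st_scale c2)
  have "st a \<odot> a = of_real t *\<^sub>C f + x \<odot> x"
    unfolding sta unfolding a_def using x f c2
    by (simp add: mult_add_left mult_add_right mult_scale_left mult_scale_right scaleC_scaleC
        scaleC_add_right mult_diff_left complex_vector.scale_right_diff_distrib flip: scaleC_add_left)
  then have "a = 0"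
    using st_mult_eq_0[OF a] unfolding eq by simp
  then have "st a = 0" by (simp add: st_zero)
  have "(2 * \<i>) *\<^sub>C x = a - st a"
    unfolding sta unfolding a_def by (simp flip: scaleC_add_left)
  then show ?thesis using \<open>a = 0\<close> \<open>st a = 0\<close> by simp
qed

inductive_set generated :: "'a set \<Rightarrow> 'a set" for G where
  base: "x \<in> G \<Longrightarrow> x \<in> generated G"
| zero: "0 \<in> generated G"
| add: "x \<in> generated G \<Longrightarrow> y \<in> generated G \<Longrightarrow> x + y \<in> generated G"
| scale: "x \<in> generated G \<Longrightarrow> c *\<^sub>C x \<in> generated G"
| mult: "x \<in> generated G \<Longrightarrow> y \<in> generated G \<Longrightarrow> x \<odot> y \<in> generated G"

lemma abelian_generated:
  assumes G: "G \<subseteq> A" and st: "\<And>x. x \<in> G \<Longrightarrow> st x \<in> G"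
    and comm: "\<And>x y. x \<in> G \<Longrightarrow> y \<in> G \<Longrightarrow> x \<odot> y = y \<odot> x"
  shows "abelian_star_subalgebra B (generated G)"
proof -
  have A: "x \<in> A" if "x \<in> generated G" for x
    using that by induction (use G in auto)
  have stg: "st x \<in> generated G" if "x \<in> generated G" for x
    using that by induction (auto simp: A st_zero st_add st_scale st_mult intro: generated.intros st)
  have c1: "x \<odot> y = y \<odot> x" if "x \<in> generated G" "y \<in> G" for x y
    using that
  proof induction
    case (mult u v)
    have "u \<odot> v \<odot> y = u \<odot> (y \<odot> v)"
      using mult G by (simp add: A mult_assoc subset_iff)
    also have "\<dots> = y \<odot> u \<odot> v"
      using mult G by (simp add: A subset_iff flip: mult_assoc)
    finally show ?case using mult G by (simp add: A mult_assoc subset_iff)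
  qed (use G in \<open>auto simp: comm A mult_zero mult_add_left mult_add_right mult_scale_left mult_scale_right\<close>)
  have c2: "x \<odot> y = y \<odot> x" if "y \<in> generated G" "x \<in> generated G" for x y
    using that
  proof induction
    case (mult u v)
    have uvx: "u \<in> A" "v \<in> A" "x \<in> A" using mult by (simp_all add: A)
    have "x \<odot> (u \<odot> v) = x \<odot> u \<odot> v" by (simp only: mult_assoc uvx)
    also have "\<dots> = u \<odot> x \<odot> v" using mult by simp
    also have "\<dots> = u \<odot> (x \<odot> v)" by (simp only: mult_assoc uvx)
    also have "\<dots> = u \<odot> (v \<odot> x)" using mult by simp
    also have "\<dots> = u \<odot> v \<odot> x" by (simp only: mult_assoc uvx)
    finally show ?case .
  qed (use G in \<open>auto simp: c1 A mult_zero mult_add_left mult_add_right mult_scale_left mult_scale_right\<close>)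
  show ?thesis
    unfolding abelian_star_subalgebra_def complex_vector.subspace_def
    using A stg c2 by (auto intro: generated.intros)
qed

text \<open>
  Maximality of \<open>M\<close> is tested against the algebra generated by \<open>M\<close> and \<open>x\<close>.
\<close>

lemma masa_memI:
  assumes M: "masa B M" and x: "x \<in> A" "st x = x" and comm: "\<And>m. m \<in> M \<Longrightarrow> m \<odot> x = x \<odot> m"
  shows "x \<in> M"
proof -
  have ab: "abelian_star_subalgebra B M" using M by (simp add: masa_def)
  have "abelian_star_subalgebra B (generated (insert x M))"
    by (rule abelian_generated) (use ab x comm in \<open>auto simp: abelian_star_subalgebra_def\<close>)
  then have "generated (insert x M) = M"
    using M unfolding masa_def by (blast intro: generated.base)
  then show ?thesis using generated.base[of x "insert x M"] by auto
qed

end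

locale fd_cstar = cstar +
  fixes S
  assumes finS: "finite S" and spanS: "car B \<subseteq> complex_vector.span S"
begin

lemma masa_exists: "\<exists>M. masa B M"
proof -
  let ?P = "\<lambda>n. \<exists>M. abelian_star_subalgebra B M \<and> complex_vector.dim M = n"
  have "abelian_star_subalgebra B {0}"
    by (auto simp: abelian_star_subalgebra_def complex_vector.subspace_def mult_zero st_zero)
  then have ex: "\<exists>n. ?P n" by blast
  have "n \<le> card S" if "?P n" for n
    using that complex_vector.dim_le_card[OF _ finS] spanS
    by (auto simp: abelian_star_subalgebra_def)
  then obtain n where n: "?P n" "\<And>m. ?P m \<Longrightarrow> m \<le> n"
    using ex GreatestI_ex_nat[of ?P "card S"] Greatest_le_nat[of ?P _ "card S"] by blast
  then obtain M where M: "abelian_star_subalgebra B M" "complex_vector.dim M = n" by blast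
  have "N' = M" if N': "abelian_star_subalgebra B N'" "M \<subseteq> N'" for N'
  proof (rule ccontr)
    assume "N' \<noteq> M"
    then obtain x where x: "x \<in> N'" "x \<notin> M" using N'(2) by blast
    obtain b where b: "b \<subseteq> M" "complex_vector.independent b" "M \<subseteq> complex_vector.span b" "card b = n"
      using complex_vector.basis_exists[of M] M(2) by metis
    have bS: "N' \<subseteq> complex_vector.span S" 
      using N'(1) spanS by (auto simp: abelian_star_subalgebra_def)
    have "finite b"
      using complex_vector.independent_span_bound[OF finS b(2)] b(1) N'(2) bS by blast
    have "complex_vector.span b \<subseteq> M"
      using b(1) M(1) by (intro complex_vector.span_minimal) (auto simp: abelian_star_subalgebra_def)
    then have "x \<notin> complex_vector.span b" using x(2) by blast
    then have xb: "complex_vector.independent (insert x b)" "x \<notin> b"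
      using complex_vector.independent_insertI[OF _ b(2)] x(2) b(1) by blast+
    obtain b' where b': "b' \<subseteq> N'" "complex_vector.independent b'" "N' \<subseteq> complex_vector.span b'"
      "card b' = complex_vector.dim N'"
      using complex_vector.basis_exists[of N'] by metis
    have "finite b'"
      using complex_vector.independent_span_bound[OF finS b'(2)] b'(1) bS by blast
    then have "card (insert x b) \<le> complex_vector.dim N'"
      using complex_vector.independent_span_bound[OF _ xb(1), of b'] b' b(1) N'(2) x(1) by auto
    moreover have "complex_vector.dim N' \<le> n" using n(2) N'(1) by blast
    ultimately show False using \<open>finite b\<close> xb(2) b(4) by simp
  qed
  then show ?thesis using M(1) by (auto simp: masa_def)
qed

end

locale fd_cstar_masa = fd_cstar +
  fixes M
  assumes masa: "masa B M"
begin

lemma M_sub [simp]: "m \<in> M \<Longrightarrow> m \<in> A"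
  and subspace_M: "complex_vector.subspace M"
  and M_st [simp]: "m \<in> M \<Longrightarrow> st m \<in> M"
  and M_mult [simp]: "m \<in> M \<Longrightarrow> m' \<in> M \<Longrightarrow> m \<odot> m' \<in> M"
  and M_comm: "m \<in> M \<Longrightarrow> m' \<in> M \<Longrightarrow> m \<odot> m' = m' \<odot> m"
  using masa by (auto simp: masa_def abelian_star_subalgebra_def)

lemma M_closed [simp]:
  "0 \<in> M"
  "x \<in> M \<Longrightarrow> y \<in> M \<Longrightarrow> x + y \<in> M"
  "x \<in> M \<Longrightarrow> y \<in> M \<Longrightarrow> x - y \<in> M"
  "x \<in> M \<Longrightarrow> c *\<^sub>C x \<in> M"
  using subspace_M complex_vector.subspace_diff[OF subspace_M]
  by (simp_all add: complex_vector.subspace_def)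

lemma M_sum [simp]: "(\<And>i. i \<in> F \<Longrightarrow> f i \<in> M) \<Longrightarrow> (\<Sum>i\<in>F. f i) \<in> M"
  by (rule complex_vector.subspace_sum[OF subspace_M])

lemma M_left_commute: "x \<in> M \<Longrightarrow> y \<in> M \<Longrightarrow> z \<in> M \<Longrightarrow> x \<odot> (y \<odot> z) = y \<odot> (x \<odot> z)"
  using M_comm[of x y] by (simp flip: mult_assoc)

text \<open>
  Joint eigenspaces of commuting elements are invariant under further elements of \<open>M\<close>.  Working
  inside the ideal \<open>y M\<close> keeps the eigenvector a multiple of \<open>y\<close>.
\<close>

lemma common_eigenvector:
  assumes y: "y \<in> M" "y \<noteq> 0" and F: "finite F" "F \<subseteq> M"
  shows "\<exists>w\<in>M. y \<odot> w \<noteq> 0 \<and> (\<forall>m\<in>F. \<exists>c. m \<odot> (y \<odot> w) = c *\<^sub>C (y \<odot> w))"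
  using F
proof (induction F)
  case empty
  have "y \<odot> st y \<noteq> 0"
    using st_mult_eq_0[of y] y M_comm[of y "st y"] by auto
  then show ?case using y by auto
next
  case (insert m F)
  then obtain w where w: "w \<in> M" "y \<odot> w \<noteq> 0" "\<forall>m\<in>F. \<exists>c. m \<odot> (y \<odot> w) = c *\<^sub>C (y \<odot> w)"
    by auto
  then obtain c where c: "\<And>n. n \<in> F \<Longrightarrow> n \<odot> (y \<odot> w) = c n *\<^sub>C (y \<odot> w)" by metis
  have m: "m \<in> M" and F: "\<And>n. n \<in> F \<Longrightarrow> n \<in> M" using insert by auto
  define I where "I = {v. (\<exists>w\<in>M. v = y \<odot> w) \<and> (\<forall>n\<in>F. n \<odot> v = c n *\<^sub>C v)}"
  have IM: "v \<in> M" if "v \<in> I" for v using that y by (auto simp: I_def)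
  have "\<exists>v\<in>I. v \<noteq> 0 \<and> (\<exists>k. m \<odot> v = k *\<^sub>C v)"
  proof (rule eigenvector_exists[OF _ finS])
    show "complex_vector.subspace I"
      unfolding complex_vector.subspace_def
    proof (intro conjI ballI allI)
      have "0 = y \<odot> 0" using y by (simp add: mult_zero)
      then have "\<exists>w\<in>M. 0 = y \<odot> w" using M_closed(1) by blast
      then show "0 \<in> I" using F by (simp add: I_def mult_zero)
      fix v v' k
      assume v: "v \<in> I"
      then obtain w where w: "w \<in> M" "v = y \<odot> w" by (auto simp: I_def)
      have "k *\<^sub>C v = y \<odot> (k *\<^sub>C w)" using y w by (simp add: mult_scale_right)
      then have "\<exists>w\<in>M. k *\<^sub>C v = y \<odot> w" using w by (metis M_closed(4))
      moreover have "n \<odot> (k *\<^sub>C v) = c n *\<^sub>C (k *\<^sub>C v)" if "n \<in> F" for n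
        using v that F IM[OF v] by (simp add: I_def mult_scale_right scaleC_scaleC mult.commute)
      ultimately show "k *\<^sub>C v \<in> I" by (simp add: I_def)
      assume v': "v' \<in> I"
      then obtain w' where w': "w' \<in> M" "v' = y \<odot> w'" by (auto simp: I_def)
      have "v + v' = y \<odot> (w + w')" using y w w' by (simp add: mult_add_right)
      then have "\<exists>w\<in>M. v + v' = y \<odot> w" using w w' by (metis M_closed(2))
      moreover have "n \<odot> (v + v') = c n *\<^sub>C (v + v')" if "n \<in> F" for n
        using v v' that F IM[OF v] IM[OF v'] by (simp add: I_def mult_add_right scaleC_add_right)
      ultimately show "v + v' \<in> I" by (simp add: I_def)
    qed
    show "I \<subseteq> complex_vector.span S" using IM spanS by auto
    show "m \<odot> (v + v') = m \<odot> v + m \<odot> v'" if "v \<in> I" "v' \<in> I" for v v'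
      using IM that m by (simp add: mult_add_right)
    show "m \<odot> (k *\<^sub>C v) = k *\<^sub>C (m \<odot> v)" if "v \<in> I" for k v
      using IM that m by (simp add: mult_scale_right)
    show "m \<odot> v \<in> I" if v: "v \<in> I" for v
    proof -
      obtain w where w: "w \<in> M" "v = y \<odot> w" using v by (auto simp: I_def)
      have "m \<odot> v = y \<odot> (m \<odot> w)" using w y m by (simp add: M_left_commute)
      moreover have "n \<odot> (m \<odot> v) = c n *\<^sub>C (m \<odot> v)" if n: "n \<in> F" for n
      proof -
        have "n \<odot> (m \<odot> v) = m \<odot> (n \<odot> v)" using F[OF n] m IM[OF v] by (rule M_left_commute)
        then show ?thesis using v n m IM[OF v] by (simp add: I_def mult_scale_right)
      qed
      ultimately show ?thesis using w m by (auto simp: I_def)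
    qed
    show "y \<odot> w \<in> I" using w c by (auto simp: I_def)
    show "y \<odot> w \<noteq> 0" by (rule w)
  qed
  then obtain v where v: "v \<in> I" "v \<noteq> 0" "\<exists>k. m \<odot> v = k *\<^sub>C v" by blast
  then obtain w' where "w' \<in> M" "v = y \<odot> w'" by (auto simp: I_def)
  with v show ?case by (auto simp: I_def)
qed

text \<open>
  The minimal projections of \<open>M\<close>.
\<close>

definition atom where
  "atom p \<longleftrightarrow> p \<in> M \<and> p \<noteq> 0 \<and> p \<odot> p = p \<and> st p = p \<and> (\<forall>m\<in>M. \<exists>c. m \<odot> p = c *\<^sub>C p)"

text \<open>
  A common eigenvector \<open>u\<close> of all of \<open>M\<close> in \<open>y M\<close> makes \<open>u\<^sup>* u\<close> a nonzero multiple of \<open>u\<close>, and a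
  real multiple of \<open>u\<^sup>* u\<close> is a projection.
\<close>

lemma atom_exists:
  assumes y: "y \<in> M" "y \<noteq> 0"
  shows "\<exists>w\<in>M. atom (y \<odot> w)"
proof -
  obtain F where F: "F \<subseteq> M" "complex_vector.independent F" "M \<subseteq> complex_vector.span F"
    using complex_vector.maximal_independent_subset[of M] by blast
  have "M \<subseteq> complex_vector.span S" using spanS by auto
  then have "finite F"
    using complex_vector.independent_span_bound[OF finS F(2)] F(1) by blast
  then obtain w where w: "w \<in> M" "y \<odot> w \<noteq> 0" "\<forall>m\<in>F. \<exists>c. m \<odot> (y \<odot> w) = c *\<^sub>C (y \<odot> w)"
    using common_eigenvector[OF y _ F(1)] by blast
  define u where "u = y \<odot> w"
  have u: "u \<in> M" "u \<noteq> 0" using w y by (auto simp: u_def)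
  have "complex_vector.span F \<subseteq> {m \<in> M. \<exists>c. m \<odot> u = c *\<^sub>C u}"
  proof (rule complex_vector.span_minimal)
    show "F \<subseteq> {m \<in> M. \<exists>c. m \<odot> u = c *\<^sub>C u}" using F(1) w(3) by (auto simp: u_def)
    show "complex_vector.subspace {m \<in> M. \<exists>c. m \<odot> u = c *\<^sub>C u}"
      unfolding complex_vector.subspace_def
    proof (intro conjI ballI allI)
      show "0 \<in> {m \<in> M. \<exists>c. m \<odot> u = c *\<^sub>C u}"
        using u by (auto simp: mult_zero intro!: exI[of _ 0])
      fix a b k assume a: "a \<in> {m \<in> M. \<exists>c. m \<odot> u = c *\<^sub>C u}"
      then obtain ca where ca: "a \<in> M" "a \<odot> u = ca *\<^sub>C u" by blast
      then have "(k *\<^sub>C a) \<odot> u = (k * ca) *\<^sub>C u"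
        using u by (simp add: mult_scale_left scaleC_scaleC)
      then show "k *\<^sub>C a \<in> {m \<in> M. \<exists>c. m \<odot> u = c *\<^sub>C u}" using ca(1) by auto
      assume b: "b \<in> {m \<in> M. \<exists>c. m \<odot> u = c *\<^sub>C u}"
      then obtain cb where cb: "b \<in> M" "b \<odot> u = cb *\<^sub>C u" by blast
      have "(a + b) \<odot> u = (ca + cb) *\<^sub>C u"
        using u ca cb by (simp add: mult_add_left scaleC_add_left)
      then show "a + b \<in> {m \<in> M. \<exists>c. m \<odot> u = c *\<^sub>C u}" using ca(1) cb(1) by auto
    qed
  qed
  then have eig: "\<exists>c. m \<odot> u = c *\<^sub>C u" if "m \<in> M" for m using that F(3) by blast
  define q where "q = st u \<odot> u"
  obtain c where c: "q = c *\<^sub>C u" using eig[of "st u"] u by (auto simp: q_def)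
  have q: "q \<in> M" "st q = q" "q \<noteq> 0"
    using u st_mult_eq_0[of u] by (auto simp: q_def st_mult st_st)
  obtain \<mu> where "q \<odot> u = \<mu> *\<^sub>C u" using eig[OF q(1)] by blast
  then have qq: "q \<odot> q = \<mu> *\<^sub>C q"
    using q(1) u c by (simp add: mult_scale_right scaleC_scaleC mult.commute)
  have "q \<odot> q \<noteq> 0" using st_mult_eq_0[of q] q by auto
  then have \<mu>: "\<mu> \<noteq> 0" using qq by auto
  have "st (q \<odot> q) = q \<odot> q" using q by (simp add: st_mult)
  then have "cnj \<mu> *\<^sub>C q = \<mu> *\<^sub>C q" using q unfolding qq by (simp add: st_scale)
  then have cnj: "cnj \<mu> = \<mu>" using q(3) by simp
  have "(1 / \<mu>) *\<^sub>C q = (c / \<mu>) *\<^sub>C u" by (simp add: c scaleC_scaleC)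
  also have "\<dots> = y \<odot> ((c / \<mu>) *\<^sub>C w)" using y w by (simp add: u_def mult_scale_right)
  finally have p: "(1 / \<mu>) *\<^sub>C q = y \<odot> ((c / \<mu>) *\<^sub>C w)" .
  have "atom ((1 / \<mu>) *\<^sub>C q)"
    unfolding atom_def
  proof (intro conjI ballI)
    show "(1 / \<mu>) *\<^sub>C q \<odot> (1 / \<mu>) *\<^sub>C q = (1 / \<mu>) *\<^sub>C q"
      using q \<mu> by (simp add: mult_scale_left mult_scale_right scaleC_scaleC qq)
    show "st ((1 / \<mu>) *\<^sub>C q) = (1 / \<mu>) *\<^sub>C q"
      using q cnj by (simp add: st_scale)
    fix m assume m: "m \<in> M"
    then obtain d where "m \<odot> u = d *\<^sub>C u" using eig by blast
    then have "m \<odot> (1 / \<mu>) *\<^sub>C q = d *\<^sub>C (1 / \<mu>) *\<^sub>C q"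
      using m u by (simp add: c mult_scale_right scaleC_scaleC mult.commute)
    then show "\<exists>c. m \<odot> (1 / \<mu>) *\<^sub>C q = c *\<^sub>C (1 / \<mu>) *\<^sub>C q" by blast
  qed (use q \<mu> in auto)
  then show ?thesis unfolding p using w by (metis M_closed(4))
qed

lemma atom_orthogonal:
  assumes p: "atom p" and q: "atom q" and "p \<noteq> q"
  shows "p \<odot> q = 0"
proof -
  have pq: "p \<in> M" "q \<in> M" "p \<odot> p = p" "q \<odot> q = q" "p \<noteq> 0" "q \<noteq> 0"
    using p q by (auto simp: atom_def)
  obtain a b where a: "p \<odot> q = a *\<^sub>C q" and b: "q \<odot> p = b *\<^sub>C p"
    using p q unfolding atom_def by blast
  have eq: "a *\<^sub>C q = b *\<^sub>C p" using a b M_comm[OF pq(1,2)] by simp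
  show ?thesis
  proof (cases "a = 0")
    case False
    define r where "r = b / a"
    have "(1/a) *\<^sub>C (a *\<^sub>C q) = (1/a) *\<^sub>C (b *\<^sub>C p)" using eq by simp
    then have qr: "q = r *\<^sub>C p" using False by (simp add: scaleC_scaleC r_def)
    then have "r \<noteq> 0" using pq by auto
    have "(r * r) *\<^sub>C p = r *\<^sub>C p"
      using pq(1,3,4) unfolding qr by (simp add: mult_scale_left mult_scale_right scaleC_scaleC)
    then have "r = 1" using pq(5) \<open>r \<noteq> 0\<close> by simp
    then show ?thesis using qr assms by simp
  qed (simp add: a)
qed

definition P where "P = {p. atom p}"

lemma P_simps [simp]:
  assumes "p \<in> P"
  shows "p \<in> M" "p \<in> A" "p \<odot> p = p" "st p = p" "p \<noteq> 0"
  using assms by (auto simp: P_def atom_def)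

lemma P_eigenvector: "p \<in> P \<Longrightarrow> m \<in> M \<Longrightarrow> \<exists>c. m \<odot> p = c *\<^sub>C p"
  unfolding P_def atom_def by blast

lemma P_orthogonal: "p \<in> P \<Longrightarrow> q \<in> P \<Longrightarrow> p \<odot> q = (if p = q then p else 0)"
  using atom_orthogonal[of p q] P_simps(3)[of p] by (simp add: P_def)

lemma independent_P: "complex_vector.independent P"
  unfolding complex_vector.dependent_explicit
proof (intro notI, elim exE conjE bexE)
  fix F f v assume F: "finite F" "F \<subseteq> P" "(\<Sum>v\<in>F. f v *\<^sub>C v) = 0" and v: "v \<in> F" "f v \<noteq> 0"
  have FA: "x \<in> P" if "x \<in> F" for x using that F by blast
  have "0 = (\<Sum>x\<in>F. f x *\<^sub>C x) \<odot> v" using F(3) v(1) FA by (simp add: mult_zero)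
  also have "\<dots> = (\<Sum>x\<in>F. if x = v then f v *\<^sub>C v else 0)"
    using FA v(1) by (simp add: mult_sum_left mult_scale_left P_orthogonal) (intro sum.cong, auto)
  also have "\<dots> = f v *\<^sub>C v" using F v by simp
  finally show False using v FA[OF v(1)] by simp
qed

lemma finite_P [simp]: "finite P"
proof -
  have "P \<subseteq> A" by (rule subsetI) simp
  then have "P \<subseteq> complex_vector.span S" using spanS by (rule subset_trans)
  then show ?thesis using complex_vector.independent_span_bound[OF finS independent_P] by blast
qed

text \<open>
  The sum of all minimal projections will turn out to be the unit of the algebra.
\<close>

definition e where "e = (\<Sum>p\<in>P. p)"

lemma e_mem [simp]: "e \<in> M" by (simp add: e_def)

lemma st_e: "st e = e" by (simp add: e_def st_sum)

lemma P_e: "p \<in> P \<Longrightarrow> p \<odot> e = p"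
  by (simp add: e_def mult_sum_right P_orthogonal)

lemma e_e: "e \<odot> e = e"
proof -
  have "(\<Sum>p\<in>P. p) \<odot> e = (\<Sum>p\<in>P. p \<odot> e)" by (rule mult_sum_left) simp_all
  then show ?thesis by (simp add: P_e flip: e_def)
qed

text \<open>
  Otherwise \<open>m - m e\<close> would be nonzero, and the ideal it generates would contain an atom orthogonal
  to every atom.
\<close>

lemma M_e: assumes m: "m \<in> M" shows "m \<odot> e = m"
proof (rule ccontr)
  assume ne: "m \<odot> e \<noteq> m"
  define y where "y = m - m \<odot> e"
  have y: "y \<in> M" "y \<noteq> 0" using m ne by (auto simp: y_def)
  have ye: "y \<odot> e = 0" using m by (simp add: y_def mult_diff_left mult_assoc e_e)
  obtain w where w: "w \<in> M" "atom (y \<odot> w)" using atom_exists[OF y] by blast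
  then have "y \<odot> w \<in> P" by (simp add: P_def)
  have "y \<odot> w = e \<odot> (y \<odot> w)" using P_e[OF \<open>y \<odot> w \<in> P\<close>] w y M_comm[of e "y \<odot> w"] by simp
  also have "\<dots> = (y \<odot> e) \<odot> w" using w y M_comm[of e y] by (simp flip: mult_assoc)
  also have "\<dots> = 0" using ye w by (simp add: mult_zero)
  finally show False using w(2) by (simp add: atom_def)
qed

lemma dim_M: "complex_vector.dim M = card P"
proof -
  have "M \<subseteq> complex_vector.span P"
  proof
    fix m assume m: "m \<in> M"
    then have "m = (\<Sum>p\<in>P. m \<odot> p)" using M_e[OF m] by (simp add: e_def mult_sum_right)
    moreover have "m \<odot> p \<in> complex_vector.span P" if p: "p \<in> P" for p
    proof -
      obtain c where "m \<odot> p = c *\<^sub>C p" using P_eigenvector[OF p m] by blast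
      then show ?thesis using p by (simp add: complex_vector.span_scale complex_vector.span_base)
    qed
    ultimately show "m \<in> complex_vector.span P"
      using complex_vector.span_sum[of P "\<lambda>p. m \<odot> p"] by simp
  qed
  moreover have "P \<subseteq> M" by (rule subsetI) simp
  ultimately show ?thesis
    using complex_vector.basis_card_eq_dim[of P M] independent_P by simp
qed

text \<open>
  For \<open>x = b - e b\<close> the self-adjoint element \<open>x x\<^sup>*\<close> is annihilated by \<open>e\<close> from both sides, so it
  commutes with \<open>M\<close>, lies in \<open>M\<close> by maximality, and vanishes.
\<close>

lemma unit_left: assumes b: "b \<in> A" shows "e \<odot> b = b"
proof -
  define x where "x = b - e \<odot> b"
  have x: "x \<in> A" using b by (simp add: x_def)
  have ex: "e \<odot> x = 0" using b by (simp add: x_def mult_diff_right e_e flip: mult_assoc)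
  define z where "z = x \<odot> st x"
  have z: "z \<in> A" "st z = z" using x by (auto simp: z_def st_mult st_st)
  have ez: "e \<odot> z = 0" using x ex by (simp add: z_def mult_zero flip: mult_assoc)
  have ze: "z \<odot> e = 0" using st_mult[of e z] ez z st_e by (simp add: st_zero)
  have "z \<in> M"
  proof (rule masa_memI[OF masa z])
    fix m assume m: "m \<in> M"
    have "m \<odot> z = (m \<odot> e) \<odot> z" using m by (simp add: M_e)
    also have "\<dots> = 0" using m z ez by (simp add: mult_assoc mult_zero)
    finally have "m \<odot> z = 0" .
    have "z \<odot> m = z \<odot> (e \<odot> m)" using m M_e[OF m] M_comm[of e m] by simp
    also have "\<dots> = 0" using m z ze by (simp add: mult_zero flip: mult_assoc)
    finally show "m \<odot> z = z \<odot> m" using \<open>m \<odot> z = 0\<close> by simp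
  qed
  then have "z = 0" using M_e[of z] ze by simp
  then have "st x = 0" using st_mult_eq_0[of "st x"] x by (simp add: z_def st_st)
  then have "x = 0" using st_st[OF x] by (simp add: st_zero)
  then show ?thesis by (simp add: x_def)
qed

lemma unit_right: assumes b: "b \<in> A" shows "b \<odot> e = b"
  using unit_left[of "st b"] st_mult[of e "st b"] b st_e by (simp add: st_st)

text \<open>
  As \<open>m p\<close> is a multiple of \<open>p\<close> for \<open>m \<in> M\<close>, the element \<open>h\<close> commutes with \<open>M\<close>, and maximality
  puts it into \<open>M p\<close>.
\<close>

lemma corner_self_adjoint:
  assumes p: "p \<in> P" and h: "h \<in> A" "st h = h" "p \<odot> h = h" "h \<odot> p = h"
  shows "\<exists>c. h = c *\<^sub>C p"
proof -
  have "h \<in> M"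
  proof (rule masa_memI[OF masa h(1,2)])
    fix m assume m: "m \<in> M"
    obtain c where c: "m \<odot> p = c *\<^sub>C p" using P_eigenvector[OF p m] by blast
    have "m \<odot> h = (m \<odot> p) \<odot> h" using m p h by (simp add: mult_assoc)
    also have "\<dots> = c *\<^sub>C h" using p h by (simp add: c mult_scale_left)
    also have "\<dots> = h \<odot> (p \<odot> m)" using p h m c M_comm[of p m] by (simp add: mult_scale_right)
    also have "\<dots> = h \<odot> m" using m p h by (simp flip: mult_assoc)
    finally show "m \<odot> h = h \<odot> m" .
  qed
  then show ?thesis using P_eigenvector[OF p, of h] h(4) by simp
qed

lemma corner:
  assumes p: "p \<in> P" and x: "x \<in> A" "p \<odot> x = x" "x \<odot> p = x"
  shows "\<exists>c. x = c *\<^sub>C p"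
proof -
  have sx: "p \<odot> st x = st x" "st x \<odot> p = st x"
    using st_mult[of x p] st_mult[of p x] x p by simp_all
  obtain a where a: "x + st x = a *\<^sub>C p"
    using corner_self_adjoint[OF p, of "x + st x"] x sx p
    by (auto simp: st_add st_st add.commute mult_add_left mult_add_right)
  obtain b where b: "\<i> *\<^sub>C x + (-\<i>) *\<^sub>C st x = b *\<^sub>C p"
    using corner_self_adjoint[OF p, of "\<i> *\<^sub>C x + (-\<i>) *\<^sub>C st x"] x sx p
    by (auto simp: st_diff st_st st_scale mult_diff_left mult_diff_right
        mult_scale_left mult_scale_right)
  have "2 *\<^sub>C x = x + x"
    using scaleC_add_left[of 1 1 x] by (simp add: scaleC_one)
  then have "2 *\<^sub>C x = (x + st x) + (-\<i>) *\<^sub>C (\<i> *\<^sub>C x + (-\<i>) *\<^sub>C st x)"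
    by (simp add: complex_vector.scale_right_diff_distrib scaleC_scaleC)
  also have "\<dots> = (a - \<i> * b) *\<^sub>C p"
    unfolding a b by (simp add: scaleC_scaleC complex_vector.scale_left_diff_distrib)
  finally have "(1/2) *\<^sub>C (2 *\<^sub>C x) = (1/2) *\<^sub>C ((a - \<i> * b) *\<^sub>C p)" by simp
  then have "x = ((a - \<i> * b) / 2) *\<^sub>C p" by (simp add: scaleC_scaleC)
  then show ?thesis by blast
qed

lemma N_P: "p \<in> P \<Longrightarrow> N p = 1"
  using N_st_mult[of p] N_eq_0[of p] by (simp add: power2_eq_square)

text \<open>
  The element \<open>w\<^sup>* w\<close> lies in the corner of \<open>p\<close>, so it is \<open>\<alpha> p\<close> with real \<open>\<alpha>\<close> and
  \<open>\<bar>\<alpha>\<bar> = \<parallel>w\<parallel>\<^sup>2\<close>.  The sign is the issue: if \<open>p \<noteq> q\<close>, then \<open>(w + w\<^sup>*)\<^sup>2 = \<alpha> (p + q)\<close>, which excludes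
  \<open>\<alpha> < 0\<close>.
\<close>

lemma corner_positive:
  assumes p: "p \<in> P" and q: "q \<in> P" and w: "w \<in> A" "q \<odot> w = w" "w \<odot> p = w"
  shows "st w \<odot> w = complex_of_real ((N w)\<^sup>2) *\<^sub>C p"
proof (cases "w = 0")
  case True
  then show ?thesis by (simp add: N_zero mult_zero st_zero)
next
  case False
  have sw: "p \<odot> st w = st w" "st w \<odot> q = st w" "st w \<in> A"
    using st_mult[of w p] st_mult[of q w] w p q by simp_all
  have "p \<odot> (st w \<odot> w) = st w \<odot> w"
    using sw w p by (simp flip: mult_assoc)
  moreover have "st w \<odot> w \<odot> p = st w \<odot> w"
    using sw w p by (simp add: mult_assoc)
  ultimately obtain \<alpha> where \<alpha>: "st w \<odot> w = \<alpha> *\<^sub>C p"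
    using corner[OF p, of "st w \<odot> w"] sw w by auto
  have norm: "(N w)\<^sup>2 = cmod \<alpha>"
    using N_st_mult[OF w(1)] p by (simp add: \<alpha> N_scale N_P)
  have "st (st w \<odot> w) = st w \<odot> w" using w by (simp add: st_mult st_st)
  then have "cnj \<alpha> *\<^sub>C p = \<alpha> *\<^sub>C p" using p by (simp add: \<alpha> st_scale)
  then have "cnj \<alpha> = \<alpha>" using p by simp
  then have real: "\<alpha> = of_real (Re \<alpha>)" by (simp add: complex_eq_iff)
  have "\<not> Re \<alpha> < 0"
  proof
    assume neg: "Re \<alpha> < 0"
    show False
    proof (cases "p = q")
      case True
      then obtain c where c: "w = c *\<^sub>C p" using corner[OF p w(1)] w by auto
      have "st w \<odot> w = (cnj c * c) *\<^sub>C p"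
        using p by (simp add: c st_scale mult_scale_left mult_scale_right scaleC_scaleC mult.commute)
      then have "\<alpha> = cnj c * c" using p \<alpha> by simp
      then have "Re \<alpha> \<ge> 0" by simp
      then show False using neg by simp
    next
      case pq: False
      have orth: "p \<odot> q = 0" "q \<odot> p = 0" using pq p q by (simp_all add: P_orthogonal)
      have pw: "p \<odot> w = 0"
        using mult_assoc[of p q w] p q w orth by (simp add: mult_zero)
      have wq: "w \<odot> q = 0"
        using mult_assoc[of w p q] p q w orth by (simp add: mult_zero)
      have qs: "q \<odot> st w = 0" using st_mult[of w q] wq w q by (simp add: st_zero)
      have sp: "st w \<odot> p = 0" using st_mult[of p w] pw w p by (simp add: st_zero)
      have ww: "w \<odot> w = 0"
        using mult_assoc[of w q w] q w wq by (simp add: mult_zero)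
      have ss: "st w \<odot> st w = 0" using st_mult[of w w] ww w by (simp add: st_zero)
      have "q \<odot> (w \<odot> st w) = w \<odot> st w" using sw w q by (simp flip: mult_assoc)
      moreover have "w \<odot> st w \<odot> q = w \<odot> st w" using sw w q by (simp add: mult_assoc)
      ultimately obtain \<beta> where \<beta>: "w \<odot> st w = \<beta> *\<^sub>C q"
        using corner[OF q, of "w \<odot> st w"] sw w by auto
      \<comment> \<open>Bracketing \<open>w w\<^sup>* w\<close> in the two ways compares the two scalars.\<close>
      have "\<alpha> *\<^sub>C w = w \<odot> (st w \<odot> w)" using w p by (simp add: \<alpha> mult_scale_right)
      also have "\<dots> = \<beta> *\<^sub>C w"
        using w sw q by (simp add: \<beta> mult_scale_left flip: mult_assoc)
      finally have "\<beta> = \<alpha>" using False by simp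
      define x where "x = w + st w"
      have "x \<odot> x = \<alpha> *\<^sub>C (p + q)"
        using w sw p q ww ss
        by (simp add: x_def mult_add_left mult_add_right \<alpha> \<beta> \<open>\<beta> = \<alpha>\<close> scaleC_add_right add.commute)
      then have xx: "x \<odot> x = - (complex_of_real (- Re \<alpha>)) *\<^sub>C (p + q)"
        using real by simp
      have "x = 0"
        by (rule neg_square_self_adjoint_zero[OF _ _ _ _ _ _ _ xx])
          (use w sw p q pw wq qs sp orth neg in
            \<open>auto simp: x_def st_add st_st add.commute mult_add_left mult_add_right\<close>)
      then have "0 = q \<odot> x" using q by (simp add: mult_zero)
      also have "\<dots> = w" using w sw q qs by (simp add: x_def mult_add_right)
      finally show False using False by simp
    qed
  qed
  then have "cmod \<alpha> = Re \<alpha>" using real norm_of_real[of "Re \<alpha>"] by (metis abs_of_nonneg not_less)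
  then show ?thesis using \<alpha> norm real by simp
qed

text \<open>
  The square of the Hilbert--Schmidt norm, read off from the matrix entries \<open>p x q\<close>.
\<close>

definition hs where "hs x = (\<Sum>p\<in>P. \<Sum>q\<in>P. (N (p \<odot> x \<odot> q))\<^sup>2)"

lemma hs_nonneg: "0 \<le> hs x"
  by (simp add: hs_def sum_nonneg)

lemma hs_st: assumes x: "x \<in> A" shows "hs (st x) = hs x"
proof -
  have "N (p \<odot> st x \<odot> q) = N (q \<odot> x \<odot> p)" if "p \<in> P" "q \<in> P" for p q
  proof -
    have "st (q \<odot> x \<odot> p) = p \<odot> st x \<odot> q"
      using that x by (simp add: st_mult mult_assoc)
    then show ?thesis using N_st[of "q \<odot> x \<odot> p"] that x by simp
  qed
  then have "hs (st x) = (\<Sum>p\<in>P. \<Sum>q\<in>P. (N (q \<odot> x \<odot> p))\<^sup>2)"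
    unfolding hs_def by (intro sum.cong) auto
  also have "\<dots> = hs x" unfolding hs_def by (rule sum.swap)
  finally show ?thesis .
qed

lemma insert_unit:
  assumes a: "a \<in> A" and b: "b \<in> A"
  shows "a \<odot> b = (\<Sum>r\<in>P. a \<odot> r \<odot> (r \<odot> b))"
proof -
  have "a \<odot> b = a \<odot> (e \<odot> b)" using unit_left[OF b] by simp
  also have "e \<odot> b = (\<Sum>r\<in>P. r \<odot> b)" unfolding e_def using b by (simp add: mult_sum_left)
  also have "a \<odot> (\<Sum>r\<in>P. r \<odot> b) = (\<Sum>r\<in>P. a \<odot> (r \<odot> b))"
    using a b by (simp add: mult_sum_right)
  also have "\<dots> = (\<Sum>r\<in>P. a \<odot> r \<odot> (r \<odot> b))"
  proof (intro sum.cong refl)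
    fix r assume r: "r \<in> P"
    have "a \<odot> r \<odot> (r \<odot> b) = a \<odot> (r \<odot> r \<odot> b)"
      using a b P_simps(2)[OF r] by (simp only: mult_assoc closed)
    then show "a \<odot> (r \<odot> b) = a \<odot> r \<odot> (r \<odot> b)" using r by simp
  qed
  finally show ?thesis .
qed

text \<open>
  Cauchy--Schwarz for the matrix product \<open>p (x y) q = \<Sum>\<^sub>r (p x r) (r y q)\<close>.
\<close>

lemma hs_mult:
  assumes x: "x \<in> A" and y: "y \<in> A"
  shows "hs (x \<odot> y) \<le> hs x * hs y"
proof -
  have "(N (p \<odot> (x \<odot> y) \<odot> q))\<^sup>2
      \<le> (\<Sum>r\<in>P. (N (p \<odot> x \<odot> r))\<^sup>2) * (\<Sum>r\<in>P. (N (r \<odot> y \<odot> q))\<^sup>2)"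
    if pq: "p \<in> P" "q \<in> P" for p q
  proof -
    have "p \<odot> (x \<odot> y) \<odot> q = (p \<odot> x) \<odot> (y \<odot> q)"
      using pq x y by (simp add: mult_assoc)
    also have "\<dots> = (\<Sum>r\<in>P. p \<odot> x \<odot> r \<odot> (r \<odot> (y \<odot> q)))"
      using pq x y by (intro insert_unit) auto
    also have "\<dots> = (\<Sum>r\<in>P. p \<odot> x \<odot> r \<odot> (r \<odot> y \<odot> q))"
      using pq x y by (intro sum.cong refl) (simp add: mult_assoc)
    finally have "N (p \<odot> (x \<odot> y) \<odot> q) = N (\<Sum>r\<in>P. p \<odot> x \<odot> r \<odot> (r \<odot> y \<odot> q))" by simp
    also have "\<dots> \<le> (\<Sum>r\<in>P. N (p \<odot> x \<odot> r \<odot> (r \<odot> y \<odot> q)))"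
      using pq x y by (intro N_sum) simp
    also have "\<dots> \<le> (\<Sum>r\<in>P. N (p \<odot> x \<odot> r) * N (r \<odot> y \<odot> q))"
      using pq x y by (intro sum_mono N_mult) simp_all
    finally have "(N (p \<odot> (x \<odot> y) \<odot> q))\<^sup>2 \<le> (\<Sum>r\<in>P. N (p \<odot> x \<odot> r) * N (r \<odot> y \<odot> q))\<^sup>2"
      using pq x y by (intro power_mono N_nonneg) simp_all
    also have "\<dots> \<le> (\<Sum>r\<in>P. (N (p \<odot> x \<odot> r))\<^sup>2) * (\<Sum>r\<in>P. (N (r \<odot> y \<odot> q))\<^sup>2)"
      by (rule Cauchy_Schwarz_ineq_sum)
    finally show ?thesis .
  qed
  then have "hs (x \<odot> y) \<le> (\<Sum>p\<in>P. \<Sum>q\<in>P.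
      (\<Sum>r\<in>P. (N (p \<odot> x \<odot> r))\<^sup>2) * (\<Sum>r\<in>P. (N (r \<odot> y \<odot> q))\<^sup>2))"
    unfolding hs_def by (intro sum_mono) simp
  also have "\<dots> = hs x * (\<Sum>q\<in>P. \<Sum>r\<in>P. (N (r \<odot> y \<odot> q))\<^sup>2)"
    unfolding hs_def by (rule sum_product[symmetric])
  also have "(\<Sum>q\<in>P. \<Sum>r\<in>P. (N (r \<odot> y \<odot> q))\<^sup>2) = hs y"
    unfolding hs_def by (rule sum.swap)
  finally show ?thesis .
qed

lemma N_sq_le_const_hs:
  assumes x: "x \<in> A"
  shows "(N x)\<^sup>2 \<le> (real (card P))\<^sup>2 * hs x"
proof -
  have xe: "x = (\<Sum>(p, q)\<in>P \<times> P. p \<odot> x \<odot> q)"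
  proof -
    have "x = e \<odot> (x \<odot> e)" using x by (simp add: unit_right unit_left)
    also have "\<dots> = (\<Sum>p\<in>P. p \<odot> (x \<odot> e))"
      unfolding e_def[THEN arg_cong, of "\<lambda>t. t \<odot> _"] using x by (intro mult_sum_left) simp_all
    also have "\<dots> = (\<Sum>p\<in>P. p \<odot> x \<odot> e)" using x by (intro sum.cong refl) (simp add: mult_assoc)
    also have "\<dots> = (\<Sum>p\<in>P. \<Sum>q\<in>P. p \<odot> x \<odot> q)"
      unfolding e_def using x by (intro sum.cong refl mult_sum_right) simp_all
    finally show ?thesis by (simp add: sum.cartesian_product)
  qed
  have "N x \<le> (\<Sum>(p, q)\<in>P \<times> P. N (p \<odot> x \<odot> q))"
    using N_sum[of "P \<times> P" "\<lambda>(p, q). p \<odot> x \<odot> q"] x xe by (auto simp: case_prod_unfold)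
  then have "(N x)\<^sup>2 \<le> (\<Sum>z\<in>P \<times> P. 1 * N (fst z \<odot> x \<odot> snd z))\<^sup>2"
    using x by (intro power_mono N_nonneg) (simp_all add: case_prod_unfold)
  also have "\<dots> \<le> (\<Sum>z\<in>P \<times> P. 1\<^sup>2) * (\<Sum>z\<in>P \<times> P. (N (fst z \<odot> x \<odot> snd z))\<^sup>2)"
    by (rule Cauchy_Schwarz_ineq_sum)
  also have "\<dots> = (real (card P))\<^sup>2 * hs x"
    by (simp add: hs_def sum.cartesian_product case_prod_unfold card_cartesian_product power2_eq_square)
  finally show ?thesis .
qed

text \<open>
  Up to a constant this holds because \<open>x\<close> is the sum of its entries.  The constant disappears
  on applying the estimate to the powers \<open>(x\<^sup>* x)\<^bsup>2\<^sup>n\<^esup>\<close>: the C*-norm is multiplicative along these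
  powers, and \<^const>\<open>hs\<close> is submultiplicative.
\<close>

lemma N_sq_le_hs:
  assumes x: "x \<in> A"
  shows "(N x)\<^sup>2 \<le> hs x"
proof -
  define y where "y = st x \<odot> x"
  have y: "y \<in> A" "st y = y" using x by (auto simp: y_def st_mult st_st)
  define s where "s n = ((\<lambda>z. z \<odot> z) ^^ n) y" for n
  have s: "s n \<in> A \<and> st (s n) = s n \<and> N (s n) = N y ^ (2 ^ n) \<and> hs (s n) \<le> hs y ^ (2 ^ n)" for n
  proof (induction n)
    case (Suc n)
    have sn: "s (Suc n) = s n \<odot> s n" by (simp add: s_def)
    have "N (s (Suc n)) = (N (s n))\<^sup>2" using N_st_mult[of "s n"] Suc sn by simp
    also have "\<dots> = N y ^ (2 ^ Suc n)" using Suc by (simp add: power_mult[symmetric] mult.commute)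
    finally have 1: "N (s (Suc n)) = N y ^ (2 ^ Suc n)" .
    have "hs (s (Suc n)) \<le> hs (s n) * hs (s n)" unfolding sn using Suc by (intro hs_mult) auto
    also have "\<dots> \<le> hs y ^ (2 ^ n) * hs y ^ (2 ^ n)"
      using Suc by (intro mult_mono hs_nonneg zero_le_power) auto
    also have "\<dots> = hs y ^ (2 ^ Suc n)" by (simp flip: power_add add: mult_2)
    finally show ?case using 1 Suc sn by (simp add: st_mult)
  qed (simp add: s_def y)
  have "(N y)\<^sup>2 \<le> hs y"
  proof (rule le_of_power_le_const_mult[where C = "(real (card P))\<^sup>2"])
    fix n
    have "((N y)\<^sup>2) ^ (2 ^ n) = (N (s n))\<^sup>2"
      using s[of n] by (simp add: power_mult[symmetric] mult.commute)
    also have "\<dots> \<le> (real (card P))\<^sup>2 * hs (s n)" using s by (intro N_sq_le_const_hs) auto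
    also have "\<dots> \<le> (real (card P))\<^sup>2 * hs y ^ (2 ^ n)" using s[of n] by (intro mult_left_mono) auto
    finally show "((N y)\<^sup>2) ^ (2 ^ n) \<le> (real (card P))\<^sup>2 * hs y ^ (2 ^ n)" .
  qed (simp_all add: hs_nonneg)
  also have "hs y \<le> hs x * hs x" unfolding y_def using hs_mult[of "st x" x] x by (simp add: hs_st)
  finally have "((N x)\<^sup>2)\<^sup>2 \<le> (hs x)\<^sup>2"
    using N_st_mult[OF x] by (simp add: y_def power2_eq_square)
  then show ?thesis by (rule power2_le_imp_le) (rule hs_nonneg)
qed

lemma corner_st_mult:
  assumes c: "c \<in> A" and p: "p \<in> P"
  shows "p \<odot> (st c \<odot> c) \<odot> p = complex_of_real (\<Sum>q\<in>P. (N (q \<odot> c \<odot> p))\<^sup>2) *\<^sub>C p"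
proof -
  have "p \<odot> (st c \<odot> c) \<odot> p = (p \<odot> st c) \<odot> (c \<odot> p)" using c p by (simp add: mult_assoc)
  also have "\<dots> = (\<Sum>q\<in>P. p \<odot> st c \<odot> q \<odot> (q \<odot> (c \<odot> p)))"
    using c p by (intro insert_unit) simp_all
  also have "\<dots> = (\<Sum>q\<in>P. complex_of_real ((N (q \<odot> c \<odot> p))\<^sup>2) *\<^sub>C p)"
  proof (intro sum.cong refl)
    fix q assume q: "q \<in> P"
    have "st (q \<odot> c \<odot> p) \<odot> (q \<odot> c \<odot> p) = complex_of_real ((N (q \<odot> c \<odot> p))\<^sup>2) *\<^sub>C p"
    proof (rule corner_positive[OF p q])
      have "q \<odot> (q \<odot> c \<odot> p) = q \<odot> q \<odot> (c \<odot> p)"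
        using P_simps(2)[OF p] P_simps(2)[OF q] c by (simp only: mult_assoc closed)
      also have "\<dots> = q \<odot> c \<odot> p" using p q c by (simp add: mult_assoc)
      finally show "q \<odot> (q \<odot> c \<odot> p) = q \<odot> c \<odot> p" .
    qed (use p q c in \<open>simp_all add: mult_assoc\<close>)
    then show "p \<odot> st c \<odot> q \<odot> (q \<odot> (c \<odot> p)) = complex_of_real ((N (q \<odot> c \<odot> p))\<^sup>2) *\<^sub>C p"
      using p q c by (simp add: st_mult mult_assoc)
  qed
  finally show ?thesis
    by (simp add: complex_vector.scale_sum_left)
qed

text \<open>
  The trace of \<open>c\<^sup>* c\<close> is the Hilbert--Schmidt norm of \<open>c\<close>, which dominates
  \<open>\<parallel>c\<parallel>\<^sup>2 = \<parallel>c\<^sup>* c\<parallel>\<close>.  Summed over \<open>E\<close>, each diagonal entry of the total is at most its norm \<open>1\<close>.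
\<close>

lemma sum_positive_le_dim:
  assumes c: "\<And>m. m \<in> E \<Longrightarrow> c m \<in> A" and le: "N (\<Sum>m\<in>E. st (c m) \<odot> c m) \<le> 1"
  shows "(\<Sum>m\<in>E. N (st (c m) \<odot> c m)) \<le> real (complex_vector.dim M)"
proof -
  define b where "b = (\<Sum>m\<in>E. st (c m) \<odot> c m)"
  have b: "b \<in> A" using c by (simp add: b_def)
  have entry: "(\<Sum>m\<in>E. \<Sum>q\<in>P. (N (q \<odot> c m \<odot> p))\<^sup>2) \<le> 1" if p: "p \<in> P" for p
  proof -
    let ?T = "\<Sum>m\<in>E. \<Sum>q\<in>P. (N (q \<odot> c m \<odot> p))\<^sup>2"
    have "p \<odot> b \<odot> p = (\<Sum>m\<in>E. p \<odot> (st (c m) \<odot> c m) \<odot> p)"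
      unfolding b_def using c p by (simp add: mult_sum_right mult_sum_left)
    also have "\<dots> = (\<Sum>m\<in>E. complex_of_real (\<Sum>q\<in>P. (N (q \<odot> c m \<odot> p))\<^sup>2) *\<^sub>C p)"
      by (intro sum.cong refl corner_st_mult c p)
    also have "\<dots> = complex_of_real ?T *\<^sub>C p"
      by (simp only: of_real_sum complex_vector.scale_sum_left)
    finally have "N (p \<odot> b \<odot> p) = \<bar>?T\<bar>"
      using p N_scale[of p "complex_of_real ?T"] by (simp only: P_simps N_P norm_of_real)
    moreover have "N (p \<odot> b \<odot> p) \<le> N (p \<odot> b) * N p" using p b by (intro N_mult) simp_all
    moreover have "N (p \<odot> b) \<le> N p * N b" using p b by (intro N_mult) simp_all
    moreover have "0 \<le> N b" "N b \<le> 1" using le N_nonneg[OF b] by (simp_all add: b_def)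
    ultimately show ?thesis using p by (simp add: N_P)
  qed
  have "(\<Sum>m\<in>E. N (st (c m) \<odot> c m)) \<le> (\<Sum>m\<in>E. hs (c m))"
    using c N_sq_le_hs by (intro sum_mono) (simp add: N_st_mult)
  also have "\<dots> = (\<Sum>m\<in>E. \<Sum>p\<in>P. \<Sum>q\<in>P. (N (q \<odot> c m \<odot> p))\<^sup>2)"
    unfolding hs_def by (intro sum.cong refl sum.swap)
  also have "\<dots> = (\<Sum>p\<in>P. \<Sum>m\<in>E. \<Sum>q\<in>P. (N (q \<odot> c m \<odot> p))\<^sup>2)"
    by (rule sum.swap)
  also have "\<dots> \<le> (\<Sum>p\<in>P. 1)" by (intro sum_mono entry)
  finally show ?thesis by (simp add: dim_M)
qed

end

lemma rank_alg_packing: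
  assumes B: "fd_cstar_algebra B" and c: "\<And>m. m \<in> E \<Longrightarrow> c m \<in> car B"
    and le: "nrm B (\<Sum>m\<in>E. mul B (adj B (c m)) (c m)) \<le> 1"
  shows "(\<Sum>m\<in>E. nrm B (mul B (adj B (c m)) (c m))) \<le> real (rank_alg B)"
proof -
  obtain S where S: "finite S" "car B \<subseteq> complex_vector.span S"
    using B by (auto simp: fd_cstar_algebra_def)
  interpret fd_cstar B S
    using B S by unfold_locales (auto simp: fd_cstar_algebra_def)
  have "masa B (SOME M. masa B M)" using masa_exists by (rule someI_ex)
  then interpret fd_cstar_masa B S "SOME M. masa B M" by unfold_locales
  show ?thesis
    unfolding rank_alg_def by (rule sum_positive_le_dim[OF c le])
qed

section \<open>The algebra of d-tuples and packing bounds\<close>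

lemma linf_upper: "i < d \<Longrightarrow> cmod (v i) \<le> nrm (linf d) v"
  by (auto simp: linf_def intro!: Max_ge)

lemma linf_least: "0 < d \<Longrightarrow> (\<And>i. i < d \<Longrightarrow> cmod (v i) \<le> b) \<Longrightarrow> nrm (linf d) v \<le> b"
  by (auto simp: linf_def intro!: Max.boundedI)

lemma linf_attained: "0 < d \<Longrightarrow> \<exists>i<d. nrm (linf d) v = cmod (v i)"
proof -
  assume "0 < d"
  then have "(MAX i\<in>{..<d}. cmod (v i)) \<in> (\<lambda>i. cmod (v i)) ` {..<d}"
    by (intro Max_in) auto
  then show ?thesis by (auto simp: linf_def)
qed

lemma car_linf: "v \<in> car (linf d) \<longleftrightarrow> (\<forall>i\<ge>d. v i = 0)"
  by (simp add: linf_def)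

lemma cbanach_linf:
  assumes d: "0 < d" shows "cbanach (linf d)"
  unfolding cbanach_def
proof (intro conjI ballI allI impI)
  show "complex_vector.subspace (car (linf d))"
    by (auto simp: complex_vector.subspace_def car_linf scaleC_fun_def)
  fix v w :: "nat \<Rightarrow> complex" and c
  show "0 \<le> nrm (linf d) v"
    using linf_upper[OF d, of v] norm_ge_zero[of "v 0"] by linarith
  show "nrm (linf d) (v + w) \<le> nrm (linf d) v + nrm (linf d) w"
    by (intro linf_least d) (auto intro!: order_trans[OF norm_triangle_ineq] add_mono linf_upper)
  show "nrm (linf d) v = 0 \<longleftrightarrow> v = 0" if v: "v \<in> car (linf d)"
  proof
    assume *: "nrm (linf d) v = 0"
    have "v i = 0" for i
      using linf_upper[of i d v] v * by (cases "i < d") (auto simp: car_linf)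
    then show "v = 0" by (simp add: fun_eq_iff)
  next
    assume "v = 0"
    then show "nrm (linf d) v = 0" using linf_attained[OF d, of v] by auto
  qed
  show "nrm (linf d) (c *\<^sub>C v) = cmod c * nrm (linf d) v"
  proof (rule antisym)
    show "nrm (linf d) (c *\<^sub>C v) \<le> cmod c * nrm (linf d) v"
      by (intro linf_least d)
        (auto simp: scaleC_fun_def scaleC_complex_def norm_mult intro!: mult_left_mono linf_upper)
    obtain i where i: "i < d" "nrm (linf d) v = cmod (v i)" using linf_attained[OF d] by blast
    then show "cmod c * nrm (linf d) v \<le> nrm (linf d) (c *\<^sub>C v)"
      using linf_upper[of i d "c *\<^sub>C v"] by (simp add: scaleC_fun_def scaleC_complex_def norm_mult)
  qed
next
  fix s :: "nat \<Rightarrow> nat \<Rightarrow> complex"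
  assume s: "range s \<subseteq> car (linf d)"
    and cau: "\<forall>e>0. \<exists>N. \<forall>m\<ge>N. \<forall>n\<ge>N. nrm (linf d) (s m - s n) < e"
  have sn: "s n \<in> car (linf d)" for n using s by blast
  have "\<exists>l. (\<lambda>n. s n i) \<longlonglongrightarrow> l" for i
  proof (cases "i < d")
    case True
    have "Cauchy (\<lambda>n. s n i)"
      unfolding Cauchy_def dist_norm
    proof (intro allI impI)
      fix e :: real assume "0 < e"
      then obtain N where "\<forall>m\<ge>N. \<forall>n\<ge>N. nrm (linf d) (s m - s n) < e" using cau by blast
      then have "\<forall>m\<ge>N. \<forall>n\<ge>N. cmod (s m i - s n i) < e"
        using le_less_trans[OF linf_upper[OF True]] by (metis minus_apply)
      then show "\<exists>M. \<forall>m\<ge>M. \<forall>n\<ge>M. cmod (s m i - s n i) < e" by blast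
    qed
    then show ?thesis using Cauchy_convergent convergent_def by blast
  next
    case False
    then have "s n i = 0" for n using sn[of n] by (simp add: car_linf)
    then show ?thesis by auto
  qed
  then obtain x where x: "\<And>i. (\<lambda>n. s n i) \<longlonglongrightarrow> x i" by metis
  have "x i = 0" if "i \<ge> d" for i
  proof -
    have "s n i = 0" for n using sn[of n] that by (simp add: car_linf)
    then show ?thesis using x[of i] by (simp add: LIMSEQ_const_iff)
  qed
  moreover have "(\<lambda>n. nrm (linf d) (s n - x)) \<longlonglongrightarrow> 0"
  proof (rule tendsto_sandwich[OF _ _ tendsto_const])
    have "(\<lambda>n. \<Sum>i<d. cmod (s n i - x i)) \<longlonglongrightarrow> (\<Sum>i<d. cmod (x i - x i))"
      by (intro tendsto_intros x)
    then show "(\<lambda>n. \<Sum>i<d. cmod (s n i - x i)) \<longlonglongrightarrow> 0" by simp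
    show "\<forall>\<^sub>F n in sequentially. 0 \<le> nrm (linf d) (s n - x)"
      using linf_upper[OF d] by (intro always_eventually allI) (meson norm_ge_zero order_trans)
    show "\<forall>\<^sub>F n in sequentially. nrm (linf d) (s n - x) \<le> (\<Sum>i<d. cmod (s n i - x i))"
      by (intro always_eventually allI linf_least d) (auto intro!: member_le_sum[of _ _ "\<lambda>i. cmod (s _ i - x i)"])
  qed
  ultimately show "\<exists>x\<in>car (linf d). (\<lambda>n. nrm (linf d) (s n - x)) \<longlonglongrightarrow> 0"
    by (intro bexI[of _ x]) (auto simp: car_linf)
qed

definition linf_alg :: "nat \<Rightarrow> (nat \<Rightarrow> complex) salgebra" where
  "linf_alg d = \<lparr>car = car (linf d), nrm = nrm (linf d),
     mul = (\<lambda>v w i. v i * w i), adj = (\<lambda>v i. cnj (v i))\<rparr>"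

lemma linf_alg_simps:
  "car (linf_alg d) = car (linf d)" "nrm (linf_alg d) = nrm (linf d)"
  "mul (linf_alg d) v w = (\<lambda>i. v i * w i)" "adj (linf_alg d) v = (\<lambda>i. cnj (v i))"
  by (simp_all add: linf_alg_def)

lemma cstar_algebra_linf_alg:
  assumes d: "0 < d" shows "cstar_algebra (linf_alg d)"
proof -
  have "cbanach (linf_alg d)"
    using cbanach_linf[OF d] unfolding cbanach_def linf_alg_simps .
  moreover have "nrm (linf d) (\<lambda>i. v i * w i) \<le> nrm (linf d) v * nrm (linf d) w" for v w
    by (intro linf_least d) (auto simp: norm_mult intro!: mult_mono linf_upper
        order_trans[OF norm_ge_zero linf_upper[OF d]])
  moreover have "nrm (linf d) (\<lambda>i. cnj (v i) * v i) = (nrm (linf d) v)\<^sup>2" for v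
  proof (rule antisym)
    show "nrm (linf d) (\<lambda>i. cnj (v i) * v i) \<le> (nrm (linf d) v)\<^sup>2"
      by (intro linf_least d) (auto simp: norm_mult power2_eq_square intro!: mult_mono linf_upper
        order_trans[OF norm_ge_zero linf_upper[OF d]])
    obtain i where i: "i < d" "nrm (linf d) v = cmod (v i)" using linf_attained[OF d] by blast
    then show "(nrm (linf d) v)\<^sup>2 \<le> nrm (linf d) (\<lambda>i. cnj (v i) * v i)"
      using linf_upper[of i d "\<lambda>i. cnj (v i) * v i"] by (simp add: norm_mult power2_eq_square)
  qed
  ultimately show ?thesis
    unfolding cstar_algebra_def linf_alg_simps
    by (auto simp: car_linf scaleC_fun_def scaleC_complex_def fun_eq_iff algebra_simps)
qed

definition unit_vec :: "nat \<Rightarrow> nat \<Rightarrow> complex" where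
  "unit_vec i j = (if j = i then 1 else 0)"

lemma sum_unit_vec: "(\<Sum>i<d. f i *\<^sub>C unit_vec i) = (\<lambda>j. if j < d then f j else 0)"
proof
  fix j
  have "(\<Sum>i<d. f i *\<^sub>C unit_vec i) j = (\<Sum>i<d. (f i *\<^sub>C unit_vec i) j)"
    by (induction d) auto
  also have "\<dots> = (\<Sum>i<d. if i = j then f j else 0)"
    by (intro sum.cong) (auto simp: scaleC_fun_def scaleC_complex_def unit_vec_def)
  finally show "(\<Sum>i<d. f i *\<^sub>C unit_vec i) j = (if j < d then f j else 0)" by simp
qed

lemma linf_span: "car (linf d) \<subseteq> complex_vector.span (unit_vec ` {..<d})"
proof
  fix v :: "nat \<Rightarrow> complex" assume "v \<in> car (linf d)"
  then have "v = (\<Sum>i<d. v i *\<^sub>C unit_vec i)"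
    unfolding sum_unit_vec by (auto simp: car_linf fun_eq_iff)
  moreover have "(\<Sum>i<d. v i *\<^sub>C unit_vec i) \<in> complex_vector.span (unit_vec ` {..<d})"
    by (intro complex_vector.span_sum complex_vector.span_scale complex_vector.span_base) auto
  ultimately show "v \<in> complex_vector.span (unit_vec ` {..<d})" by simp
qed

lemma dim_linf: "complex_vector.dim (car (linf d)) = d"
proof (rule complex_vector.dim_unique[OF _ linf_span])
  have inj: "inj_on unit_vec {..<d}"
    by (auto simp: inj_on_def unit_vec_def fun_eq_iff split: if_splits)
  show "unit_vec ` {..<d} \<subseteq> car (linf d)" by (auto simp: unit_vec_def car_linf)
  show "card (unit_vec ` {..<d}) = d" using card_image[OF inj] by simp
  show "complex_vector.independent (unit_vec ` {..<d})"
  proof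
    assume "complex_vector.dependent (unit_vec ` {..<d})"
    then obtain f i where f: "i < d" "f (unit_vec i) \<noteq> 0"
      "(\<Sum>v\<in>unit_vec ` {..<d}. f v *\<^sub>C v) = 0"
      using complex_vector.dependent_finite[of "unit_vec ` {..<d}"] by auto
    have "(\<Sum>i<d. f (unit_vec i) *\<^sub>C unit_vec i) i = 0"
      using f(3) by (simp add: sum.reindex[OF inj])
    then show False unfolding sum_unit_vec using f by simp
  qed
qed

text \<open>
  The algebra is commutative, so it is its own maximal abelian *-subalgebra.
\<close>

lemma rank_linf_alg:
  assumes d: "0 < d" shows "rank_alg (linf_alg d) = d"
proof -
  have "abelian_star_subalgebra (linf_alg d) (car (linf d))"
    using cbanach_linf[OF d]
    by (auto simp: abelian_star_subalgebra_def cbanach_def linf_alg_simps car_linf mult.commute)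
  then have "masa (linf_alg d) M \<longleftrightarrow> M = car (linf d)" for M
    by (auto simp: masa_def abelian_star_subalgebra_def linf_alg_simps)
  then show ?thesis by (simp add: rank_alg_def dim_linf)
qed

lemma fd_linf_alg: "0 < d \<Longrightarrow> fd_cstar_algebra (linf_alg d)"
  unfolding fd_cstar_algebra_def linf_alg_simps
  using cstar_algebra_linf_alg linf_span by blast

lemma subspace_cfun: "complex_vector.subspace (car (cfun :: ('k::topological_space \<Rightarrow> complex) salgebra))"
  by (auto simp: complex_vector.subspace_def car_cfun plus_fun_def zero_fun_def scaleC_fun_def
      scaleC_complex_def intro!: continuous_intros)

lemma clinear_on_sum:
  assumes f: "clinear_on X Y f" and X: "complex_vector.subspace (car X)"
    and x: "\<And>m. m \<in> E \<Longrightarrow> x m \<in> car X"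
  shows "f (\<Sum>m\<in>E. a m *\<^sub>C x m) = (\<Sum>m\<in>E. a m *\<^sub>C f (x m))"
  using x
proof (induction E rule: infinite_finite_induct)
  case (insert m E)
  have "a m *\<^sub>C x m \<in> car X" "(\<Sum>m\<in>E. a m *\<^sub>C x m) \<in> car X"
    using insert X by (auto intro!: complex_vector.subspace_sum complex_vector.subspace_scale)
  then show ?case using insert f by (simp add: clinear_on_def)
next
  have "f (0 *\<^sub>C 0) = 0 *\<^sub>C f 0"
    using f complex_vector.subspace_0[OF X] unfolding clinear_on_def by blast
  then have z: "f 0 = 0" by simp
  { case (infinite A) then show ?case using z by simp }
  { case empty then show ?case using z by simp }
qed

text \<open>
  Combinations of such a family with coefficients in the unit disc stay in the unit ball of
  \<open>C(K)\<close>.  The packing bounds say how many members a contraction into a space of given rank can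
  leave large.
\<close>

definition disjoint_family_in :: "('k::topological_space \<Rightarrow> real) set \<Rightarrow> bool" where
  "disjoint_family_in E \<longleftrightarrow> finite E
    \<and> (\<forall>F\<in>E. continuous_on UNIV F \<and> (\<forall>y. 0 \<le> F y \<and> F y \<le> 1))
    \<and> (\<forall>F\<in>E. \<forall>G\<in>E. F \<noteq> G \<longrightarrow> (\<forall>y. F y = 0 \<or> G y = 0))"

abbreviation cplx :: "('k \<Rightarrow> real) \<Rightarrow> 'k \<Rightarrow> complex" where
  "cplx F \<equiv> (\<lambda>y. complex_of_real (F y))"

lemma disjoint_family_combination:
  assumes E: "disjoint_family_in E" and a: "\<And>F. F \<in> E \<Longrightarrow> cmod (a F) \<le> 1" and D: "D \<subseteq> E"
  shows "nrm cfun (\<Sum>F\<in>D. a F *\<^sub>C cplx F) \<le> 1"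
proof (rule nrm_cfun_least)
  fix y
  have fin: "finite D" using E D by (auto simp: disjoint_family_in_def intro: finite_subset)
  have "(\<Sum>F\<in>D. a F *\<^sub>C cplx F) y = (\<Sum>F\<in>D. a F * complex_of_real (F y))"
    using fin by induction (auto simp: scaleC_fun_def scaleC_complex_def)
  also have "cmod \<dots> \<le> 1"
  proof (cases "\<exists>F\<in>D. F y \<noteq> 0")
    case True
    then obtain F where F: "F \<in> D" "F y \<noteq> 0" by blast
    then have "G y = 0" if "G \<in> D" "G \<noteq> F" for G
      using E D that unfolding disjoint_family_in_def by (metis subsetD)
    then have "(\<Sum>F\<in>D. a F * complex_of_real (F y)) = (\<Sum>G\<in>{F}. a G * complex_of_real (G y))"
      using F fin by (intro sum.mono_neutral_right) auto
    moreover have "cmod (a F) * \<bar>F y\<bar> \<le> 1 * 1"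
      using E D F a by (intro mult_mono) (auto simp: disjoint_family_in_def)
    ultimately show ?thesis by (simp add: norm_mult)
  next
    case False
    then have "(\<Sum>F\<in>D. a F * complex_of_real (F y)) = 0" by (intro sum.neutral) simp
    then show ?thesis by simp
  qed
  finally show "cmod ((\<Sum>F\<in>D. a F *\<^sub>C cplx F) y) \<le> 1" .
qed

lemma disjoint_family_car:
  "disjoint_family_in E \<Longrightarrow> F \<in> E \<Longrightarrow> cplx F \<in> car cfun"
  by (auto simp: disjoint_family_in_def car_cfun intro!: continuous_intros)

text \<open>
  Assign to each member a coordinate at which its image has modulus above \<open>1/2\<close>.  Were three members assigned
  to the same coordinate, rotating their images to the positive axis and adding would give a
  coordinate larger than \<open>1\<close>.
\<close>

lemma linf_packing:
  fixes E :: "('k::topological_space \<Rightarrow> real) set"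
  assumes E: "disjoint_family_in E" and d: "0 < d" and \<phi>: "contractive cfun (linf d) \<phi>"
    and big: "\<And>F. F \<in> E \<Longrightarrow> 1/2 < nrm (linf d) (\<phi> (cplx F))"
  shows "card E \<le> 2 * d"
proof -
  have fin: "finite E" using E by (simp add: disjoint_family_in_def)
  have lin: "clinear_on cfun (linf d) \<phi>" using \<phi> by (simp add: contractive_def)
  have "\<exists>j<d. 1/2 < cmod (\<phi> (cplx F) j)" if "F \<in> E" for F
    using linf_attained[OF d, of "\<phi> (cplx F)"] big[OF that] by auto
  then obtain j where j: "\<And>F. F \<in> E \<Longrightarrow> j F < d" "\<And>F. F \<in> E \<Longrightarrow> 1/2 < cmod (\<phi> (cplx F) (j F))"
    by metis
  have le2: "card {F \<in> E. j F = i} \<le> 2" for i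
  proof (rule ccontr)
    assume c3: "\<not> card {F \<in> E. j F = i} \<le> 2"
    let ?D = "{F \<in> E. j F = i}"
    have "?D \<noteq> {}" using c3 by (intro notI) simp
    then have i: "i < d" using j by auto
    \<comment> \<open>The phases that rotate the \<open>i\<close>-th coordinates to the positive axis.\<close>
    define a where "a F = cnj (\<phi> (cplx F) i) / complex_of_real (cmod (\<phi> (cplx F) i))" for F
    have a1: "cmod (a F) \<le> 1" for F by (simp add: a_def norm_divide)
    have az: "a F * \<phi> (cplx F) i = complex_of_real (cmod (\<phi> (cplx F) i))" for F
    proof (cases "\<phi> (cplx F) i = 0")
      case False
      have "cnj (\<phi> (cplx F) i) * \<phi> (cplx F) i = (complex_of_real (cmod (\<phi> (cplx F) i)))\<^sup>2"
        using complex_norm_square[of "\<phi> (cplx F) i"] by (simp add: mult.commute)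
      then show ?thesis using False by (simp add: a_def power2_eq_square)
    qed (simp add: a_def)
    let ?G = "\<Sum>F\<in>?D. a F *\<^sub>C cplx F"
    have "\<phi> ?G = (\<Sum>F\<in>?D. a F *\<^sub>C \<phi> (cplx F))"
      by (rule clinear_on_sum[OF lin subspace_cfun]) (use disjoint_family_car[OF E] in auto)
    then have "\<phi> ?G i = (\<Sum>F\<in>?D. a F *\<^sub>C \<phi> (cplx F)) i" by simp
    also have "\<dots> = (\<Sum>F\<in>?D. a F * \<phi> (cplx F) i)"
      using finite_subset[OF _ fin, of ?D]
      by (induction rule: infinite_finite_induct) (auto simp: scaleC_fun_def scaleC_complex_def)
    finally have "\<phi> ?G i = complex_of_real (\<Sum>F\<in>?D. cmod (\<phi> (cplx F) i))" by (simp add: az)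
    then have "cmod (\<phi> ?G i) = (\<Sum>F\<in>?D. cmod (\<phi> (cplx F) i))"
      by (simp only: norm_of_real) (simp add: sum_nonneg)
    moreover have "(\<Sum>F\<in>?D. 1/2) \<le> (\<Sum>F\<in>?D. cmod (\<phi> (cplx F) i))"
      using j(2) by (intro sum_mono) (auto intro: less_imp_le)
    moreover have "cmod (\<phi> ?G i) \<le> 1"
    proof -
      have "?G \<in> car cfun"
        using disjoint_family_car[OF E]
        by (intro complex_vector.subspace_sum[OF subspace_cfun] complex_vector.subspace_scale[OF subspace_cfun]) auto
      then have "nrm (linf d) (\<phi> ?G) \<le> nrm cfun ?G" using \<phi> by (simp add: contractive_def)
      also have "\<dots> \<le> 1" by (rule disjoint_family_combination[OF E a1]) auto
      finally show ?thesis using linf_upper[OF i, of "\<phi> ?G"] by linarith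
    qed
    ultimately show False using c3 by simp
  qed
  have "card E = (\<Sum>i<d. card {F \<in> E. j F = i})"
  proof -
    have "card E = (\<Sum>F\<in>E. 1)" by simp
    also have "\<dots> = (\<Sum>i<d. \<Sum>F\<in>{F \<in> E. j F = i}. 1)"
      using fin j(1) by (intro sum.group[symmetric]) auto
    finally show ?thesis by simp
  qed
  also have "\<dots> \<le> (\<Sum>i<d. 2)" by (intro sum_mono le2)
  finally show ?thesis by simp
qed

text \<open>
  Complete positivity of order one makes the images positive elements, and their sum is the image of
  a function of norm at most \<open>1\<close>; the trace estimate applies.
\<close>

lemma rank_packing:
  fixes E :: "('k::topological_space \<Rightarrow> real) set"
  assumes E: "disjoint_family_in E" and B: "fd_cstar_algebra B" and \<phi>: "contractive cfun B \<phi>"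
    and cp: "completely_positive cfun B \<phi>"
    and big: "\<And>F. F \<in> E \<Longrightarrow> 1/2 < nrm B (\<phi> (cplx F))"
  shows "card E \<le> 2 * rank_alg B"
proof -
  have lin: "clinear_on cfun B \<phi>" using \<phi> by (simp add: contractive_def)
  have "\<exists>c\<in>car B. \<phi> (cplx F) = mul B (adj B c) c" if F: "F \<in> E" for F
  proof -
    have "matrix_pos cfun 1 (\<lambda>i j. cplx F)"
      unfolding matrix_pos_def
    proof (intro exI[of _ "\<lambda>i j. cplx (\<lambda>y. sqrt (F y))"] conjI allI impI)
      have "continuous_on UNIV F" using E F by (simp add: disjoint_family_in_def)
      then show "cplx (\<lambda>y. sqrt (F y)) \<in> car cfun"
        by (auto simp: car_cfun intro!: continuous_intros)
      show "cplx F = (\<Sum>l<(1::nat). mul cfun (adj cfun (cplx (\<lambda>y. sqrt (F y)))) (cplx (\<lambda>y. sqrt (F y))))"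
        using E F by (auto simp: mul_cfun adj_cfun disjoint_family_in_def fun_eq_iff simp flip: of_real_mult)
    qed
    then have "matrix_pos B 1 (\<lambda>i j. \<phi> (cplx F))"
      using cp unfolding completely_positive_def by blast
    then obtain c where c: "\<forall>i<(1::nat). \<forall>j<(1::nat). c i j \<in> car B"
      "\<forall>i<(1::nat). \<forall>j<(1::nat). \<phi> (cplx F) = (\<Sum>l<(1::nat). mul B (adj B (c l i)) (c l j))"
      unfolding matrix_pos_def by blast
    have "c 0 0 \<in> car B" using c(1) by simp
    moreover have "\<phi> (cplx F) = mul B (adj B (c 0 0)) (c 0 0)" using c(2) by simp
    ultimately show ?thesis by blast
  qed
  then obtain c where c: "\<And>F. F \<in> E \<Longrightarrow> c F \<in> car B" "\<And>F. F \<in> E \<Longrightarrow> \<phi> (cplx F) = mul B (adj B (c F)) (c F)"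
    by metis
  let ?G = "\<Sum>F\<in>E. 1 *\<^sub>C cplx F"
  have "\<phi> ?G = (\<Sum>F\<in>E. 1 *\<^sub>C \<phi> (cplx F))"
    by (rule clinear_on_sum[OF lin subspace_cfun]) (use disjoint_family_car[OF E] in auto)
  also have "\<dots> = (\<Sum>F\<in>E. mul B (adj B (c F)) (c F))" using c(2) by simp
  finally have "nrm B (\<Sum>F\<in>E. mul B (adj B (c F)) (c F)) = nrm B (\<phi> ?G)" by simp
  also have "\<dots> \<le> nrm cfun ?G"
  proof -
    have "?G \<in> car cfun"
      using disjoint_family_car[OF E]
      by (intro complex_vector.subspace_sum[OF subspace_cfun] complex_vector.subspace_scale[OF subspace_cfun]) auto
    then show ?thesis using \<phi> by (simp add: contractive_def)
  qed
  also have "\<dots> \<le> 1" by (rule disjoint_family_combination[OF E]) auto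
  finally have "(\<Sum>F\<in>E. nrm B (mul B (adj B (c F)) (c F))) \<le> real (rank_alg B)"
    by (intro rank_alg_packing[OF B c(1)])
  moreover have "(\<Sum>F\<in>E. 1/2) \<le> (\<Sum>F\<in>E. nrm B (mul B (adj B (c F)) (c F)))"
    using big c(2) by (intro sum_mono) (force intro: less_imp_le)
  ultimately show ?thesis by simp
qed

section \<open>The upper bound\<close>

lemma star_hom_matrix_pos:
  assumes A: "cstar_algebra A" and f: "star_hom A B f" and pos: "matrix_pos A k a"
  shows "matrix_pos B k (\<lambda>i j. f (a i j))"
proof -
  interpret cstar A using A by unfold_locales
  have lin: "clinear_on A B f" using f by (simp add: star_hom_def)
  obtain c where c: "\<And>i j. i < k \<Longrightarrow> j < k \<Longrightarrow> c i j \<in> car A"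
    "\<And>i j. i < k \<Longrightarrow> j < k \<Longrightarrow> a i j = (\<Sum>l<k. mul A (adj A (c l i)) (c l j))"
    using pos unfolding matrix_pos_def by blast
  show ?thesis
    unfolding matrix_pos_def
  proof (intro exI[of _ "\<lambda>i j. f (c i j)"] conjI allI impI)
    fix i j assume ij: "i < k" "j < k"
    show "f (c i j) \<in> car B" using lin c(1)[OF ij] by (auto simp: clinear_on_def)
    have "f (a i j) = f (\<Sum>l<k. 1 *\<^sub>C mul A (adj A (c l i)) (c l j))"
      using c(2)[OF ij] by simp
    also have "\<dots> = (\<Sum>l<k. 1 *\<^sub>C f (mul A (adj A (c l i)) (c l j)))"
      by (rule clinear_on_sum[OF lin subspace_A]) (use c(1) ij in simp)
    also have "\<dots> = (\<Sum>l<k. mul B (adj B (f (c l i))) (f (c l j)))"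
      using f c(1) ij by (intro sum.cong refl) (simp add: star_hom_def)
    finally show "f (a i j) = (\<Sum>l<k. mul B (adj B (f (c l i))) (f (c l j)))" .
  qed
qed

definition evaluation :: "nat \<Rightarrow> (nat \<Rightarrow> 'k) \<Rightarrow> ('k \<Rightarrow> complex) \<Rightarrow> nat \<Rightarrow> complex" where
  "evaluation d b f i = (if i < d then f (b i) else 0)"

definition average :: "nat \<Rightarrow> (nat \<Rightarrow> 'k \<Rightarrow> real) \<Rightarrow> (nat \<Rightarrow> complex) \<Rightarrow> 'k \<Rightarrow> complex" where
  "average d p v x = (\<Sum>i<d. complex_of_real (p i x) * v i)"

definition partition_of_unity_upto :: "nat \<Rightarrow> (nat \<Rightarrow> 'k::topological_space \<Rightarrow> real) \<Rightarrow> bool" where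
  "partition_of_unity_upto d p \<longleftrightarrow> (\<forall>i. continuous_on UNIV (p i)) \<and> (\<forall>i x. 0 \<le> p i x)
    \<and> (\<forall>x. (\<Sum>i<d. p i x) = 1)"

lemma partition_dim_pos: "partition_of_unity_upto d p \<Longrightarrow> 0 < d"
  by (rule ccontr) (simp add: partition_of_unity_upto_def)

lemma average_le:
  assumes p: "partition_of_unity_upto d p"
    and v: "\<And>i. i < d \<Longrightarrow> p i x \<noteq> 0 \<Longrightarrow> cmod (v i) \<le> M"
  shows "cmod (\<Sum>i<d. complex_of_real (p i x) * v i) \<le> M"
proof -
  have "cmod (\<Sum>i<d. complex_of_real (p i x) * v i) \<le> (\<Sum>i<d. p i x * M)"
  proof (rule sum_norm_le)
    fix i assume "i \<in> {..<d}"
    moreover have "0 \<le> p i x" using p by (simp add: partition_of_unity_upto_def)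
    ultimately show "cmod (complex_of_real (p i x) * v i) \<le> p i x * M"
      using v[of i] by (cases "p i x = 0") (auto simp: norm_mult intro!: mult_left_mono)
  qed
  also have "\<dots> = M"
    using p by (simp add: partition_of_unity_upto_def flip: sum_distrib_right)
  finally show ?thesis .
qed

lemma evaluation_contractive:
  assumes K: "compact (UNIV :: 'k::topological_space set)" and d: "0 < d"
  shows "contractive (cfun :: ('k \<Rightarrow> complex) salgebra) (linf d) (evaluation d b)"
  unfolding contractive_def clinear_on_def
  using d nrm_cfun_upper[OF K]
  by (auto simp: evaluation_def car_linf car_cfun fun_eq_iff scaleC_fun_def scaleC_complex_def
      intro!: linf_least)

lemma evaluation_star_hom:
  assumes K: "compact (UNIV :: 'k::topological_space set)" and d: "0 < d"
  shows "star_hom (cfun :: ('k \<Rightarrow> complex) salgebra) (linf_alg d) (evaluation d b)"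
  using evaluation_contractive[OF K d, of b]
  by (auto simp: star_hom_def contractive_def clinear_on_def linf_alg_simps mul_cfun adj_cfun
      evaluation_def fun_eq_iff)

lemma average_contractive:
  assumes p: "partition_of_unity_upto d p"
  shows "contractive (linf d) cfun (average d p)"
  unfolding contractive_def clinear_on_def
proof (intro conjI ballI allI)
  show "average d p ` car (linf d) \<subseteq> car cfun"
    using p by (auto simp: car_cfun average_def[abs_def] partition_of_unity_upto_def
        intro!: continuous_intros)
  show "average d p (v + w) = average d p v + average d p w" for v w
    by (simp add: average_def fun_eq_iff algebra_simps sum.distrib)
  show "average d p (c *\<^sub>C v) = c *\<^sub>C average d p v" for c v
    by (simp add: average_def fun_eq_iff scaleC_fun_def scaleC_complex_def sum_distrib_left
        mult.left_commute)
  show "nrm cfun (average d p v) \<le> nrm (linf d) v" for v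
    unfolding average_def[abs_def] by (intro nrm_cfun_least average_le[OF p] linf_upper)
qed

text \<open>
  At the point \<open>x\<close> the matrix of averages is the Gram matrix of the \<open>d k\<close> rows
  \<open>sqrt (p\<^sub>m x) c\<^sub>l(m)\<close>.  Positivity in \<open>M\<^sub>k(C(K))\<close> asks for \<open>k\<close> rows, which is the purpose of
  \<open>gram_reduction\<close>.
\<close>

lemma average_matrix_pos:
  fixes p :: "nat \<Rightarrow> 'k::topological_space \<Rightarrow> real"
  assumes K: "compact (UNIV :: 'k set)" and p: "partition_of_unity_upto d p"
    and pos: "matrix_pos (linf_alg d) k a"
  shows "matrix_pos cfun k (\<lambda>i j. average d p (a i j))"
proof -
  obtain c where c: "\<And>i j. i < k \<Longrightarrow> j < k \<Longrightarrow>
      a i j = (\<Sum>l<k. mul (linf_alg d) (adj (linf_alg d) (c l i)) (c l j))"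
    using pos unfolding matrix_pos_def by blast
  \<comment> \<open>The rows are indexed by the pairs of a point \<open>m < d\<close> and a row \<open>l < k\<close> of the given factor.\<close>
  define C where "C = (\<lambda>(m, l) i x. complex_of_real (sqrt (p m x)) * c l i m)"
  have "continuous_on UNIV (C t i)" for t i
    using p unfolding C_def partition_of_unity_upto_def
    by (cases t) (auto intro!: continuous_intros)
  from gram_reduction[where c = C and k = k and L = "{..<d} \<times> {..<k}", OF K this]
  obtain D where D: "\<And>l i. continuous_on UNIV (D l i)"
    "\<And>i j x. i < k \<Longrightarrow> j < k \<Longrightarrow>
      (\<Sum>t\<in>{..<d} \<times> {..<k}. cnj (C t i x) * C t j x) = (\<Sum>l<k. cnj (D l i x) * D l j x)"
    by blast
  show ?thesis
    unfolding matrix_pos_def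
  proof (intro exI[of _ D] conjI allI impI)
    fix i j assume ij: "i < k" "j < k"
    show "D i j \<in> car cfun" using D(1) by (simp add: car_cfun)
    show "average d p (a i j) = (\<Sum>l<k. mul cfun (adj cfun (D l i)) (D l j))"
    proof
      fix x
      have p0: "0 \<le> p m x" for m using p by (simp add: partition_of_unity_upto_def)
      have sq: "complex_of_real (sqrt (p m x)) * complex_of_real (sqrt (p m x)) = complex_of_real (p m x)" for m
        using p0[of m] by (simp flip: of_real_mult)
      have app: "(\<Sum>l\<in>L. g l) m = (\<Sum>l\<in>L. g l m)" for L :: "nat set" and g :: "nat \<Rightarrow> 'z \<Rightarrow> complex" and m
        by (induction L rule: infinite_finite_induct) auto
      have "average d p (a i j) x = (\<Sum>m<d. \<Sum>l<k. complex_of_real (p m x) * (cnj (c l i m) * c l j m))"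
        by (simp add: average_def c[OF ij] app linf_alg_simps sum_distrib_left)
      also have "\<dots> = (\<Sum>t\<in>{..<d} \<times> {..<k}. cnj (C t i x) * C t j x)"
        unfolding sum.cartesian_product
        by (intro sum.cong refl) (auto simp: C_def ac_simps simp flip: sq)
      also have "\<dots> = (\<Sum>l<k. cnj (D l i x) * D l j x)" by (rule D(2)[OF ij])
      finally show "average d p (a i j) x = (\<Sum>l<k. mul cfun (adj cfun (D l i)) (D l j)) x"
        by (simp add: app mul_cfun adj_cfun)
    qed
  qed
qed

text \<open>
  The data from which the factorisations through \<open>\<complex>\<^sup>d\<close> are built: a partition of unity with \<open>d\<close>
  members and sample points, such that on the support of a member each function of \<open>\<Omega>\<close> stays
  \<open>\<epsilon>\<close>-close to its sample.
\<close>

definition approximable :: "('k::topological_space \<Rightarrow> complex) set \<Rightarrow> real \<Rightarrow> nat \<Rightarrow> bool" where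
  "approximable \<Omega> \<epsilon> d \<longleftrightarrow> (\<exists>p b. partition_of_unity_upto d p \<and>
    (\<forall>f\<in>\<Omega>. \<forall>i<d. \<forall>x. p i x \<noteq> 0 \<longrightarrow> cmod (f (b i) - f x) \<le> \<epsilon>))"

lemma average_evaluation_close:
  assumes p: "partition_of_unity_upto d p"
    and osc: "\<And>i x. i < d \<Longrightarrow> p i x \<noteq> 0 \<Longrightarrow> cmod (f (b i) - f x) \<le> \<epsilon>"
  shows "nrm cfun (average d p (evaluation d b f) - f) \<le> \<epsilon>"
proof (rule nrm_cfun_least)
  fix x
  have one: "(\<Sum>i<d. p i x) = 1" using p by (simp add: partition_of_unity_upto_def)
  have "(average d p (evaluation d b f) - f) x
      = (\<Sum>i<d. complex_of_real (p i x) * evaluation d b f i) - complex_of_real (\<Sum>i<d. p i x) * f x"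
    by (simp only: one) (simp add: average_def)
  also have "\<dots> = (\<Sum>i<d. complex_of_real (p i x) * (f (b i) - f x))"
    by (simp add: evaluation_def sum_distrib_left sum_subtractf algebra_simps)
  also have "cmod \<dots> \<le> \<epsilon>"
    by (rule average_le[OF p osc])
  finally show "cmod ((average d p (evaluation d b f) - f) x) \<le> \<epsilon>" .
qed

lemma clinear_on_diff:
  assumes f: "clinear_on X Y f" and X: "complex_vector.subspace (car X)" and x: "x \<in> car X" "y \<in> car X"
  shows "f (x - y) = f x - f y"
proof -
  have "f ((x - y) + y) = f (x - y) + f y"
    using f x complex_vector.subspace_diff[OF X x] unfolding clinear_on_def by blast
  then show ?thesis by simp
qed

lemma contractive_average_evaluation:
  assumes K: "compact (UNIV :: 'k::topological_space set)"
    and g: "contractive (cfun :: ('k \<Rightarrow> complex) salgebra) Y \<gamma>" and f: "f \<in> car cfun"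
    and p: "partition_of_unity_upto d p"
    and osc: "\<And>i x. i < d \<Longrightarrow> p i x \<noteq> 0 \<Longrightarrow> cmod (f (b i) - f x) \<le> \<epsilon>"
  shows "nrm Y (\<gamma> (average d p (evaluation d b f)) - \<gamma> f) \<le> \<epsilon>"
proof -
  have av: "average d p (evaluation d b f) \<in> car cfun"
    using average_contractive[OF p] evaluation_contractive[OF K partition_dim_pos[OF p], of b] f
    unfolding contractive_def clinear_on_def by blast
  have "\<gamma> (average d p (evaluation d b f)) - \<gamma> f = \<gamma> (average d p (evaluation d b f) - f)"
    by (rule clinear_on_diff[symmetric, OF _ subspace_cfun av f, of Y])
      (use g in \<open>simp add: contractive_def\<close>)
  moreover have "average d p (evaluation d b f) - f \<in> car cfun"
    by (rule complex_vector.subspace_diff[OF subspace_cfun av f])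
  moreover have "nrm cfun (average d p (evaluation d b f) - f) \<le> \<epsilon>"
    by (rule average_evaluation_close[OF p]) (rule osc)
  ultimately show ?thesis
    using g unfolding contractive_def by (metis order_trans)
qed

lemma contractive_comp:
  assumes "contractive X Y f" "contractive Y Z g"
  shows "contractive X Z (\<lambda>x. g (f x))"
proof -
  have fX: "f x \<in> car Y" if "x \<in> car X" for x
    using assms(1) that by (auto simp: contractive_def clinear_on_def)
  have "nrm Z (g (f x)) \<le> nrm X x" if "x \<in> car X" for x
    using assms fX[OF that] that unfolding contractive_def by (meson order_trans)
  then show ?thesis
    using assms fX unfolding contractive_def clinear_on_def by auto
qed

lemma rc_le_of_approximable:
  assumes K: "compact (UNIV :: 'k::topological_space set)"
    and iso: "isometric (cfun :: ('k \<Rightarrow> complex) salgebra) Y \<iota>"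
    and \<Omega>: "\<Omega> \<subseteq> car cfun" and ap: "approximable \<Omega> \<epsilon> d" and \<epsilon>: "\<epsilon> < \<delta>"
  shows "rc cfun Y \<iota> \<Omega> \<delta> \<le> enat d"
proof -
  obtain p b where p: "partition_of_unity_upto d p"
    and osc: "\<And>f i x. f \<in> \<Omega> \<Longrightarrow> i < d \<Longrightarrow> p i x \<noteq> 0 \<Longrightarrow> cmod (f (b i) - f x) \<le> \<epsilon>"
    using ap unfolding approximable_def by blast
  have con: "contractive cfun Y \<iota>" using iso by (simp add: isometric_def contractive_def)
  have "nrm Y (\<iota> (average d p (evaluation d b f)) - \<iota> f) < \<delta>" if "f \<in> \<Omega>" for f
  proof -
    have "nrm Y (\<iota> (average d p (evaluation d b f)) - \<iota> f) \<le> \<epsilon>"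
      by (rule contractive_average_evaluation[OF K con _ p]) (use that \<Omega> osc in auto)
    then show ?thesis using \<epsilon> by simp
  qed
  then have "(evaluation d b, \<lambda>v. \<iota> (average d p v), d) \<in> CA cfun Y \<iota> \<Omega> \<delta>"
    unfolding CA_def using partition_dim_pos[OF p] evaluation_contractive[OF K]
      contractive_comp[OF average_contractive[OF p] con] by simp
  then show ?thesis unfolding rc_def by (rule INF_lower2) simp
qed

lemma rcp_le_of_approximable:
  assumes K: "compact (UNIV :: 'k::topological_space set)"
    and rep: "star_hom (cfun :: ('k \<Rightarrow> complex) salgebra) bounded_ops \<pi>"
    and \<Omega>: "\<Omega> \<subseteq> car cfun" and ap: "approximable \<Omega> \<epsilon> d" and \<epsilon>: "\<epsilon> < \<delta>"
  shows "rcp cfun \<pi> \<Omega> \<delta> \<le> enat d"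
proof -
  obtain p b where p: "partition_of_unity_upto d p"
    and osc: "\<And>f i x. f \<in> \<Omega> \<Longrightarrow> i < d \<Longrightarrow> p i x \<noteq> 0 \<Longrightarrow> cmod (f (b i) - f x) \<le> \<epsilon>"
    using ap unfolding approximable_def by blast
  note d = partition_dim_pos[OF p]
  have con: "contractive cfun bounded_ops \<pi>" by (rule representation_contractive[OF K rep])
  have "nrm bounded_ops (\<pi> (average d p (evaluation d b f)) - \<pi> f) < \<delta>" if "f \<in> \<Omega>" for f
  proof -
    have "nrm bounded_ops (\<pi> (average d p (evaluation d b f)) - \<pi> f) \<le> \<epsilon>"
      by (rule contractive_average_evaluation[OF K con _ p]) (use that \<Omega> osc in auto)
    then show ?thesis using \<epsilon> by simp
  qed
  moreover have "contractive cfun (linf_alg d) (evaluation d b)"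
    using evaluation_contractive[OF K d] by (simp add: contractive_def clinear_on_def linf_alg_simps)
  moreover have "completely_positive cfun (linf_alg d) (evaluation d b)"
    using evaluation_star_hom[OF K d, of b] star_hom_matrix_pos[OF cstar_algebra_cfun[OF K]]
    unfolding completely_positive_def by (auto simp: star_hom_def)
  moreover have comp: "contractive (linf_alg d) bounded_ops (\<lambda>v. \<pi> (average d p v))"
    using contractive_comp[OF average_contractive[OF p] con]
    by (simp add: contractive_def clinear_on_def linf_alg_simps)
  moreover have "completely_positive (linf_alg d) bounded_ops (\<lambda>v. \<pi> (average d p v))"
    unfolding completely_positive_def
    using comp star_hom_matrix_pos[OF cstar_algebra_cfun[OF K] rep average_matrix_pos[OF K p]]
    by (auto simp: contractive_def)
  ultimately have "(evaluation d b, \<lambda>v. \<pi> (average d p v), linf_alg d) \<in> CPA cfun \<pi> \<Omega> \<delta>"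
    unfolding CPA_def using fd_linf_alg[OF d] by simp
  then show ?thesis unfolding rcp_def by (rule INF_lower2) (simp add: rank_linf_alg[OF d])
qed

text \<open>
  Unlike general open sets, cozero sets come with the functions that a partition of unity is made
  of, and they are stable under the formation of joins.
\<close>

definition cozero :: "'k::topological_space set \<Rightarrow> bool" where
  "cozero U \<longleftrightarrow> (\<exists>g :: 'k \<Rightarrow> real. continuous_on UNIV g \<and> (\<forall>x. 0 \<le> g x) \<and> U = {x. 0 < g x})"

lemma cozero_iterated_join:
  assumes T: "continuous_on UNIV T" and W: "\<And>U. U \<in> W \<Longrightarrow> cozero U"
  shows "U \<in> iterated_join T W n \<Longrightarrow> cozero U"
proof (induction n arbitrary: U)
  case 0
  then show ?case by (auto simp: cozero_def intro!: exI[of _ "\<lambda>_. 1"])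
next
  case (Suc n)
  then obtain V V' where V: "V \<in> iterated_join T W n" "V' \<in> W" "U = V \<inter> (T ^^ n) -` V'"
    by (auto simp: cover_join_def)
  obtain g where g: "continuous_on UNIV g" "\<forall>x. 0 \<le> g x" "V = {x. 0 < (g x :: real)}"
    using Suc.IH[OF V(1)] by (auto simp: cozero_def)
  obtain h where h: "continuous_on UNIV h" "\<forall>x. 0 \<le> h x" "V' = {x. 0 < (h x :: real)}"
    using W[OF V(2)] by (auto simp: cozero_def)
  have "continuous_on UNIV (\<lambda>x. g x * h ((T ^^ n) x))"
    by (intro continuous_intros g continuous_on_funpow[OF T h(1)])
  moreover have "U = {x. 0 < g x * h ((T ^^ n) x)}"
    using g(2) h(2) by (auto simp: V(3) g(3) h(3) zero_less_mult_iff not_less[symmetric])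
  ultimately show ?case
    unfolding cozero_def using g(2) h(2) by (intro exI[of _ "\<lambda>x. g x * h ((T ^^ n) x)"]) auto
qed

lemma small_oscillation_cover:
  fixes \<Omega> :: "('k::topological_space \<Rightarrow> complex) set"
  assumes K: "compact (UNIV :: 'k set)" and fin: "finite \<Omega>" and \<Omega>: "\<Omega> \<subseteq> car cfun" and \<epsilon>: "0 < \<epsilon>"
  obtains W where "finite_open_cover W" "\<And>U. U \<in> W \<Longrightarrow> cozero U"
    "\<And>U f x y. U \<in> W \<Longrightarrow> f \<in> \<Omega> \<Longrightarrow> x \<in> U \<Longrightarrow> y \<in> U \<Longrightarrow> cmod (f x - f y) \<le> \<epsilon>"
proof -
  \<comment> \<open>Positive exactly where every \<open>f \<in> \<Omega>\<close> is within \<open>\<epsilon> / 2\<close> of its value at \<open>a\<close>.\<close>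
  define g where "g a x = (\<Prod>f\<in>\<Omega>. max 0 (\<epsilon> / 2 - cmod (f x - f a)))" for a x :: 'k
  have cont: "continuous_on UNIV f" if "f \<in> \<Omega>" for f using \<Omega> that by (auto simp: car_cfun)
  have g_cont: "continuous_on UNIV (g a)" for a
    unfolding g_def using cont by (intro continuous_intros) auto
  have g_nonneg: "0 \<le> g a x" for a x unfolding g_def by (intro prod_nonneg) auto
  have g_self: "0 < g a a" for a unfolding g_def using \<epsilon> by (intro prod_pos) auto
  have g_close: "cmod (f x - f a) < \<epsilon> / 2" if "f \<in> \<Omega>" "0 < g a x" for f a x
    using that fin by (fastforce simp: g_def prod_zero_iff max_def less_le split: if_splits)
  have op: "open {x. 0 < g a x}" for a
    using g_cont[of a] by (intro open_Collect_less) auto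
  moreover have "UNIV \<subseteq> (\<Union>a\<in>UNIV. {x. 0 < g a x})" using g_self by auto
  ultimately obtain A where A: "finite A" "UNIV \<subseteq> (\<Union>a\<in>A. {x. 0 < g a x})"
    using compactE_image[OF K, of UNIV "\<lambda>a. {x. 0 < g a x}"] by (metis (no_types, lifting))
  show thesis
  proof (rule that[of "(\<lambda>a. {x. 0 < g a x}) ` A"])
    show "finite_open_cover ((\<lambda>a. {x. 0 < g a x}) ` A)"
      unfolding finite_open_cover_def using A op by blast
    show "cozero U" if "U \<in> (\<lambda>a. {x. 0 < g a x}) ` A" for U
      using that g_cont g_nonneg unfolding cozero_def by blast
    fix U f x y assume "U \<in> (\<lambda>a. {x. 0 < g a x}) ` A" "x \<in> U" "y \<in> U" and f: "f \<in> \<Omega>"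
    then obtain a where a: "0 < g a x" "0 < g a y" by auto
    have "cmod (f x - f y) \<le> cmod (f x - f a) + cmod (f y - f a)"
      using norm_triangle_ineq4[of "f x - f a" "f y - f a"] by simp
    then show "cmod (f x - f y) \<le> \<epsilon>"
      using g_close[OF f a(1)] g_close[OF f a(2)] by linarith
  qed
qed

lemma iterated_join_oscillation:
  assumes osc: "\<And>U x y. U \<in> W \<Longrightarrow> x \<in> U \<Longrightarrow> y \<in> U \<Longrightarrow> cmod (f x - f y) \<le> \<epsilon>"
    and U: "U \<in> iterated_join T W n" "x \<in> U" "y \<in> U" and i: "i < n"
  shows "cmod (f ((T ^^ i) x) - f ((T ^^ i) y)) \<le> \<epsilon>"
  using U i
proof (induction n arbitrary: U)
  case (Suc n)
  then obtain V V' where V: "V \<in> iterated_join T W n" "V' \<in> W" "U = V \<inter> (T ^^ n) -` V'"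
    by (auto simp: cover_join_def)
  show ?case
  proof (cases "i = n")
    case True
    then show ?thesis using osc[OF V(2)] Suc.prems V(3) by auto
  next
    case False
    then show ?thesis using Suc.IH[OF V(1)] Suc.prems V(3) by auto
  qed
qed simp

lemma koopman_funpow: "(koopman T ^^ i) f = (\<lambda>x. f ((T ^^ i) x))"
  by (induction i arbitrary: f) (auto simp: koopman_def fun_eq_iff funpow_swap1)

lemma iterated_approximable:
  fixes \<Omega> :: "('k::topological_space \<Rightarrow> complex) set"
  assumes T: "continuous_on UNIV T" and W: "finite_open_cover W" "\<And>U. U \<in> W \<Longrightarrow> cozero U"
    and osc: "\<And>U f x y. U \<in> W \<Longrightarrow> f \<in> \<Omega> \<Longrightarrow> x \<in> U \<Longrightarrow> y \<in> U \<Longrightarrow> cmod (f x - f y) \<le> \<epsilon>"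
  shows "approximable (\<Union>i<n. (koopman T ^^ i) ` \<Omega>) \<epsilon> (min_subcover (iterated_join T W n))"
proof -
  have finW: "finite W" and covW: "\<Union>W = UNIV" using W(1) by (simp_all add: finite_open_cover_def)
  obtain V where V: "finite V" "V \<subseteq> iterated_join T W n" "\<Union>V = UNIV"
    "card V = min_subcover (iterated_join T W n)"
    using min_subcover_attained[OF finite_iterated_join[OF finW] iterated_join_covers[OF covW]] .
  define d where "d = card V"
  obtain h where h: "bij_betw h {..<d} V"
    using ex_bij_betw_nat_finite[OF V(1)] by (auto simp: d_def lessThan_atLeast0)
  have hV: "h i \<in> V" if "i < d" for i using h that by (auto simp: bij_betw_def)
  have "\<exists>g :: 'k \<Rightarrow> real. continuous_on UNIV g \<and> (\<forall>x. 0 \<le> g x) \<and> (i < d \<longrightarrow> h i = {x. 0 < g x})" for i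
  proof (cases "i < d")
    case True
    then have "cozero (h i)" using cozero_iterated_join[OF T W(2)] hV V(2) by blast
    then show ?thesis by (auto simp: cozero_def)
  qed (auto intro!: exI[of _ "\<lambda>_. 0"])
  then obtain g :: "nat \<Rightarrow> 'k \<Rightarrow> real" where g: "\<And>i. continuous_on UNIV (g i)" "\<And>i x. 0 \<le> g i x"
    "\<And>i. i < d \<Longrightarrow> h i = {x. 0 < g i x}" by metis
  define s where "s x = (\<Sum>i<d. g i x)" for x
  have s_pos: "0 < s x" for x
  proof -
    obtain U where U: "U \<in> V" "x \<in> U" using cover_memE[OF V(3)] .
    then obtain i where "i < d" "U = h i" using h by (auto simp: bij_betw_def)
    then have "i < d" "0 < g i x" using g(3) U by auto
    then show ?thesis unfolding s_def using g(2) by (intro sum_pos2[of _ i]) auto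
  qed
  define p where "p i x = g i x / s x" for i x
  have "partition_of_unity_upto d p"
    unfolding partition_of_unity_upto_def
  proof (intro conjI allI)
    show "continuous_on UNIV (p i)" for i
      unfolding p_def s_def using g(1) s_pos[unfolded s_def]
      by (intro continuous_intros) (auto simp: less_imp_neq[symmetric])
    show "0 \<le> p i x" for i x using g(2) s_pos[of x] by (simp add: p_def)
    show "(\<Sum>i<d. p i x) = 1" for x
      using s_pos[of x] by (simp add: p_def s_def flip: sum_divide_distrib)
  qed
  moreover have "cmod (f ((SOME y. y \<in> h i)) - f x) \<le> \<epsilon>"
    if f: "f \<in> (\<Union>i<n. (koopman T ^^ i) ` \<Omega>)" and i: "i < d" and px: "p i x \<noteq> 0" for f i x
  proof -
    have x: "x \<in> h i" using px g(2)[of i x] g(3)[OF i] by (auto simp: p_def less_le)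
    then have y: "(SOME y. y \<in> h i) \<in> h i" by (rule someI)
    obtain j f' where j: "j < n" "f' \<in> \<Omega>" "f = (\<lambda>x. f' ((T ^^ j) x))"
      using f by (auto simp: koopman_funpow)
    show ?thesis unfolding j(3)
      by (rule iterated_join_oscillation[where f = f' and W = W, OF _ _ y x j(1)])
        (use osc[OF _ j(2)] hV[OF i] V(2) in auto)
  qed
  ultimately show ?thesis
    unfolding approximable_def V(4)[symmetric] d_def[symmetric] by (intro exI[of _ p] exI[of _ "\<lambda>i. SOME y. y \<in> h i"]) blast
qed

lemma elog_le: "m \<le> enat k \<Longrightarrow> 1 \<le> k \<Longrightarrow> elog m \<le> ereal (ln (real k))"
  by (cases m) (auto simp: elog_def)

lemma koopman_orbit_subset:
  assumes T: "continuous_on UNIV T" and \<Omega>: "\<Omega> \<subseteq> car cfun"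
  shows "(\<Union>i<n. (koopman T ^^ i) ` \<Omega>) \<subseteq> car cfun"
  using \<Omega> continuous_on_funpow[OF T] by (auto simp: car_cfun koopman_funpow subset_iff)

text \<open>
  The hypothesis on \<open>r\<close> is all that the upper bound needs to know of a rank function.
\<close>

lemma entropy_le_htop:
  fixes T :: "'k::topological_space \<Rightarrow> 'k"
  assumes K: "compact (UNIV :: 'k set)" and T: "continuous_on UNIV T"
    and r: "\<And>\<Omega> \<epsilon> \<delta> d. \<Omega> \<subseteq> car cfun \<Longrightarrow> approximable \<Omega> \<epsilon> d \<Longrightarrow> \<epsilon> < \<delta> \<Longrightarrow> r \<Omega> \<delta> \<le> enat d"
  shows "entropy_of (car cfun) r (koopman T) \<le> htop T"
  unfolding entropy_of_def
proof (intro SUP_least)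
  fix \<Omega> :: "('k \<Rightarrow> complex) set" and \<delta> :: real
  assume "\<Omega> \<in> {\<Omega>. finite \<Omega> \<and> \<Omega> \<subseteq> car cfun}" "\<delta> \<in> {0<..}"
  then have \<Omega>: "finite \<Omega>" "\<Omega> \<subseteq> car cfun" and \<delta>: "0 < \<delta>" by auto
  obtain W where W: "finite_open_cover W" "\<And>U. U \<in> W \<Longrightarrow> cozero U"
    "\<And>U f x y. U \<in> W \<Longrightarrow> f \<in> \<Omega> \<Longrightarrow> x \<in> U \<Longrightarrow> y \<in> U \<Longrightarrow> cmod (f x - f y) \<le> \<delta> / 2"
    using small_oscillation_cover[OF K \<Omega>, of "\<delta> / 2"] \<delta> by auto
  have finW: "finite W" and covW: "\<Union>W = UNIV" using W(1) by (simp_all add: finite_open_cover_def)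
  let ?N = "\<lambda>n. min_subcover (iterated_join T W n)"
  have le: "elog (r (\<Union>i<n. (koopman T ^^ i) ` \<Omega>) \<delta>) / ereal (real n) \<le> ereal (ln (real (?N n)) / real n)"
    if "n \<ge> 1" for n
  proof -
    have "r (\<Union>i<n. (koopman T ^^ i) ` \<Omega>) \<delta> \<le> enat (?N n)"
      by (rule r[OF koopman_orbit_subset[OF T \<Omega>(2)] iterated_approximable[OF T W]]) (use \<delta> in auto)
    then have "elog (r (\<Union>i<n. (koopman T ^^ i) ` \<Omega>) \<delta>) \<le> ereal (ln (real (?N n)))"
      by (rule elog_le) (rule min_subcover_pos[OF finite_iterated_join[OF finW] iterated_join_covers[OF covW]])
    then have "elog (r (\<Union>i<n. (koopman T ^^ i) ` \<Omega>) \<delta>) / ereal (real n) \<le> ereal (ln (real (?N n))) / ereal (real n)"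
      using that by (intro ereal_divide_right_mono) auto
    then show ?thesis using that by simp
  qed
  have "entropy_at r (koopman T) \<Omega> \<delta> \<le> limsup (\<lambda>n. ereal (ln (real (?N n)) / real n))"
    unfolding entropy_at_def
    by (intro Limsup_mono eventually_sequentiallyI[of 1] le)
  also have "\<dots> = ereal (lim (\<lambda>n. ln (real (?N n)) / real n))"
    using cover_entropy_convergent[OF finW covW, of T] by (intro lim_imp_Limsup) auto
  also have "\<dots> \<le> htop T"
    unfolding htop_def using W(1) by (intro SUP_upper) simp
  finally show "entropy_at r (koopman T) \<Omega> \<delta> \<le> htop T" .
qed

section \<open>The lower bound\<close>

text \<open>
  The function \<open>F\<close> is a cut-off of an average \<open>f\<close> of elements of \<open>\<Omega>\<close> that attains its maximum
  \<open>1\<close>.  The last condition says that subtracting \<open>\<theta> F\<close> lowers the norm of \<open>f\<close> by at least \<open>\<theta>\<close>.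
\<close>

definition peaked :: "('k::topological_space \<Rightarrow> complex) set \<Rightarrow> real \<Rightarrow> ('k \<Rightarrow> real) \<Rightarrow> bool" where
  "peaked \<Omega> \<theta> F \<longleftrightarrow> (\<exists>n u x. 0 < (n::nat) \<and>
    (\<forall>i<n. cplx (u i) \<in> \<Omega> \<and> continuous_on UNIV (u i) \<and> (\<forall>y. 0 \<le> u i y \<and> u i y \<le> 1)) \<and>
    (\<Sum>i<n. u i x) / real n = 1 \<and> (\<forall>y. \<bar>(\<Sum>i<n. u i y) / real n - \<theta> * F y\<bar> \<le> 1 - \<theta>))"

lemma seminormed_sum:
  assumes Y: "seminormed Y" and x: "\<And>i. i \<in> I \<Longrightarrow> x i \<in> car Y"
  shows "nrm Y (\<Sum>i\<in>I. x i) \<le> (\<Sum>i\<in>I. nrm Y (x i))"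
  using x
proof (induction I rule: infinite_finite_induct)
  case (insert i I)
  have "x i \<in> car Y" "(\<Sum>i\<in>I. x i) \<in> car Y"
    using insert Y by (auto simp: seminormed_def intro!: complex_vector.subspace_sum)
  then have "nrm Y (x i + (\<Sum>i\<in>I. x i)) \<le> nrm Y (x i) + nrm Y (\<Sum>i\<in>I. x i)"
    using Y by (simp add: seminormed_def)
  then show ?case using insert by simp
next
  have "0 \<in> car Y" using Y complex_vector.subspace_0 by (auto simp: seminormed_def)
  then have "nrm Y (0 *\<^sub>C 0) = cmod 0 * nrm Y 0" using Y unfolding seminormed_def by blast
  then have z: "nrm Y 0 = 0" by simp
  { case (infinite A) then show ?case using z by simp }
  { case empty then show ?case using z by simp }
qed

text \<open>
  The error of the factorisation on the average \<open>f\<close> is below \<open>\<theta>/2\<close>, hence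
  \<open>1 - \<theta>/2 < \<parallel>\<phi>(f)\<parallel> \<le> \<parallel>\<phi>(f - \<theta> F)\<parallel> + \<theta> \<parallel>\<phi>(F)\<parallel> \<le> 1 - \<theta> + \<theta> \<parallel>\<phi>(F)\<parallel>\<close>.
\<close>

lemma peaked_image_norm:
  fixes \<phi> :: "('k::topological_space \<Rightarrow> complex) \<Rightarrow> 'b::complex_vector"
    and \<psi> :: "'b \<Rightarrow> 'y::complex_vector"
  assumes B: "seminormed B" and Y: "seminormed Y"
    and \<phi>: "contractive cfun B \<phi>" and \<psi>: "contractive B Y \<psi>" and \<gamma>: "clinear_on cfun Y \<gamma>"
    and close: "\<And>u. u \<in> \<Omega> \<Longrightarrow> nrm Y (\<psi> (\<phi> u) - \<gamma> u) < \<theta> / 2"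
    and norming: "\<And>f x. continuous_on UNIV f \<Longrightarrow> (\<And>y. 0 \<le> f y \<and> f y \<le> 1) \<Longrightarrow> f x = 1 \<Longrightarrow>
      1 \<le> nrm Y (\<gamma> (cplx f))"
    and \<theta>: "0 < \<theta>" and F: "continuous_on UNIV F" "peaked \<Omega> \<theta> F"
  shows "1/2 < nrm B (\<phi> (cplx F))"
proof -
  obtain n u x where n: "0 < (n::nat)"
    and u: "\<And>i. i < n \<Longrightarrow> cplx (u i) \<in> \<Omega>" "\<And>i. i < n \<Longrightarrow> continuous_on UNIV (u i)"
      "\<And>i y. i < n \<Longrightarrow> 0 \<le> u i y \<and> u i y \<le> 1"
    and x: "(\<Sum>i<n. u i x) / real n = 1"
    and cut: "\<And>y. \<bar>(\<Sum>i<n. u i y) / real n - \<theta> * F y\<bar> \<le> 1 - \<theta>"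
    using F(2) unfolding peaked_def by blast
  have sB: "complex_vector.subspace (car B)" and sY: "complex_vector.subspace (car Y)"
    using B Y by (auto simp: seminormed_def)
  have lin\<phi>: "clinear_on cfun B \<phi>" and lin\<psi>: "clinear_on B Y \<psi>"
    using \<phi> \<psi> by (auto simp: contractive_def)
  have in\<phi>: "\<phi> f \<in> car B" if "f \<in> car cfun" for f using lin\<phi> that by (auto simp: clinear_on_def)
  have in\<psi>: "\<psi> v \<in> car Y" if "v \<in> car B" for v using lin\<psi> that by (auto simp: clinear_on_def)
  have in\<gamma>: "\<gamma> f \<in> car Y" if "f \<in> car cfun" for f using \<gamma> that by (auto simp: clinear_on_def)
  have ucar: "cplx (u i) \<in> car cfun" if "i < n" for i
    using u(2)[OF that] by (auto simp: car_cfun intro!: continuous_intros)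
  define f where "f y = (\<Sum>i<n. u i y) / real n" for y
  have f_cont: "continuous_on UNIV f"
    unfolding f_def using u(2) n by (intro continuous_intros) auto
  have f_sum: "cplx f = (\<Sum>i<n. complex_of_real (1 / real n) *\<^sub>C cplx (u i))"
  proof
    fix y
    have app: "(\<Sum>i\<in>I. g i) y = (\<Sum>i\<in>I. g i y)" for I :: "nat set" and g :: "nat \<Rightarrow> 'k \<Rightarrow> complex"
      by (induction I rule: infinite_finite_induct) auto
    show "cplx f y = (\<Sum>i<n. complex_of_real (1 / real n) *\<^sub>C cplx (u i)) y"
      unfolding app f_def by (simp add: scaleC_fun_def scaleC_complex_def sum_divide_distrib)
  qed
  have fcar: "cplx f \<in> car cfun" using f_cont by (auto simp: car_cfun intro!: continuous_intros)
  have Fcar: "cplx F \<in> car cfun" using F(1) by (auto simp: car_cfun intro!: continuous_intros)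
  define e where "e = (\<lambda>i. \<psi> (\<phi> (cplx (u i))) - \<gamma> (cplx (u i)))"
  have eY: "e i \<in> car Y" if "i < n" for i
    unfolding e_def using that ucar by (intro complex_vector.subspace_diff[OF sY] in\<psi> in\<phi> in\<gamma>) auto
  have err: "nrm Y (\<gamma> (cplx f) - \<psi> (\<phi> (cplx f))) < \<theta> / 2"
  proof -
    have "\<phi> (cplx f) = (\<Sum>i<n. complex_of_real (1 / real n) *\<^sub>C \<phi> (cplx (u i)))"
      unfolding f_sum by (rule clinear_on_sum[OF lin\<phi> subspace_cfun]) (use ucar in simp)
    then have "\<psi> (\<phi> (cplx f)) = (\<Sum>i<n. complex_of_real (1 / real n) *\<^sub>C \<psi> (\<phi> (cplx (u i))))"
      using clinear_on_sum[OF lin\<psi> sB, of "{..<n}" "\<lambda>i. \<phi> (cplx (u i))" "\<lambda>_. complex_of_real (1 / real n)"]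
        in\<phi> ucar by simp
    moreover have "\<gamma> (cplx f) = (\<Sum>i<n. complex_of_real (1 / real n) *\<^sub>C \<gamma> (cplx (u i)))"
      unfolding f_sum by (rule clinear_on_sum[OF \<gamma> subspace_cfun]) (use ucar in simp)
    ultimately have "\<gamma> (cplx f) - \<psi> (\<phi> (cplx f)) = (\<Sum>i<n. (- complex_of_real (1 / real n)) *\<^sub>C e i)"
      unfolding e_def
      by (simp add: complex_vector.scale_right_diff_distrib sum_subtractf sum_negf)
    also have "nrm Y \<dots> \<le> (\<Sum>i<n. nrm Y ((- complex_of_real (1 / real n)) *\<^sub>C e i))"
      using eY by (intro seminormed_sum[OF Y] complex_vector.subspace_scale[OF sY]) auto
    also have "\<dots> = (\<Sum>i<n. nrm Y (e i) / real n)"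
      using Y eY n unfolding seminormed_def by (intro sum.cong refl) (simp add: norm_divide del: complex_vector.scale_minus_left)
    also have "\<dots> < (\<Sum>i<n. (\<theta> / 2) / real n)"
      using close u(1) n unfolding e_def by (intro sum_strict_mono divide_strict_right_mono) auto
    also have "\<dots> = \<theta> / 2" using n by simp
    finally show ?thesis .
  qed
  have "1 \<le> nrm Y (\<gamma> (cplx f))"
  proof (rule norming[OF f_cont])
    show "0 \<le> f y \<and> f y \<le> 1" for y
    proof -
      have "(\<Sum>i<n. u i y) \<le> (\<Sum>i<n. 1)" using u(3) by (intro sum_mono) auto
      moreover have "0 \<le> (\<Sum>i<n. u i y)" using u(3) by (intro sum_nonneg) auto
      ultimately show ?thesis using n by (simp add: f_def)
    qed
    show "f x = 1" using x by (simp add: f_def)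
  qed
  also have "\<gamma> (cplx f) = \<psi> (\<phi> (cplx f)) + (\<gamma> (cplx f) - \<psi> (\<phi> (cplx f)))" by simp
  also have "nrm Y \<dots> \<le> nrm Y (\<psi> (\<phi> (cplx f))) + nrm Y (\<gamma> (cplx f) - \<psi> (\<phi> (cplx f)))"
  proof -
    have "\<psi> (\<phi> (cplx f)) \<in> car Y" "\<gamma> (cplx f) - \<psi> (\<phi> (cplx f)) \<in> car Y"
      using fcar by (auto intro!: complex_vector.subspace_diff[OF sY] in\<psi> in\<phi> in\<gamma>)
    then show ?thesis using Y unfolding seminormed_def by blast
  qed
  also have "nrm Y (\<psi> (\<phi> (cplx f))) \<le> nrm B (\<phi> (cplx f))"
    using \<psi> in\<phi>[OF fcar] by (simp add: contractive_def)
  finally have big: "1 - \<theta> / 2 < nrm B (\<phi> (cplx f))" using err by linarith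
  define h where "h = cplx f - complex_of_real \<theta> *\<^sub>C cplx F"
  have \<theta>F: "complex_of_real \<theta> *\<^sub>C cplx F \<in> car cfun"
    by (rule complex_vector.subspace_scale[OF subspace_cfun Fcar])
  have hcar: "h \<in> car cfun"
    unfolding h_def by (rule complex_vector.subspace_diff[OF subspace_cfun fcar \<theta>F])
  have "h + complex_of_real \<theta> *\<^sub>C cplx F = cplx f" by (simp add: h_def)
  then have "\<phi> (cplx f) = \<phi> h + complex_of_real \<theta> *\<^sub>C \<phi> (cplx F)"
    using lin\<phi> hcar \<theta>F Fcar unfolding clinear_on_def by metis
  then have "nrm B (\<phi> (cplx f)) \<le> nrm B (\<phi> h) + nrm B (complex_of_real \<theta> *\<^sub>C \<phi> (cplx F))"
    using B in\<phi>[OF hcar] in\<phi>[OF Fcar] complex_vector.subspace_scale[OF sB] unfolding seminormed_def by metis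
  also have "nrm B (complex_of_real \<theta> *\<^sub>C \<phi> (cplx F)) = \<theta> * nrm B (\<phi> (cplx F))"
    using B in\<phi>[OF Fcar] \<theta> unfolding seminormed_def by simp
  also have "nrm B (\<phi> h) \<le> nrm cfun h" using \<phi> hcar by (simp add: contractive_def)
  also have "nrm cfun h \<le> 1 - \<theta>"
  proof (rule nrm_cfun_least)
    fix y
    have "h y = complex_of_real (f y - \<theta> * F y)"
      by (simp add: h_def scaleC_fun_def scaleC_complex_def)
    then show "cmod (h y) \<le> 1 - \<theta>" using cut[of y] by (simp only: norm_of_real f_def)
  qed
  finally have "\<theta> / 2 < \<theta> * nrm B (\<phi> (cplx F))" using big by linarith
  then show ?thesis using \<theta> by simp
qed

text \<open>
  What the lower bound needs to know of a rank function.
\<close>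

definition bounds_packings :: "(('k::topological_space \<Rightarrow> complex) set \<Rightarrow> real \<Rightarrow> enat) \<Rightarrow> bool" where
  "bounds_packings r \<longleftrightarrow> (\<forall>\<Omega> \<theta> E k. 0 < \<theta> \<longrightarrow> disjoint_family_in E \<longrightarrow> (\<forall>F\<in>E. peaked \<Omega> \<theta> F) \<longrightarrow>
    r \<Omega> (\<theta> / 2) = enat k \<longrightarrow> card E \<le> 2 * k)"

lemma rc_bounds_packings:
  fixes \<iota> :: "('k::topological_space \<Rightarrow> complex) \<Rightarrow> 'y::complex_vector"
  assumes K: "compact (UNIV :: 'k set)" and Y: "cbanach Y" and iso: "isometric cfun Y \<iota>"
  shows "bounds_packings (rc cfun Y \<iota>)"
  unfolding bounds_packings_def
proof (intro allI impI)
  fix \<Omega> \<theta> E k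
  assume \<theta>: "0 < \<theta>" and E: "disjoint_family_in E" and peak: "\<forall>F\<in>E. peaked \<Omega> \<theta> F"
    and k: "rc cfun Y \<iota> \<Omega> (\<theta> / 2) = enat k"
  have "rc cfun Y \<iota> \<Omega> (\<theta> / 2) < enat (Suc k)" using k by simp
  then obtain \<phi> \<psi> d where d: "(\<phi>, \<psi>, d) \<in> CA cfun Y \<iota> \<Omega> (\<theta> / 2)" "d \<le> k"
    unfolding rc_def INF_less_iff by (auto simp: less_Suc_eq_le)
  have d0: "0 < d" and \<phi>: "contractive cfun (linf d) \<phi>" and \<psi>: "contractive (linf d) Y \<psi>"
    and close: "\<And>u. u \<in> \<Omega> \<Longrightarrow> nrm Y (\<psi> (\<phi> u) - \<iota> u) < \<theta> / 2"
    using d by (auto simp: CA_def)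
  have "card E \<le> 2 * d"
  proof (rule linf_packing[OF E d0 \<phi>])
    fix F assume F: "F \<in> E"
    show "1/2 < nrm (linf d) (\<phi> (cplx F))"
    proof (rule peaked_image_norm[where \<phi> = \<phi> and \<psi> = \<psi> and \<gamma> = \<iota> and \<Omega> = \<Omega>, OF _ _ \<phi> \<psi> _ _ _ \<theta>])
      show "nrm Y (\<psi> (\<phi> u) - \<iota> u) < \<theta> / 2" if "u \<in> \<Omega>" for u by (rule close[OF that])
      show "seminormed (linf d)" by (rule seminormed_cbanach[OF cbanach_linf[OF d0]])
      show "seminormed Y" by (rule seminormed_cbanach[OF Y])
      show "clinear_on cfun Y \<iota>" using iso by (simp add: isometric_def)
      show "continuous_on UNIV F" using E F by (simp add: disjoint_family_in_def)
      show "peaked \<Omega> \<theta> F" using peak F by blast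
      fix f :: "'k \<Rightarrow> real" and x
      assume f: "continuous_on UNIV f" "f x = 1"
      then have fc: "continuous_on UNIV (cplx f)" by (intro continuous_intros)
      then have "nrm Y (\<iota> (cplx f)) = nrm cfun (cplx f)"
        using iso unfolding isometric_def by (simp add: car_cfun)
      moreover have "cmod (cplx f x) \<le> nrm cfun (cplx f)" by (rule nrm_cfun_upper[OF K fc])
      ultimately show "1 \<le> nrm Y (\<iota> (cplx f))" using f(2) by simp
    qed
  qed
  with d(2) show "card E \<le> 2 * k" by linarith
qed

lemma rcp_bounds_packings:
  fixes \<pi> :: "('k::topological_space \<Rightarrow> complex) \<Rightarrow> 'h::chilbert_space \<Rightarrow> 'h"
  assumes K: "compact (UNIV :: 'k set)" and rep: "faithful_rep cfun \<pi>"
  shows "bounds_packings (rcp cfun \<pi>)"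
  unfolding bounds_packings_def
proof (intro allI impI)
  fix \<Omega> \<theta> E k
  assume \<theta>: "0 < \<theta>" and E: "disjoint_family_in E" and peak: "\<forall>F\<in>E. peaked \<Omega> \<theta> F"
    and k: "rcp cfun \<pi> \<Omega> (\<theta> / 2) = enat k"
  have "rcp cfun \<pi> \<Omega> (\<theta> / 2) < enat (Suc k)" using k by simp
  then obtain \<phi> \<psi> B where B: "(\<phi>, \<psi>, B) \<in> CPA cfun \<pi> \<Omega> (\<theta> / 2)" "rank_alg B \<le> k"
    unfolding rcp_def INF_less_iff by (auto simp: less_Suc_eq_le)
  have fd: "fd_cstar_algebra B" and \<phi>: "contractive cfun B \<phi>" and cp: "completely_positive cfun B \<phi>"
    and \<psi>: "contractive B bounded_ops \<psi>"
    and close: "\<And>u. u \<in> \<Omega> \<Longrightarrow> nrm bounded_ops (\<psi> (\<phi> u) - \<pi> u) < \<theta> / 2"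
    using B(1) by (auto simp: CPA_def)
  have "card E \<le> 2 * rank_alg B"
  proof (rule rank_packing[OF E fd \<phi> cp])
    fix F assume F: "F \<in> E"
    show "1/2 < nrm B (\<phi> (cplx F))"
    proof (rule peaked_image_norm[where \<phi> = \<phi> and \<psi> = \<psi> and \<gamma> = \<pi> and \<Omega> = \<Omega>,
          OF _ seminormed_bounded_ops \<phi> \<psi> _ _ _ \<theta>])
      show "nrm bounded_ops (\<psi> (\<phi> u) - \<pi> u) < \<theta> / 2" if "u \<in> \<Omega>" for u by (rule close[OF that])
      show "seminormed B"
        using fd by (intro seminormed_cbanach) (simp add: fd_cstar_algebra_def cstar_algebra_def)
      show "clinear_on cfun bounded_ops \<pi>" using rep by (simp add: faithful_rep_def star_hom_def)
      show "continuous_on UNIV F" using E F by (simp add: disjoint_family_in_def)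
      show "peaked \<Omega> \<theta> F" using peak F by blast
      fix f :: "'k \<Rightarrow> real" and x
      assume f: "continuous_on UNIV f" "\<And>y. 0 \<le> f y \<and> f y \<le> 1" "f x = 1"
      show "1 \<le> nrm bounded_ops (\<pi> (cplx f))"
        by (rule faithful_rep_norming[OF K rep f(1) _ _ f(3)]) (use f(2) in auto)
    qed
  qed
  with B(2) show "card E \<le> 2 * k" by linarith
qed

lemma urysohn_bump:
  fixes x :: "'k::t2_space"
  assumes K: "compact (UNIV :: 'k set)" and U: "open U" "x \<in> U"
  shows "\<exists>h :: 'k \<Rightarrow> real. continuous_on UNIV h \<and> (\<forall>y. 0 \<le> h y) \<and> h x = 1 \<and> (\<forall>y. h y \<noteq> 0 \<longrightarrow> y \<in> U)"
proof -
  have "Hausdorff_space (euclidean :: 'k topology)"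
    unfolding Hausdorff_space_def
  proof (intro allI impI)
    fix a b :: 'k
    assume "a \<in> topspace euclidean \<and> b \<in> topspace euclidean \<and> a \<noteq> b"
    then obtain U V where "open U" "open V" "a \<in> U" "b \<in> V" "U \<inter> V = {}"
      using hausdorff[of a b] by auto
    then show "\<exists>U V. openin euclidean U \<and> openin euclidean V \<and> a \<in> U \<and> b \<in> V \<and> disjnt U V"
      unfolding disjnt_def open_openin[symmetric] by blast
  qed
  moreover have "compact_space (euclidean :: 'k topology)"
    using K by (simp add: compact_space_def)
  ultimately have "normal_space (euclidean :: 'k topology)"
    using compact_Hausdorff_or_regular_imp_normal_space by blast
  moreover have "closedin euclidean (- U)" "closedin euclidean {x}" "disjnt (- U) {x}"
    using U by (auto simp: disjnt_def)
  ultimately obtain h :: "'k \<Rightarrow> real" where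
    h: "continuous_map euclidean (top_of_set {0..1}) h" "h ` (- U) \<subseteq> {0}" "h ` {x} \<subseteq> {1}"
    using Urysohn_lemma[of euclidean "- U" "{x}" 0 1] by auto
  have "continuous_on UNIV h" "\<forall>y. 0 \<le> h y"
    using h(1) by (auto simp: continuous_map_in_subtopology)
  then show ?thesis using h(2,3) by blast
qed

text \<open>
  In a compact Hausdorff space a continuous pseudometric takes the place of a metric, with \<open>c\<close> as
  Lebesgue number of the cover.  It is the \<open>\<ell>\<^sub>1\<close>-distance of the values of a subordinate partition of
  unity \<open>(p\<^sub>a)\<close>: at each \<open>x\<close> some \<open>p\<^sub>a x\<close> is at least \<open>c\<close>, and \<open>p\<^sub>a\<close> stays positive within
  distance \<open>c\<close>.
\<close>

lemma cover_pseudometric: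
  fixes W :: "'k::t2_space set set"
  assumes K: "compact (UNIV :: 'k set)" and W: "finite_open_cover W"
  shows "\<exists>c D s. 0 < (c::real) \<and> (\<forall>x. continuous_on UNIV (D x)) \<and> (\<forall>x. D x x = 0)
    \<and> (\<forall>x y. D x y = D y x) \<and> (\<forall>x y z. D x z \<le> D x y + D y z)
    \<and> (\<forall>x. s x \<in> W) \<and> (\<forall>x y. D x y < c \<longrightarrow> y \<in> s x)"
proof -
  have covW: "\<Union>W = UNIV" and opW: "\<And>U. U \<in> W \<Longrightarrow> open U" using W by (simp_all add: finite_open_cover_def)
  have "\<exists>U h. U \<in> W \<and> continuous_on UNIV h \<and> (\<forall>y. 0 \<le> h y) \<and> h x = (1::real) \<and> (\<forall>y. h y \<noteq> 0 \<longrightarrow> y \<in> U)" for x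
  proof -
    obtain U where "U \<in> W" "x \<in> U" using cover_memE[OF covW] .
    then show ?thesis using urysohn_bump[OF K opW] by blast
  qed
  then obtain U h where h: "\<And>x. U x \<in> W" "\<And>x. continuous_on UNIV (h x)" "\<And>x y. 0 \<le> h x y"
    "\<And>x. h x x = (1::real)" "\<And>x y. h x y \<noteq> 0 \<Longrightarrow> y \<in> U x" by metis
  have "open {y. 0 < h x y}" for x
    using h(2)[of x] by (intro open_Collect_less) auto
  moreover have "UNIV \<subseteq> (\<Union>x\<in>UNIV. {y. 0 < h x y})"
    using h(4) by (auto intro!: exI[of _ "_ :: 'k"] simp: )
  ultimately obtain A where A: "finite A" "UNIV \<subseteq> (\<Union>x\<in>A. {y. 0 < h x y})"
    using compactE_image[OF K, of UNIV "\<lambda>x. {y. 0 < h x y}"] by (metis (no_types, lifting))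
  define t where "t y = (\<Sum>a\<in>A. h a y)" for y
  have t_pos: "0 < t y" for y
  proof -
    obtain a where "a \<in> A" "0 < h a y" using A(2) by auto
    then show ?thesis unfolding t_def using h(3) A(1) by (intro sum_pos2[of _ a]) auto
  qed
  define p where "p a y = h a y / t y" for a y
  have p_cont: "continuous_on UNIV (p a)" for a
    unfolding p_def t_def using h(2) t_pos[unfolded t_def]
    by (intro continuous_intros) (auto simp: less_imp_neq[symmetric])
  have p_nonneg: "0 \<le> p a y" for a y using h(3) t_pos[of y] by (simp add: p_def)
  have p_sum: "(\<Sum>a\<in>A. p a y) = 1" for y
    using t_pos[of y] by (simp add: p_def t_def flip: sum_divide_distrib)
  have "A \<noteq> {}" using p_sum[of undefined] by auto
  then have card: "0 < card A" using A(1) by (simp add: card_gt_0_iff)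
  define c where "c = 1 / real (card A)"
  have "\<exists>a\<in>A. c \<le> p a x" for x
  proof (rule ccontr)
    assume "\<not> ?thesis"
    then have "(\<Sum>a\<in>A. p a x) < (\<Sum>a\<in>A. c)"
      using A(1) \<open>A \<noteq> {}\<close> by (intro sum_strict_mono) (auto simp: not_le)
    then show False using p_sum[of x] card by (simp add: c_def)
  qed
  then obtain a where a: "\<And>x. a x \<in> A" "\<And>x. c \<le> p (a x) x" by metis
  define D where "D x y = (\<Sum>a\<in>A. \<bar>p a x - p a y\<bar>)" for x y
  show ?thesis
  proof (intro exI[of _ c] exI[of _ D] exI[of _ "\<lambda>x. U (a x)"] conjI allI impI)
    show "0 < c" using card by (simp add: c_def)
    show "continuous_on UNIV (D x)" for x
      unfolding D_def by (intro continuous_intros p_cont)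
    show "D x x = 0" for x by (simp add: D_def)
    show "D x y = D y x" for x y by (simp add: D_def abs_minus_commute)
    show "D x z \<le> D x y + D y z" for x y z
      unfolding D_def sum.distrib[symmetric] by (intro sum_mono) linarith
    show "U (a x) \<in> W" for x by (rule h(1))
    show "y \<in> U (a x)" if "D x y < c" for x y
    proof -
      have "\<bar>p (a x) x - p (a x) y\<bar> \<le> D x y"
        unfolding D_def using a(1) A(1) by (intro member_le_sum) auto
      then have "0 < p (a x) y" using that a(2)[of x] by linarith
      then have "h (a x) y \<noteq> 0" by (auto simp: p_def)
      then show ?thesis by (rule h(5))
    qed
  qed
qed

text \<open>
  The members of the \<open>n\<close>-th join whose itinerary follows \<open>s\<close> except at no more than \<open>k\<close> times, where
  it may be arbitrary.
\<close>

primrec hamming_family ::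
    "('k \<Rightarrow> 'k) \<Rightarrow> 'k set set \<Rightarrow> (nat \<Rightarrow> 'k set) \<Rightarrow> nat \<Rightarrow> nat \<Rightarrow> 'k set set" where
  "hamming_family T W s 0 k = {UNIV}"
| "hamming_family T W s (Suc n) k =
    (\<lambda>V. V \<inter> (T ^^ n) -` s n) ` hamming_family T W s n k \<union>
    (case k of 0 \<Rightarrow> {}
      | Suc k' \<Rightarrow> (\<lambda>(V, U). V \<inter> (T ^^ n) -` U) ` (hamming_family T W s n k' \<times> W))"

lemma hamming_family_subset:
  assumes s: "\<And>i. i < n \<Longrightarrow> s i \<in> W"
  shows "hamming_family T W s n k \<subseteq> iterated_join T W n"
  using s
proof (induction n arbitrary: k)
  case (Suc n)
  have IH: "hamming_family T W s n k \<subseteq> iterated_join T W n" for k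
    by (rule Suc.IH) (simp add: Suc.prems)
  have step: "V \<inter> (T ^^ n) -` U \<in> iterated_join T W (Suc n)" if "V \<in> iterated_join T W n" "U \<in> W" for V U
    using that by (auto simp: cover_join_def)
  show ?case
    using IH Suc.prems[of n] step
    by (cases k) (auto simp del: iterated_join.simps)
qed simp

lemma finite_hamming_family: "finite W \<Longrightarrow> finite (hamming_family T W s n k)"
  by (induction n arbitrary: k) (auto split: nat.split)

text \<open>
  A Chernoff-type count: weighting each deviation by \<open>q\<close> turns the recursion into multiplication by
  \<open>1 + card W q\<close>.  Choosing \<open>q\<close> small first and the density of deviations afterwards makes the
  growth rate arbitrarily small.
\<close>

lemma card_hamming_family:
  assumes W: "finite W" and q: "0 < q" "q \<le> (1::real)"
  shows "real (card (hamming_family T W s n k)) \<le> (1 / q) ^ k * (1 + real (card W) * q) ^ n"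
proof (induction n arbitrary: k)
  case 0
  show ?case using q by (simp add: power_divide divide_simps power_le_one)
next
  case (Suc n)
  let ?b = "1 + real (card W) * q"
  let ?H = "\<lambda>k. hamming_family T W s n k"
  note fin = finite_hamming_family[OF W]
  have b: "1 \<le> ?b" using q by simp
  have 1: "real (card ((\<lambda>V. V \<inter> (T ^^ n) -` s n) ` ?H k)) \<le> (1 / q) ^ k * ?b ^ n"
    using card_image_le[OF fin, of "\<lambda>V. V \<inter> (T ^^ n) -` s n" T s n k] Suc[of k] by linarith
  show ?case
  proof (cases k)
    case 0
    have "real (card (hamming_family T W s (Suc n) k)) \<le> ?b ^ n" using 1 0 by simp
    also have "\<dots> \<le> ?b ^ Suc n" using b by simp
    finally show ?thesis using 0 by simp
  next
    case (Suc k')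
    have "card ((\<lambda>(V, U). V \<inter> (T ^^ n) -` U) ` (?H k' \<times> W)) \<le> card (?H k' \<times> W)"
      using fin W by (intro card_image_le) auto
    then have "real (card ((\<lambda>(V, U). V \<inter> (T ^^ n) -` U) ` (?H k' \<times> W))) \<le> real (card (?H k')) * real (card W)"
      by (simp add: card_cartesian_product flip: of_nat_mult)
    also have "\<dots> \<le> ((1 / q) ^ k' * ?b ^ n) * real (card W)"
      by (intro mult_right_mono Suc.IH) simp
    finally have 2: "real (card ((\<lambda>(V, U). V \<inter> (T ^^ n) -` U) ` (?H k' \<times> W))) \<le> (1 / q) ^ k' * ?b ^ n * real (card W)" .
    have "card (hamming_family T W s (Suc n) k) \<le> card ((\<lambda>V. V \<inter> (T ^^ n) -` s n) ` ?H k)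
        + card ((\<lambda>(V, U). V \<inter> (T ^^ n) -` U) ` (?H k' \<times> W))"
      unfolding Suc by (simp add: card_Un_le)
    then have "real (card (hamming_family T W s (Suc n) k))
        \<le> (1 / q) ^ k * ?b ^ n + (1 / q) ^ k' * ?b ^ n * real (card W)"
      using 1 2 by linarith
    also have "\<dots> = (1 / q) ^ k * ?b ^ Suc n"
      using q by (simp add: Suc field_simps)
    finally show ?thesis .
  qed
qed

lemma hamming_family_covers:
  assumes cov: "\<Union>W = UNIV"
  shows "card {i. i < n \<and> (T ^^ i) x \<notin> s i} \<le> k \<Longrightarrow> x \<in> \<Union>(hamming_family T W s n k)"
proof (induction n arbitrary: k)
  case (Suc n)
  let ?bad = "\<lambda>n. {i. i < n \<and> (T ^^ i) x \<notin> s i}"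
  show ?case
  proof (cases "(T ^^ n) x \<in> s n")
    case True
    have "?bad (Suc n) = ?bad n" using True by (auto simp: less_Suc_eq)
    then obtain V where "V \<in> hamming_family T W s n k" "x \<in> V" using Suc by auto
    then show ?thesis using True by auto
  next
    case False
    have "?bad (Suc n) = insert n (?bad n)" using False by (auto simp: less_Suc_eq)
    then have "Suc (card (?bad n)) \<le> k" using Suc.prems by simp
    then obtain k' where k': "k = Suc k'" "card (?bad n) \<le> k'" by (cases k) auto
    obtain V where V: "V \<in> hamming_family T W s n k'" "x \<in> V" using Suc.IH[OF k'(2)] by auto
    obtain U where U: "U \<in> W" "(T ^^ n) x \<in> U" using cover_memE[OF cov] .
    have "V \<inter> (T ^^ n) -` U \<in> hamming_family T W s (Suc n) k"
      using V U by (auto simp: k'(1))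
    then show ?thesis using V U by blast
  qed
qed simp

lemma maximal_disjoint_subfamily:
  assumes fin: "finite (\<F> :: ('a \<Rightarrow> real) set)" and ne: "\<And>F. F \<in> \<F> \<Longrightarrow> \<exists>y. F y \<noteq> 0"
  obtains E where "E \<subseteq> \<F>" "\<And>F G y. F \<in> E \<Longrightarrow> G \<in> E \<Longrightarrow> F \<noteq> G \<Longrightarrow> F y = 0 \<or> G y = 0"
    "\<And>F. F \<in> \<F> \<Longrightarrow> \<exists>G\<in>E. \<exists>y. F y \<noteq> 0 \<and> G y \<noteq> 0"
proof -
  define \<D> where "\<D> = {E. E \<subseteq> \<F> \<and> (\<forall>F\<in>E. \<forall>G\<in>E. F \<noteq> G \<longrightarrow> (\<forall>y. F y = 0 \<or> G y = 0))}"
  have "finite \<D>" using fin by (simp add: \<D>_def)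
  moreover have "{} \<in> \<D>" by (simp add: \<D>_def)
  ultimately obtain E where E: "E \<in> \<D>" and max: "\<And>E'. E' \<in> \<D> \<Longrightarrow> E \<subseteq> E' \<Longrightarrow> E = E'"
    using finite_has_maximal[of \<D>] by blast
  show thesis
  proof (rule that[of E])
    show "E \<subseteq> \<F>" using E by (simp add: \<D>_def)
    show "F y = 0 \<or> G y = 0" if "F \<in> E" "G \<in> E" "F \<noteq> G" for F G y
      using E that by (simp add: \<D>_def)
    fix F assume F: "F \<in> \<F>"
    show "\<exists>G\<in>E. \<exists>y. F y \<noteq> 0 \<and> G y \<noteq> 0"
    proof (rule ccontr)
      assume none: "\<not> ?thesis"
      then have "insert F E \<in> \<D>"
        using E F unfolding \<D>_def by auto
      then have "F \<in> E" using max[of "insert F E"] by blast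
      then show False using none ne[OF F] by blast
    qed
  qed
qed

text \<open>
  The set \<open>\<Omega>\<close> consists of bump functions \<open>g a\<close> at scale \<open>\<eta>\<close> of the pseudometric of the cover, and
  \<open>E\<close> is a maximal disjoint family among the cut-offs \<open>F w\<close> of names \<open>w\<close>.  If the supports of \<open>F w\<close> and
  \<open>F v\<close> meet at \<open>y\<close>, then at most times both \<open>w i\<close> and \<open>v i\<close> are close to \<open>T\<^sup>i y\<close>.  A point \<open>x\<close>
  with name \<open>w\<close> then follows the members of the cover around \<open>v i\<close> at these times.
\<close>

lemma min_subcover_le_packing:
  fixes T :: "'k::t2_space \<Rightarrow> 'k"
  assumes K: "compact (UNIV :: 'k set)" and T: "continuous_on UNIV T" and W: "finite_open_cover W"
  shows "\<exists>\<Omega>. finite \<Omega> \<and> \<Omega> \<subseteq> car cfun \<and>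
    (\<forall>n \<theta> q. 1 \<le> n \<longrightarrow> 0 < \<theta> \<longrightarrow> \<theta> \<le> 1/2 \<longrightarrow> 0 < q \<longrightarrow> q \<le> 1 \<longrightarrow>
      (\<exists>E. disjoint_family_in E \<and> (\<forall>F\<in>E. peaked (\<Union>i<n. (koopman T ^^ i) ` \<Omega>) \<theta> F) \<and>
        real (min_subcover (iterated_join T W n))
          \<le> real (card E) * ((1 / q) powr (4 * \<theta> * real n) * (1 + real (card W) * q) ^ n)))"
proof -
  have finW: "finite W" and covW: "\<Union>W = UNIV" using W by (simp_all add: finite_open_cover_def)
  obtain c :: real and D :: "'k \<Rightarrow> 'k \<Rightarrow> real" and s :: "'k \<Rightarrow> 'k set" where c: "0 < c"
    and D: "\<And>x. continuous_on UNIV (D x)" "\<And>x. D x x = 0" "\<And>x y. D x y = D y x"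
      "\<And>x y z. D x z \<le> D x y + D y z"
    and s: "\<And>x. s x \<in> W" "\<And>x y. D x y < c \<Longrightarrow> y \<in> s x"
    using cover_pseudometric[OF K W] by blast
  \<comment> \<open>The itinerary estimate below passes from \<open>v i\<close> to \<open>T\<^sup>i x\<close> through steps of lengths
    \<open>2 \<eta>\<close>, \<open>2 \<eta>\<close> and \<open>\<eta>\<close>.\<close>
  define \<eta> where "\<eta> = c / 5"
  have \<eta>: "0 < \<eta>" using c by (simp add: \<eta>_def)
  define g where "g a y = min 1 (max 0 (2 - D a y / \<eta>))" for a y
  have g_cont: "continuous_on UNIV (g a)" for a
    unfolding g_def using \<eta> by (intro continuous_intros D(1)) auto
  have g01: "0 \<le> g a y" "g a y \<le> 1" for a y by (auto simp: g_def)
  have g_one: "g a y = 1" if "D a y < \<eta>" for a y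
  proof -
    have "D a y / \<eta> \<le> 1" using that \<eta> by simp
    then show ?thesis by (simp add: g_def)
  qed
  have g_near: "D a y < 2 * \<eta>" if "g a y \<noteq> 0" for a y
  proof -
    have "D a y / \<eta> < 2" using that by (auto simp: g_def max_def split: if_splits)
    then show ?thesis using \<eta> by (simp add: divide_less_eq)
  qed
  have "open {y. D a y < \<eta>}" for a
    using D(1)[of a] by (intro open_Collect_less) auto
  moreover have "UNIV \<subseteq> (\<Union>a\<in>UNIV. {y. D a y < \<eta>})"
  proof
    fix y
    have "D y y < \<eta>" using D(2) \<eta> by simp
    then show "y \<in> (\<Union>a\<in>UNIV. {y. D a y < \<eta>})" by blast
  qed
  ultimately obtain A where A: "finite A" "UNIV \<subseteq> (\<Union>a\<in>A. {y. D a y < \<eta>})"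
    using compactE_image[OF K, of UNIV "\<lambda>a. {y. D a y < \<eta>}"] by (metis (no_types, lifting))
  have name: "\<exists>a\<in>A. D a y < \<eta>" for y using A(2) by auto
  define \<Omega> where "\<Omega> = (\<lambda>a. cplx (g a)) ` A"
  show ?thesis
  proof (intro exI[of _ \<Omega>] conjI allI impI)
    show "finite \<Omega>" using A(1) by (simp add: \<Omega>_def)
    show "\<Omega> \<subseteq> car cfun" using g_cont by (auto simp: \<Omega>_def car_cfun intro!: continuous_intros)
    fix n :: nat and \<theta> q :: real
    assume n: "1 \<le> n" and \<theta>: "0 < \<theta>" "\<theta> \<le> 1/2" and q: "0 < q" "q \<le> 1"
    define f where "f w y = (\<Sum>i<n. g (w i) ((T ^^ i) y)) / real n" for w y
    have f_cont: "continuous_on UNIV (f w)" for w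
      unfolding f_def using n by (intro continuous_intros continuous_on_funpow[OF T g_cont]) auto
    have f_le: "f w y \<le> 1" for w y
    proof -
      have "(\<Sum>i<n. g (w i) ((T ^^ i) y)) \<le> (\<Sum>i<n. 1)" by (intro sum_mono g01)
      then show ?thesis using n by (simp add: f_def)
    qed
    have f_nonneg: "0 \<le> f w y" for w y
      unfolding f_def by (intro divide_nonneg_nonneg sum_nonneg g01) simp
    define F where "F w y = min \<theta> (max 0 (f w y - (1 - 2 * \<theta>))) / \<theta>" for w y
    have F_cont: "continuous_on UNIV (F w)" for w
      unfolding F_def using \<theta> by (intro continuous_intros f_cont) auto
    have F01: "0 \<le> F w y" "F w y \<le> 1" for w y using \<theta> by (auto simp: F_def divide_le_eq)
    have F_cut: "\<bar>f w y - \<theta> * F w y\<bar> \<le> 1 - \<theta>" for w y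
      using \<theta> f_le[of w y] f_nonneg[of w y] by (auto simp: F_def min_def max_def)
    have F_supp: "real (card {i. i < n \<and> g (w i) ((T ^^ i) y) = 0}) < 2 * \<theta> * real n" if "F w y \<noteq> 0" for w y
    proof -
      let ?Z = "{i. i < n \<and> g (w i) ((T ^^ i) y) = 0}"
      have fw: "1 - 2 * \<theta> < f w y"
      proof (rule ccontr)
        assume "\<not> 1 - 2 * \<theta> < f w y"
        then have "max 0 (f w y - (1 - 2 * \<theta>)) = 0" by simp
        then show False using that \<theta> by (simp add: F_def)
      qed
      have "(\<Sum>i<n. g (w i) ((T ^^ i) y)) \<le> (\<Sum>i<n. if i \<in> ?Z then 0 else 1)"
        using g01 by (intro sum_mono) auto
      also have "\<dots> = (\<Sum>i<n. 1 - (if i \<in> ?Z then 1 else 0))" by (intro sum.cong) auto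
      also have "\<dots> = real n - real (card ?Z)"
      proof -
        have "{i \<in> {..<n}. i \<in> ?Z} = ?Z" by auto
        then show ?thesis by (simp add: sum_subtractf sum.inter_filter[symmetric])
      qed
      finally have "f w y * real n \<le> real n - real (card ?Z)" using n by (simp add: f_def)
      moreover have "(1 - 2 * \<theta>) * real n < f w y * real n" using fw n by (intro mult_strict_right_mono) auto
      ultimately show ?thesis by (simp add: algebra_simps)
    qed
    define words where "words = {w \<in> {..<n} \<rightarrow>\<^sub>E A. \<exists>x. f w x = 1}"
    have "finite words" unfolding words_def using A(1) by (simp add: finite_PiE)
    have F_one: "F w x = 1" if "f w x = 1" for w x using that \<theta> by (simp add: F_def)
    obtain E where E: "E \<subseteq> F ` words"
      "\<And>G H y. G \<in> E \<Longrightarrow> H \<in> E \<Longrightarrow> G \<noteq> H \<Longrightarrow> G y = 0 \<or> H y = 0"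
      "\<And>G. G \<in> F ` words \<Longrightarrow> \<exists>H\<in>E. \<exists>y. G y \<noteq> 0 \<and> H y \<noteq> 0"
    proof (rule maximal_disjoint_subfamily[of "F ` words"])
      show "finite (F ` words)" using \<open>finite words\<close> by simp
      show "\<exists>y. G y \<noteq> 0" if G: "G \<in> F ` words" for G
      proof -
        obtain w x where "G = F w" "f w x = 1" using G by (auto simp: words_def)
        then have "G x \<noteq> 0" using F_one by simp
        then show ?thesis by blast
      qed
    qed blast
    have finE: "finite E" using E(1) \<open>finite words\<close> by (meson finite_imageI finite_subset)
    have disj: "disjoint_family_in E"
      unfolding disjoint_family_in_def
    proof (intro conjI ballI allI impI)
      show "finite E" by (rule finE)
      fix G assume "G \<in> E"
      then obtain w where "G = F w" using E(1) by blast
      then show "continuous_on UNIV G" "0 \<le> G y" "G y \<le> 1" for y using F_cont F01 by auto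
    next
      fix G H y assume "G \<in> E" "H \<in> E" "G \<noteq> H"
      then show "G y = 0 \<or> H y = 0" by (rule E(2))
    qed
    have peak: "peaked (\<Union>i<n. (koopman T ^^ i) ` \<Omega>) \<theta> G" if G: "G \<in> E" for G
    proof -
      obtain w x where w: "w \<in> {..<n} \<rightarrow>\<^sub>E A" "f w x = 1" "G = F w" using E(1) G by (auto simp: words_def)
      have wA: "w i \<in> A" if "i < n" for i using w(1) that by auto
      show ?thesis
        unfolding peaked_def
      proof (intro exI[of _ n] exI[of _ "\<lambda>i y. g (w i) ((T ^^ i) y)"] exI[of _ x] conjI allI impI)
        fix i assume i: "i < n"
        have "cplx (\<lambda>y. g (w i) ((T ^^ i) y)) = (koopman T ^^ i) (cplx (g (w i)))"
          by (simp add: koopman_funpow)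
        moreover have "cplx (g (w i)) \<in> \<Omega>" using wA[OF i] by (simp add: \<Omega>_def)
        ultimately show "cplx (\<lambda>y. g (w i) ((T ^^ i) y)) \<in> (\<Union>i<n. (koopman T ^^ i) ` \<Omega>)"
          using i by blast
        show "continuous_on UNIV (\<lambda>y. g (w i) ((T ^^ i) y))"
          by (rule continuous_on_funpow[OF T g_cont])
      next
        show "(\<Sum>i<n. g (w i) ((T ^^ i) x)) / real n = 1" using w(2) by (simp add: f_def)
        show "\<bar>(\<Sum>i<n. g (w i) ((T ^^ i) y)) / real n - \<theta> * G y\<bar> \<le> 1 - \<theta>" for y
          using F_cut[of w y] by (simp add: f_def w(3))
      qed (use n g01 in auto)
    qed
    have "\<forall>G\<in>E. \<exists>w. w \<in> words \<and> G = F w" using E(1) by blast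
    then obtain v where v: "\<And>G. G \<in> E \<Longrightarrow> v G \<in> words" "\<And>G. G \<in> E \<Longrightarrow> G = F (v G)" by metis
    define k where "k = nat \<lfloor>4 * \<theta> * real n\<rfloor>"
    define \<V> where "\<V> = (\<Union>G\<in>E. hamming_family T W (\<lambda>i. s (v G i)) n k)"
    have "x \<in> \<Union>\<V>" for x
    proof -
      have "\<forall>i. \<exists>a\<in>A. D a ((T ^^ i) x) < \<eta>" using name by blast
      then obtain w' where w': "\<And>i. w' i \<in> A" "\<And>i. D (w' i) ((T ^^ i) x) < \<eta>" by metis
      define w where "w = restrict w' {..<n}"
      have w: "w \<in> {..<n} \<rightarrow>\<^sub>E A" "\<And>i. i < n \<Longrightarrow> D (w i) ((T ^^ i) x) < \<eta>"
        using w' by (auto simp: w_def)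
      have "f w x = 1" using n w(2) g_one by (simp add: f_def)
      then have "F w \<in> F ` words" using w(1) by (auto simp: words_def)
      then obtain G y where G: "G \<in> E" "F w y \<noteq> 0" "G y \<noteq> 0" using E(3) by blast
      then have vG: "F (v G) y \<noteq> 0" using v(2) by metis
      let ?Z = "\<lambda>w. {i. i < n \<and> g (w i) ((T ^^ i) y) = 0}"
      have "{i. i < n \<and> (T ^^ i) x \<notin> s (v G i)} \<subseteq> ?Z w \<union> ?Z (v G)"
      proof (rule ccontr)
        assume "\<not> ?thesis"
        then obtain i where i: "i < n" "(T ^^ i) x \<notin> s (v G i)" "g (w i) ((T ^^ i) y) \<noteq> 0"
          "g (v G i) ((T ^^ i) y) \<noteq> 0" by auto
        have "D (v G i) ((T ^^ i) x) \<le> D (v G i) ((T ^^ i) y) + D ((T ^^ i) y) ((T ^^ i) x)" by (rule D(4))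
        also have "D ((T ^^ i) y) ((T ^^ i) x) \<le> D ((T ^^ i) y) (w i) + D (w i) ((T ^^ i) x)" by (rule D(4))
        also have "D ((T ^^ i) y) (w i) = D (w i) ((T ^^ i) y)" by (rule D(3))
        finally have "D (v G i) ((T ^^ i) x) < c"
          using g_near[OF i(3)] g_near[OF i(4)] w(2)[OF i(1)] by (simp add: \<eta>_def)
        then show False using s(2) i(2) by blast
      qed
      then have "card {i. i < n \<and> (T ^^ i) x \<notin> s (v G i)} \<le> card (?Z w \<union> ?Z (v G))"
        by (intro card_mono) auto
      also have "\<dots> \<le> card (?Z w) + card (?Z (v G))" by (rule card_Un_le)
      finally have "real (card {i. i < n \<and> (T ^^ i) x \<notin> s (v G i)}) \<le> 4 * \<theta> * real n"
        using F_supp[OF G(2)] F_supp[OF vG] by linarith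
      then have "card {i. i < n \<and> (T ^^ i) x \<notin> s (v G i)} \<le> k"
        unfolding k_def by (simp add: le_nat_floor)
      then have "x \<in> \<Union>(hamming_family T W (\<lambda>i. s (v G i)) n k)"
        by (rule hamming_family_covers[OF covW])
      then show ?thesis using G(1) by (auto simp: \<V>_def)
    qed
    then have cov: "\<Union>\<V> = UNIV" by (simp add: set_eq_iff)
    have fin\<V>: "finite \<V>" unfolding \<V>_def using finE finite_hamming_family[OF finW] by simp
    have sub: "\<V> \<subseteq> iterated_join T W n"
      unfolding \<V>_def using s(1) by (intro UN_least hamming_family_subset)
    have "min_subcover (iterated_join T W n) \<le> card \<V>" by (rule min_subcover_le[OF fin\<V> sub cov])
    also have "\<dots> \<le> (\<Sum>G\<in>E. card (hamming_family T W (\<lambda>i. s (v G i)) n k))"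
      unfolding \<V>_def by (rule card_UN_le[OF finE])
    finally have "real (min_subcover (iterated_join T W n))
        \<le> (\<Sum>G\<in>E. real (card (hamming_family T W (\<lambda>i. s (v G i)) n k)))"
      by (simp flip: of_nat_sum)
    also have "\<dots> \<le> (\<Sum>G\<in>E. (1 / q) ^ k * (1 + real (card W) * q) ^ n)"
      by (intro sum_mono card_hamming_family finW q)
    also have "\<dots> = real (card E) * ((1 / q) ^ k * (1 + real (card W) * q) ^ n)" by simp
    also have "\<dots> \<le> real (card E) * ((1 / q) powr (4 * \<theta> * real n) * (1 + real (card W) * q) ^ n)"
    proof (intro mult_left_mono mult_right_mono)
      have "(1 / q) ^ k = (1 / q) powr real k" using q by (simp add: powr_realpow)
      also have "\<dots> \<le> (1 / q) powr (4 * \<theta> * real n)"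
        using q \<theta> by (intro powr_mono) (auto simp: k_def)
      finally show "(1 / q) ^ k \<le> (1 / q) powr (4 * \<theta> * real n)" .
    qed (use q in auto)
    finally show "\<exists>E. disjoint_family_in E \<and> (\<forall>F\<in>E. peaked (\<Union>i<n. (koopman T ^^ i) ` \<Omega>) \<theta> F) \<and>
        real (min_subcover (iterated_join T W n))
          \<le> real (card E) * ((1 / q) powr (4 * \<theta> * real n) * (1 + real (card W) * q) ^ n)"
      using disj peak by blast
  qed
qed

text \<open>
  For fixed \<open>q\<close> and \<open>\<theta>\<close> the packing estimate loses \<open>4 \<theta> ln (1/q) + ln (1 + card W q)\<close> in the growth
  rate; first \<open>q\<close> and then \<open>\<theta>\<close> is chosen small.
\<close>

lemma htop_le_entropy:
  fixes T :: "'k::t2_space \<Rightarrow> 'k"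
  assumes K: "compact (UNIV :: 'k set)" and T: "continuous_on UNIV T" and r: "bounds_packings r"
  shows "htop T \<le> entropy_of (car cfun) r (koopman T)"
  unfolding htop_def
proof (rule SUP_least)
  fix W :: "'k set set" assume "W \<in> {W. finite_open_cover W}"
  then have W: "finite_open_cover W" by simp
  have finW: "finite W" and covW: "\<Union>W = UNIV" using W by (simp_all add: finite_open_cover_def)
  let ?N = "\<lambda>n. min_subcover (iterated_join T W n)"
  define L where "L = lim (\<lambda>n. ln (real (?N n)) / real n)"
  have L: "(\<lambda>n. ln (real (?N n)) / real n) \<longlonglongrightarrow> L"
    unfolding L_def by (rule cover_entropy_convergent[OF finW covW])
  obtain \<Omega> where \<Omega>: "finite \<Omega>" "\<Omega> \<subseteq> car cfun"
    and pack: "\<And>n \<theta> q. 1 \<le> n \<Longrightarrow> 0 < \<theta> \<Longrightarrow> \<theta> \<le> 1/2 \<Longrightarrow> 0 < q \<Longrightarrow> q \<le> 1 \<Longrightarrow>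
      \<exists>E. disjoint_family_in E \<and> (\<forall>F\<in>E. peaked (\<Union>i<n. (koopman T ^^ i) ` \<Omega>) \<theta> F) \<and>
        real (?N n) \<le> real (card E) * ((1 / q) powr (4 * \<theta> * real n) * (1 + real (card W) * q) ^ n)"
    using min_subcover_le_packing[OF K T W] by blast
  let ?h = "entropy_of (car cfun) r (koopman T)"
  have bound: "ereal (L - (4 * \<theta> * ln (1 / q) + ln (1 + real (card W) * q))) \<le> ?h"
    if \<theta>: "0 < \<theta>" "\<theta> \<le> 1/2" and q: "0 < q" "q \<le> 1" for \<theta> q
  proof -
    define C where "C = 4 * \<theta> * ln (1 / q) + ln (1 + real (card W) * q)"
    let ?r = "\<lambda>n. r (\<Union>i<n. (koopman T ^^ i) ` \<Omega>) (\<theta> / 2)"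
    have le: "ereal (ln (real (?N n)) / real n - ln 2 / real n - C) \<le> elog (?r n) / ereal (real n)"
      if n: "1 \<le> n" for n
    proof (cases "?r n")
      case infinity
      then show ?thesis using n by (simp add: elog_def)
    next
      case (enat m)
      obtain E where E: "disjoint_family_in E" "\<forall>F\<in>E. peaked (\<Union>i<n. (koopman T ^^ i) ` \<Omega>) \<theta> F"
        and N: "real (?N n) \<le> real (card E) * ((1 / q) powr (4 * \<theta> * real n) * (1 + real (card W) * q) ^ n)"
        using pack[OF n \<theta> q] by blast
      have cE: "card E \<le> 2 * m"
        using r \<theta>(1) E enat unfolding bounds_packings_def by blast
      have N1: "1 \<le> ?N n"
        by (rule min_subcover_pos[OF finite_iterated_join[OF finW] iterated_join_covers[OF covW]])
      have b: "0 < 1 + real (card W) * q" using q by (simp add: add_pos_nonneg)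
      have "0 < real (card E)" using N N1 by (cases "card E = 0") auto
      then have m: "1 \<le> m" using cE by linarith
      have "real (?N n) \<le> (2 * real m) * ((1 / q) powr (4 * \<theta> * real n) * (1 + real (card W) * q) ^ n)"
        using cE b by (intro order_trans[OF N] mult_right_mono) (auto simp flip: of_nat_mult)
      then have "ln (real (?N n)) \<le> ln ((2 * real m) * ((1 / q) powr (4 * \<theta> * real n) * (1 + real (card W) * q) ^ n))"
        using N1 by (intro ln_mono) auto
      also have "\<dots> = ln 2 + ln (real m) + (4 * \<theta> * real n * ln (1 / q) + real n * ln (1 + real (card W) * q))"
        using m q b by (simp add: ln_mult_pos ln_powr ln_realpow)
      also have "\<dots> = ln 2 + ln (real m) + real n * C" by (simp add: C_def algebra_simps)
      finally have "ln (real (?N n)) / real n \<le> (ln 2 + ln (real m) + real n * C) / real n"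
        using n by (intro divide_right_mono) auto
      then have "ln (real (?N n)) / real n - ln 2 / real n - C \<le> ln (real m) / real n"
        using n by (simp add: add_divide_distrib)
      then show ?thesis using n m enat by (simp add: elog_def)
    qed
    have "(\<lambda>n. ln (real (?N n)) / real n - ln 2 / real n - C) \<longlonglongrightarrow> L - 0 - C"
      by (intro tendsto_intros L lim_const_over_n)
    then have "ereal (L - C) = limsup (\<lambda>n. ereal (ln (real (?N n)) / real n - ln 2 / real n - C))"
      by (intro lim_imp_Limsup[symmetric]) auto
    also have "\<dots> \<le> entropy_at r (koopman T) \<Omega> (\<theta> / 2)"
      unfolding entropy_at_def by (intro Limsup_mono eventually_sequentiallyI[of 1] le)
    also have "\<dots> \<le> (SUP \<delta>\<in>{0<..}. entropy_at r (koopman T) \<Omega> \<delta>)"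
      using \<theta> by (intro SUP_upper) simp
    also have "\<dots> \<le> ?h"
      unfolding entropy_of_def using \<Omega> by (intro SUP_upper) simp
    finally show ?thesis by (simp add: C_def)
  qed
  have eps: "ereal (L - \<epsilon>) \<le> ?h" if \<epsilon>: "0 < \<epsilon>" for \<epsilon>
  proof -
    define w where "w = real (card W)"
    have w: "0 \<le> w" by (simp add: w_def)
    define q where "q = min 1 (\<epsilon> / (2 * (w + 1)))"
    have q: "0 < q" "q \<le> 1" using \<epsilon> w by (auto simp: q_def)
    have "ln (1 + w * q) \<le> w * q" using w q by (intro ln_add_one_self_le_self) auto
    also have "\<dots> \<le> (w + 1) * (\<epsilon> / (2 * (w + 1)))"
      using w q \<epsilon> by (intro mult_mono) (auto simp: q_def)
    also have "\<dots> = \<epsilon> / 2"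
    proof -
      have "v * (\<epsilon> / (2 * v)) = \<epsilon> / 2" if "0 < v" for v :: real using that by simp
      from this[of "w + 1"] show ?thesis using w by linarith
    qed
    finally have 1: "ln (1 + w * q) \<le> \<epsilon> / 2" .
    define l where "l = ln (1 / q)"
    have l: "0 \<le> l" using q by (simp add: l_def)
    define \<theta> where "\<theta> = min (1/2) (\<epsilon> / (8 * (l + 1)))"
    have \<theta>: "0 < \<theta>" using \<epsilon> l by (simp add: \<theta>_def)
    have \<theta>_half: "\<theta> \<le> 1/2" unfolding \<theta>_def by (rule min.cobounded1)
    have "4 * \<theta> * l \<le> 4 * (\<epsilon> / (8 * (l + 1))) * (l + 1)"
      using l \<epsilon> \<theta> by (intro mult_mono) (auto simp: \<theta>_def)
    also have "\<dots> = \<epsilon> / 2"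
    proof -
      have "4 * (\<epsilon> / (8 * v)) * v = \<epsilon> / 2" if "0 < v" for v :: real using that by simp
      from this[of "l + 1"] show ?thesis using l by linarith
    qed
    finally have 2: "4 * \<theta> * l \<le> \<epsilon> / 2" .
    have "ereal (L - \<epsilon>) \<le> ereal (L - (4 * \<theta> * ln (1 / q) + ln (1 + real (card W) * q)))"
      using 1 2 by (simp add: l_def w_def)
    also have "\<dots> \<le> ?h" by (rule bound[OF \<theta> \<theta>_half q])
    finally show ?thesis .
  qed
  show "ereal (lim (\<lambda>n. ln (real (?N n)) / real n)) \<le> ?h"
    unfolding L_def[symmetric]
  proof (cases ?h)
    case (real h)
    have "L \<le> h"
    proof (rule field_le_epsilon)
      fix \<epsilon> :: real assume "0 < \<epsilon>"
      then show "L \<le> h + \<epsilon>" using eps[of \<epsilon>] real by simp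
    qed
    then show "ereal L \<le> ?h" using real by simp
  next
    case MInf
    then show "ereal L \<le> ?h" using eps[of 1] by simp
  qed simp
qed

theorem proposition3p1:
  fixes T T' :: "'k::t2_space \<Rightarrow> 'k"
    and \<iota> :: "('k \<Rightarrow> complex) \<Rightarrow> 'y::complex_vector"
    and Y :: "'y nspace"
    and \<pi> :: "('k \<Rightarrow> complex) \<Rightarrow> 'h::chilbert_space \<Rightarrow> 'h"
  assumes "compact (UNIV :: 'k set)"
    and "homeomorphism UNIV UNIV T T'"
    and "faithful_rep cfun \<pi>"
    and "CA_embedding cfun Y \<iota>"
  shows "ht cfun \<pi> (koopman T) = hc cfun Y \<iota> (koopman T)
    \<and> hc cfun Y \<iota> (koopman T) = htop T"
proof -
  have T: "continuous_on UNIV T" using assms(2) by (simp add: homeomorphism_def)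
  have Y: "cbanach Y" and iso: "isometric cfun Y \<iota>" using assms(4) by (simp_all add: CA_embedding_def)
  have hom: "star_hom cfun bounded_ops \<pi>" using assms(3) by (simp add: faithful_rep_def)
  have "ht cfun \<pi> (koopman T) = htop T"
    unfolding ht_def
  proof (rule antisym)
    show "entropy_of (car cfun) (rcp cfun \<pi>) (koopman T) \<le> htop T"
      by (rule entropy_le_htop[OF assms(1) T]) (rule rcp_le_of_approximable[OF assms(1) hom])
    show "htop T \<le> entropy_of (car cfun) (rcp cfun \<pi>) (koopman T)"
      by (rule htop_le_entropy[OF assms(1) T rcp_bounds_packings[OF assms(1,3)]])
  qed
  moreover have "hc cfun Y \<iota> (koopman T) = htop T"
    unfolding hc_def
  proof (rule antisym)
    show "entropy_of (car cfun) (rc cfun Y \<iota>) (koopman T) \<le> htop T"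
      by (rule entropy_le_htop[OF assms(1) T]) (rule rc_le_of_approximable[OF assms(1) iso])
    show "htop T \<le> entropy_of (car cfun) (rc cfun Y \<iota>) (koopman T)"
      by (rule htop_le_entropy[OF assms(1) T rc_bounds_packings[OF assms(1) Y iso]])
  qed
  ultimately show ?thesis by simp
qed

end
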